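(* There is an algorithm which, given a CNF formula $F$ with $n$ variables and $m$ clauses together with a branch decomposition $(T,\delta)$ of $F$ of $\mathtt{ps}$-width $k$, computes the families $\mathtt{PS}(F_v)$ and $\mathtt{PS}(F_{\overline{v}})$ for every node $v$ of $T$ in time $\mathcal{O}(k^2\log(k)\,m(m+n))$.
   Context: A literal is a propositional variable $x$ or its negation $\neg x$; a clause is a finite set of literals; a CNF formula $F$ is a finite multiset of clauses, and $\mathtt{cla}(F)$ denotes its clauses (equal clauses are treated as distinct elements). For a clause $C$, $\mathtt{var}(C)$ is the set of variables of its literals, and $\mathtt{var}(F)=\bigcup_{C\in\mathtt{cla}(F)}\mathtt{var}(C)$. An assignment of a set $X$ of variables is a map $\tau:X\to\{0,1\}$, extended to literals by $\tau(\neg x)=1-\tau(x)$; it satisfies a clause if some literal of the clause gets value $1$ (so the empty clause is never satisfied). For a clause $C$ and a set $X$ of variables, $C|_X=\{\ell\in C:\mathtt{var}(\ell)\in X\}$. For $\mathcal{C}\subseteq\mathtt{cla}(F)$ and $X\subseteq\mathtt{var}(F)$, $F_{\mathcal{C},X}$ is the formula with clauses $\{C|_X : C\in\mathcal{C}\}$ (its clauses are identified with the clauses of $\mathcal{C}$ they come from). For a formula $F$ and an assignment $\tau$ of $\mathtt{var}(F)$, $\mathtt{sat}(F,\tau)$ is the set of clauses of $F$ satisfied by $\tau$, and $\mathtt{PS}(F)=\{\mathtt{sat}(F,\tau):\tau \text{ an assignment of } \mathtt{var}(F)\}$ (the precisely satisfiable sets of $F$). A branch decomposition of $F$ is a pair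 $(T,\delta)$ where $T$ is a rooted binary tree and $\delta$ is a bijection from the leaves of $T$ to $\mathtt{cla}(F)\cup\mathtt{var}(F)$. For a node $v$ of $T$, $\delta(v)$ denotes the set of $\delta(l)$ over all leaves $l$ of the subtree rooted at $v$. Writing $\delta(v)=\mathcal{C}\cup X$ with $\mathcal{C}\subseteq\mathtt{cla}(F)$, $X\subseteq\mathtt{var}(F)$, let $F_v=F_{\mathtt{cla}(F)\setminus\mathcal{C},\,X}$ and $F_{\overline{v}}=F_{\mathcal{C},\,\mathtt{var}(F)\setminus X}$. The $\mathtt{ps}$-value of the cut is $\mathtt{ps}(\delta(v))=\max\{|\mathtt{PS}(F_v)|,|\mathtt{PS}(F_{\overline{v}})|\}$, and the $\mathtt{ps}$-width of $(T,\delta)$ is the maximum of $\mathtt{ps}(\delta(v))$ over all nodes $v$ of $T$. *)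

theory Defs
  imports Complex_Main "HOL-Library.FuncSet"
begin

datatype 'v literal = Pos (lit_var: 'v) | Neg (lit_var: 'v)

text \<open>A finite multiset of clauses whose members are all kept apart is given as a family: a set
  \<open>cla\<close> of clause identities, and for each of them its set of literals. Two identities may carry
  the same literals. The values of \<open>lits\<close> outside \<open>cla\<close> are irrelevant.\<close>

record ('c, 'v) cnf =
  cla :: "'c set"
  lits :: "'c \<Rightarrow> 'v literal set"

definition wf_cnf :: "('c, 'v) cnf \<Rightarrow> bool" where
  "wf_cnf F \<longleftrightarrow> finite (cla F) \<and> (\<forall>c\<in>cla F. finite (lits F c))"

definition vars :: "('c, 'v) cnf \<Rightarrow> 'v set" where
  "vars F = (\<Union>c\<in>cla F. lit_var ` lits F c)"

definition assignments :: "'v set \<Rightarrow> ('v \<Rightarrow> bool) set" where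
  "assignments X = (X \<rightarrow>\<^sub>E UNIV)"

fun lit_val :: "('v \<Rightarrow> bool) \<Rightarrow> 'v literal \<Rightarrow> bool" where
  "lit_val \<tau> (Pos x) = \<tau> x"
| "lit_val \<tau> (Neg x) = (\<not> \<tau> x)"

definition sat :: "('c, 'v) cnf \<Rightarrow> ('v \<Rightarrow> bool) \<Rightarrow> 'c set" where
  "sat F \<tau> = {c \<in> cla F. \<exists>l\<in>lits F c. lit_val \<tau> l}"

definition PS :: "('c, 'v) cnf \<Rightarrow> 'c set set" where
  "PS F = {sat F \<tau> | \<tau>. \<tau> \<in> assignments (vars F)}"

text \<open>The formula $F_{\mathcal C,X}$. Restricted clauses keep the identity of the clause they come
  from, so precisely satisfiable sets of restrictions are sets of clauses of the original formula.\<close>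

definition restr :: "('c, 'v) cnf \<Rightarrow> 'c set \<Rightarrow> 'v set \<Rightarrow> ('c, 'v) cnf" where
  "restr F C X = \<lparr>cla = C, lits = (\<lambda>c. {l \<in> lits F c. lit_var l \<in> X})\<rparr>"

text \<open>Rooted binary trees in which every internal node has two children. The label of a leaf is its
  image under $\delta$.\<close>

datatype 'a btree = Leaf 'a | Branch "'a btree" "'a btree"

fun leaves :: "'a btree \<Rightarrow> 'a list" where
  "leaves (Leaf a) = [a]"
| "leaves (Branch l r) = leaves l @ leaves r"

text \<open>A node is represented by the subtree rooted at it; when the leaf labels are distinct this is
  a one-to-one correspondence. The list is in preorder.\<close>

fun nodes :: "'a btree \<Rightarrow> 'a btree list" where
  "nodes (Leaf a) = [Leaf a]"
| "nodes (Branch l r) = Branch l r # nodes l @ nodes r"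

definition branch_decomposition :: "('c, 'v) cnf \<Rightarrow> ('c + 'v) btree \<Rightarrow> bool" where
  "branch_decomposition F T \<longleftrightarrow>
     distinct (leaves T) \<and> set (leaves T) = Inl ` cla F \<union> Inr ` vars F"

definition clauses_below :: "('c + 'v) btree \<Rightarrow> 'c set" where
  "clauses_below v = {c. Inl c \<in> set (leaves v)}"

definition vars_below :: "('c + 'v) btree \<Rightarrow> 'v set" where
  "vars_below v = {x. Inr x \<in> set (leaves v)}"

text \<open>\<open>F_node F v\<close> is $F_v$ and \<open>F_conode F v\<close> is $F_{\overline v}$.\<close>

definition F_node :: "('c, 'v) cnf \<Rightarrow> ('c + 'v) btree \<Rightarrow> ('c, 'v) cnf" where
  "F_node F v = restr F (cla F - clauses_below v) (vars_below v)"

definition F_conode :: "('c, 'v) cnf \<Rightarrow> ('c + 'v) btree \<Rightarrow> ('c, 'v) cnf" where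
  "F_conode F v = restr F (clauses_below v) (vars F - vars_below v)"

definition ps_value :: "('c, 'v) cnf \<Rightarrow> ('c + 'v) btree \<Rightarrow> nat" where
  "ps_value F v = max (card (PS (F_node F v))) (card (PS (F_conode F v)))"

definition ps_width :: "('c, 'v) cnf \<Rightarrow> ('c + 'v) btree \<Rightarrow> nat" where
  "ps_width F T = Max (ps_value F ` set (nodes T))"

text \<open>Structured programs over finitely many registers and a memory addressed by words, with unit
  cost for every elementary operation. All values that occur must be smaller than a bound \<open>B\<close>,
  i.e. fit into a machine word: a computation that exceeds \<open>B\<close> has no derivation in \<open>exec\<close>.
  This excludes packing unboundedly much data into one word. \<open>Sub\<close> is truncated subtraction.\<close>

datatype exp = Const nat | Reg nat | Load exp | Add exp exp | Sub exp exp

datatype test = Less exp exp | Leq exp exp | Eq exp exp | Neq exp exp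

datatype com =
    Skip
  | Assign nat exp
  | Store exp exp
  | Seq com com
  | Cond test com com
  | While test com

record state =
  reg :: "nat \<Rightarrow> nat"
  mem :: "nat \<Rightarrow> nat"

fun eval_exp :: "state \<Rightarrow> exp \<Rightarrow> nat" where
  "eval_exp s (Const k) = k"
| "eval_exp s (Reg r) = reg s r"
| "eval_exp s (Load e) = mem s (eval_exp s e)"
| "eval_exp s (Add e f) = eval_exp s e + eval_exp s f"
| "eval_exp s (Sub e f) = eval_exp s e - eval_exp s f"

fun fits_exp :: "nat \<Rightarrow> state \<Rightarrow> exp \<Rightarrow> bool" where
  "fits_exp B s (Const k) \<longleftrightarrow> k < B"
| "fits_exp B s (Reg r) \<longleftrightarrow> reg s r < B"
| "fits_exp B s (Load e) \<longleftrightarrow> fits_exp B s e \<and> mem s (eval_exp s e) < B"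
| "fits_exp B s (Add e f) \<longleftrightarrow>
     fits_exp B s e \<and> fits_exp B s f \<and> eval_exp s e + eval_exp s f < B"
| "fits_exp B s (Sub e f) \<longleftrightarrow> fits_exp B s e \<and> fits_exp B s f"

fun cost_exp :: "exp \<Rightarrow> nat" where
  "cost_exp (Const k) = 1"
| "cost_exp (Reg r) = 1"
| "cost_exp (Load e) = 1 + cost_exp e"
| "cost_exp (Add e f) = 1 + cost_exp e + cost_exp f"
| "cost_exp (Sub e f) = 1 + cost_exp e + cost_exp f"

fun eval_test :: "state \<Rightarrow> test \<Rightarrow> bool" where
  "eval_test s (Less e f) \<longleftrightarrow> eval_exp s e < eval_exp s f"
| "eval_test s (Leq e f) \<longleftrightarrow> eval_exp s e \<le> eval_exp s f"
| "eval_test s (Eq e f) \<longleftrightarrow> eval_exp s e = eval_exp s f"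
| "eval_test s (Neq e f) \<longleftrightarrow> eval_exp s e \<noteq> eval_exp s f"

fun fits_test :: "nat \<Rightarrow> state \<Rightarrow> test \<Rightarrow> bool" where
  "fits_test B s (Less e f) \<longleftrightarrow> fits_exp B s e \<and> fits_exp B s f"
| "fits_test B s (Leq e f) \<longleftrightarrow> fits_exp B s e \<and> fits_exp B s f"
| "fits_test B s (Eq e f) \<longleftrightarrow> fits_exp B s e \<and> fits_exp B s f"
| "fits_test B s (Neq e f) \<longleftrightarrow> fits_exp B s e \<and> fits_exp B s f"

fun cost_test :: "test \<Rightarrow> nat" where
  "cost_test (Less e f) = 1 + cost_exp e + cost_exp f"
| "cost_test (Leq e f) = 1 + cost_exp e + cost_exp f"
| "cost_test (Eq e f) = 1 + cost_exp e + cost_exp f"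
| "cost_test (Neq e f) = 1 + cost_exp e + cost_exp f"

text \<open>\<open>exec B p s t s'\<close>: started in \<open>s\<close>, program \<open>p\<close> halts in \<open>s'\<close> after time \<open>t\<close>, and all values
  on the way are smaller than \<open>B\<close>.\<close>

inductive exec :: "nat \<Rightarrow> com \<Rightarrow> state \<Rightarrow> nat \<Rightarrow> state \<Rightarrow> bool" for B where
  Skip: "exec B Skip s 1 s"
| Assign: "fits_exp B s e \<Longrightarrow>
    exec B (Assign r e) s (1 + cost_exp e) (s\<lparr>reg := (reg s)(r := eval_exp s e)\<rparr>)"
| Store: "fits_exp B s a \<Longrightarrow> fits_exp B s e \<Longrightarrow>
    exec B (Store a e) s (1 + cost_exp a + cost_exp e)
      (s\<lparr>mem := (mem s)(eval_exp s a := eval_exp s e)\<rparr>)"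
| Seq: "exec B p s t s' \<Longrightarrow> exec B q s' u s'' \<Longrightarrow> exec B (Seq p q) s (t + u) s''"
| CondTrue: "fits_test B s b \<Longrightarrow> eval_test s b \<Longrightarrow> exec B p s t s' \<Longrightarrow>
    exec B (Cond b p q) s (cost_test b + t) s'"
| CondFalse: "fits_test B s b \<Longrightarrow> \<not> eval_test s b \<Longrightarrow> exec B q s t s' \<Longrightarrow>
    exec B (Cond b p q) s (cost_test b + t) s'"
| WhileFalse: "fits_test B s b \<Longrightarrow> \<not> eval_test s b \<Longrightarrow>
    exec B (While b p) s (cost_test b) s"
| WhileTrue: "fits_test B s b \<Longrightarrow> eval_test s b \<Longrightarrow> exec B p s t s' \<Longrightarrow>
    exec B (While b p) s' u s'' \<Longrightarrow> exec B (While b p) s (cost_test b + t + u) s''"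

text \<open>The input occupies an initial segment of the memory; everything else is zero. The output is
  a memory segment whose start address is left in register 0.\<close>

definition initial_state :: "nat list \<Rightarrow> state" where
  "initial_state ws = \<lparr>reg = (\<lambda>_. 0), mem = (\<lambda>i. if i < length ws then ws ! i else 0)\<rparr>"

definition output_is :: "state \<Rightarrow> nat list \<Rightarrow> bool" where
  "output_is s ws \<longleftrightarrow> (\<forall>i<length ws. mem s (reg s 0 + i) = ws ! i)"

text \<open>Variables and clauses are passed to the machine as numbers below $n$ and $m$, by arbitrary
  bijections \<open>\<nu>\<close> and \<open>\<gamma>\<close>.\<close>

definition numbering :: "('a \<Rightarrow> nat) \<Rightarrow> 'a set \<Rightarrow> bool" where
  "numbering \<phi> A \<longleftrightarrow> bij_betw \<phi> A {..<card A}"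

fun lit_code :: "('v \<Rightarrow> nat) \<Rightarrow> 'v literal \<Rightarrow> nat" where
  "lit_code \<nu> (Pos x) = 2 * \<nu> x"
| "lit_code \<nu> (Neg x) = 2 * \<nu> x + 1"

definition encodes_clause :: "('v \<Rightarrow> nat) \<Rightarrow> 'v literal set \<Rightarrow> nat list \<Rightarrow> bool" where
  "encodes_clause \<nu> C ws \<longleftrightarrow>
     (\<exists>ls. distinct ls \<and> set ls = C \<and> ws = length ls # map (lit_code \<nu>) ls)"

definition encodes_cnf ::
    "('c \<Rightarrow> nat) \<Rightarrow> ('v \<Rightarrow> nat) \<Rightarrow> ('c, 'v) cnf \<Rightarrow> nat list \<Rightarrow> bool" where
  "encodes_cnf \<gamma> \<nu> F ws \<longleftrightarrow>
     (\<exists>wss. length wss = card (cla F) \<and>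
        (\<forall>c\<in>cla F. encodes_clause \<nu> (lits F c) (wss ! \<gamma> c)) \<and>
        ws = card (vars F) # card (cla F) # concat wss)"

fun tree_code :: "('c \<Rightarrow> nat) \<Rightarrow> ('v \<Rightarrow> nat) \<Rightarrow> ('c + 'v) btree \<Rightarrow> nat list" where
  "tree_code \<gamma> \<nu> (Leaf (Inl c)) = [1, \<gamma> c]"
| "tree_code \<gamma> \<nu> (Leaf (Inr x)) = [2, \<nu> x]"
| "tree_code \<gamma> \<nu> (Branch l r) = 0 # tree_code \<gamma> \<nu> l @ tree_code \<gamma> \<nu> r"

definition encodes_input ::
    "('c \<Rightarrow> nat) \<Rightarrow> ('v \<Rightarrow> nat) \<Rightarrow> ('c, 'v) cnf \<Rightarrow> ('c + 'v) btree \<Rightarrow> nat list \<Rightarrow> bool" where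
  "encodes_input \<gamma> \<nu> F T ws \<longleftrightarrow>
     (\<exists>fs. encodes_cnf \<gamma> \<nu> F fs \<and> ws = fs @ tree_code \<gamma> \<nu> T)"

definition char_vec :: "('c \<Rightarrow> nat) \<Rightarrow> nat \<Rightarrow> 'c set \<Rightarrow> nat list" where
  "char_vec \<gamma> m S = map (\<lambda>j. of_bool (j \<in> \<gamma> ` S)) [0..<m]"

definition encodes_family :: "('c \<Rightarrow> nat) \<Rightarrow> nat \<Rightarrow> 'c set set \<Rightarrow> nat list \<Rightarrow> bool" where
  "encodes_family \<gamma> m \<S> ws \<longleftrightarrow>
     (\<exists>Ss. distinct Ss \<and> set Ss = \<S> \<and> ws = length Ss # concat (map (char_vec \<gamma> m) Ss))"

text \<open>The families of all nodes, the nodes being listed in the same order as in the input.\<close>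

definition encodes_output ::
    "('c \<Rightarrow> nat) \<Rightarrow> ('c, 'v) cnf \<Rightarrow> ('c + 'v) btree \<Rightarrow> nat list \<Rightarrow> bool" where
  "encodes_output \<gamma> F T ws \<longleftrightarrow>
     (\<exists>wss. list_all2
        (\<lambda>v us. \<exists>as bs. us = as @ bs \<and>
           encodes_family \<gamma> (card (cla F)) (PS (F_node F v)) as \<and>
           encodes_family \<gamma> (card (cla F)) (PS (F_conode F v)) bs)
        (nodes T) wss \<and> ws = concat wss)"

text \<open>$k^2\log(k)\,m(m+n)$. The logarithm is replaced by 1 for $k=1$, where it vanishes.\<close>

definition time_bound :: "nat \<Rightarrow> nat \<Rightarrow> nat \<Rightarrow> real" where
  "time_bound k m n = (real k)\<^sup>2 * max 1 (log 2 (real k)) * real m * (real m + real n)"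

end

theory Submission
  imports Defs
begin

text \<open>For a node with children \<open>l\<close>, \<open>r\<close>, a precisely satisfiable set of $F_v$ is the union of one of
  $F_l$ and one of $F_r$, cut down to the clauses not below \<open>v\<close>, since assignments of the two sides can
  be chosen independently. Likewise the sets of $F_{\overline l}$ are the unions of one of
  $F_{\overline v}$ and one of $F_r$, cut down to the clauses below \<open>l\<close>. So all families follow from
  at most \<open>k\<^sup>2\<close> unions of sets per node, first bottom-up, then top-down.
  Duplicates are removed by inserting the characteristic vectors into a trie, which takes time
  linear in \<open>m\<close> for each union, so that no sorting (and no logarithm) is needed.

  The program allocates all its data at increasing addresses and hardly ever overwrites anything: what
  lies below the allocation pointer is persistent, and what lies above it is zero.\<close>

subsection \<open>Runs with unbounded words\<close>

text \<open>The obstacle is the word bound: \<open>exec\<close> has no derivation once a value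
  reaches the bound, and carrying bounds through every invariant would swamp the argument. They are
  recovered at the end from the program text instead. If each stored value is a register, a loaded
  word or a constant, changed only by adding constants or by subtraction (\<open>slow\<close>),
  stored values grow by at most a constant per instruction and are linear in the elapsed time. The
  price is that sums of registers may occur in addresses and tests but are never stored, so offsets
  depending on \<open>m\<close> and \<open>n\<close> are reached by counting loops. The time comes
  from a count of products: one per node for each of its two families except for the root's
  complement, each on at most \<open>2 * k * k\<close> pairs at a cost linear in \<open>m\<close>.
  There are fewer than \<open>2 * (m + n)\<close> nodes. A clause has at most \<open>2 * n\<close>
  literals, so the input can be read within the same bound. Since a tree has a leaf,
  \<open>m\<close> and \<open>k\<close> are positive, which absorbs all additive constants. The
  address 0 is the null pointer throughout, so fresh memory already reads as an absent child or the
  end of a list.\<close>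

lemma fits_exp_mono: "fits_exp B s e \<Longrightarrow> B \<le> B' \<Longrightarrow> fits_exp B' s e"
  by (induction e) auto

lemma fits_test_mono: "fits_test B s b \<Longrightarrow> B \<le> B' \<Longrightarrow> fits_test B' s b"
  by (cases b) (auto elim!: fits_exp_mono)

text \<open>A value that fits a bound fits every larger one. Runs found with different bounds can
  therefore be composed under the maximum of the bounds.\<close>

lemma exec_mono: "exec B p s t s' \<Longrightarrow> B \<le> B' \<Longrightarrow> exec B' p s t s'"
proof (induction rule: exec.induct)
  case (WhileTrue s b p t s' u s'')
  then show ?case using exec.WhileTrue fits_test_mono by blast
next
  case (WhileFalse s b p)
  then show ?case using exec.WhileFalse fits_test_mono by blast
next
  case (CondTrue s b p t s' q)
  then show ?case using exec.CondTrue fits_test_mono by blast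
next
  case (CondFalse s b q t s' p)
  then show ?case using exec.CondFalse fits_test_mono by blast
next
  case (Seq p s t s' q u s'')
  then show ?case using exec.Seq by blast
next
  case (Store s a e)
  then show ?case using exec.Store fits_exp_mono by blast
next
  case (Assign s e r)
  then show ?case using exec.Assign fits_exp_mono by blast
next
  case (Skip s)
  then show ?case using exec.Skip by blast
qed

lemma ex_fits_exp: "\<exists>B. fits_exp B s e"
proof (induction e)
  case (Load e)
  then obtain B where "fits_exp B s e" ..
  then show ?case
    by (intro exI[of _ "max B (Suc (mem s (eval_exp s e)))"])
      (use fits_exp_mono[OF _ max.cobounded1] in auto)
next
  case (Add e f)
  then obtain B C where "fits_exp B s e" "fits_exp C s f" by auto
  then show ?case
    by (intro exI[of _ "max (max B C) (Suc (eval_exp s e + eval_exp s f))"])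
      (auto elim!: fits_exp_mono)
next
  case (Sub e f)
  then obtain B C where "fits_exp B s e" "fits_exp C s f" by auto
  then show ?case by (intro exI[of _ "max B C"]) (auto elim!: fits_exp_mono)
qed auto

lemma ex_fits_exp2: "\<exists>B. fits_exp B s e \<and> fits_exp B s f"
  using ex_fits_exp[of s e] ex_fits_exp[of s f]
  by (blast intro: fits_exp_mono[OF _ max.cobounded1] fits_exp_mono[OF _ max.cobounded2])

lemma ex_fits_test: "\<exists>B. fits_test B s b"
  by (cases b) (use ex_fits_exp2 in auto)

inductive_cases SkipE: "exec B Skip s t s'"
inductive_cases AssignE: "exec B (Assign r e) s t s'"
inductive_cases StoreE: "exec B (Store a e) s t s'"
inductive_cases SeqE: "exec B (Seq p q) s t s'"
inductive_cases CondE: "exec B (Cond b p q) s t s'"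

text \<open>The bound is hidden existentially. A single expression always has some bound, and
  \<open>exec_mono\<close> merges the bounds of the parts, so the laws below mention no word
  size.\<close>

definition run :: "com \<Rightarrow> state \<Rightarrow> nat \<Rightarrow> state \<Rightarrow> bool" where
  "run p s t s' \<longleftrightarrow> (\<exists>B. exec B p s t s')"

lemma run_Seq:
  assumes "run p s t s'" "run q s' u s''"
  shows "run (Seq p q) s (t + u) s''"
proof -
  obtain B C where "exec B p s t s'" "exec C q s' u s''" using assms unfolding run_def by auto
  then have "exec (max B C) p s t s'" "exec (max B C) q s' u s''"
    using exec_mono max.cobounded1 max.cobounded2 by blast+
  then show ?thesis using exec.Seq unfolding run_def by blast
qed

lemma run_CondTrue:
  assumes "eval_test s b" "run p s t s'"
  shows "run (Cond b p q) s (cost_test b + t) s'"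
proof -
  obtain B C where "exec B p s t s'" "fits_test C s b"
    using assms ex_fits_test[of s b] unfolding run_def by auto
  then have "exec (max B C) p s t s'" "fits_test (max B C) s b"
    using exec_mono fits_test_mono max.cobounded1 max.cobounded2 by blast+
  then show ?thesis using assms exec.CondTrue unfolding run_def by blast
qed

lemma run_CondFalse:
  assumes "\<not> eval_test s b" "run q s t s'"
  shows "run (Cond b p q) s (cost_test b + t) s'"
proof -
  obtain B C where "exec B q s t s'" "fits_test C s b"
    using assms ex_fits_test[of s b] unfolding run_def by auto
  then have "exec (max B C) q s t s'" "fits_test (max B C) s b"
    using exec_mono fits_test_mono max.cobounded1 max.cobounded2 by blast+
  then show ?thesis using assms exec.CondFalse unfolding run_def by blast
qed

lemma run_WhileFalse: "\<not> eval_test s b \<Longrightarrow> run (While b p) s (cost_test b) s"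
  unfolding run_def using ex_fits_test[of s b] exec.WhileFalse by blast

lemma run_WhileTrue:
  assumes "eval_test s b" "run p s t s'" "run (While b p) s' u s''"
  shows "run (While b p) s (cost_test b + t + u) s''"
proof -
  obtain B C D where "exec B p s t s'" "fits_test C s b" "exec D (While b p) s' u s''"
    using assms ex_fits_test[of s b] unfolding run_def by auto
  moreover have "B \<le> max B (max C D)" "C \<le> max B (max C D)" "D \<le> max B (max C D)" by auto
  ultimately have "exec (max B (max C D)) p s t s'" "fits_test (max B (max C D)) s b"
     "exec (max B (max C D)) (While b p) s' u s''"
    using exec_mono fits_test_mono by blast+
  then show ?thesis using assms exec.WhileTrue unfolding run_def by blast
qed

text \<open>A syntactic over-approximation of the registers that a run changes; it supplies the
  frame conditions of loops and subprograms.\<close>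

fun wregs :: "com \<Rightarrow> nat set" where
  "wregs Skip = {}"
| "wregs (Assign r e) = {r}"
| "wregs (Store a e) = {}"
| "wregs (Seq p q) = wregs p \<union> wregs q"
| "wregs (Cond b p q) = wregs p \<union> wregs q"
| "wregs (While b p) = wregs p"

lemma exec_frame: "exec B p s t s' \<Longrightarrow> r \<notin> wregs p \<Longrightarrow> reg s' r = reg s r"
  by (induction rule: exec.induct) auto

subsection \<open>Weakest preconditions\<close>

text \<open>Total correctness with running time: the postcondition also receives the time used.
  Times are added inside the postcondition, so that the equations below let the simplifier execute
  straight-line code symbolically.\<close>

definition wp :: "com \<Rightarrow> (nat \<Rightarrow> state \<Rightarrow> bool) \<Rightarrow> state \<Rightarrow> bool" where
  "wp p Q s \<longleftrightarrow> (\<exists>t s'. run p s t s' \<and> Q t s')"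

lemma wp_Skip [simp]: "wp Skip Q s \<longleftrightarrow> Q 1 s"
  unfolding wp_def run_def using exec.Skip by (fastforce elim: SkipE)

lemma wp_Assign [simp]:
  "wp (Assign r e) Q s \<longleftrightarrow> Q (1 + cost_exp e) (s\<lparr>reg := (reg s)(r := eval_exp s e)\<rparr>)"
proof -
  obtain B where "fits_exp B s e" using ex_fits_exp by blast
  from exec.Assign[OF this, of r] show ?thesis
    unfolding wp_def run_def by - (rule iffI, elim exE conjE AssignE, simp, blast)
qed

lemma wp_Store [simp]:
  "wp (Store a e) Q s \<longleftrightarrow>
     Q (1 + cost_exp a + cost_exp e) (s\<lparr>mem := (mem s)(eval_exp s a := eval_exp s e)\<rparr>)"
proof -
  obtain B where "fits_exp B s a" "fits_exp B s e" using ex_fits_exp2 by blast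
  from exec.Store[OF this] show ?thesis
    unfolding wp_def run_def by - (rule iffI, elim exE conjE StoreE, simp, blast)
qed

lemma wp_Seq [simp]:
  "wp (Seq p q) Q s \<longleftrightarrow> wp p (\<lambda>t s'. wp q (\<lambda>u s''. Q (t + u) s'') s') s"
  unfolding wp_def
proof (safe)
  fix t s' assume "run (Seq p q) s t s'" "Q t s'"
  then show "\<exists>t s'. run p s t s' \<and> (\<exists>u s''. run q s' u s'' \<and> Q (t + u) s'')"
    unfolding run_def by (blast elim: SeqE)
qed (blast intro: run_Seq)

lemma wp_Cond [simp]:
  "wp (Cond b p q) Q s \<longleftrightarrow>
     (if eval_test s b then wp p (\<lambda>t. Q (cost_test b + t)) s
      else wp q (\<lambda>t. Q (cost_test b + t)) s)"
proof -
  have "eval_test s b \<Longrightarrow> wp (Cond b p q) Q s \<Longrightarrow> wp p (\<lambda>t. Q (cost_test b + t)) s"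
    unfolding wp_def run_def by (auto elim!: CondE)
  moreover have "\<not> eval_test s b \<Longrightarrow> wp (Cond b p q) Q s \<Longrightarrow> wp q (\<lambda>t. Q (cost_test b + t)) s"
    unfolding wp_def run_def by (auto elim!: CondE)
  moreover have "eval_test s b \<Longrightarrow> wp p (\<lambda>t. Q (cost_test b + t)) s \<Longrightarrow> wp (Cond b p q) Q s"
    unfolding wp_def by (blast intro: run_CondTrue)
  moreover have "\<not> eval_test s b \<Longrightarrow> wp q (\<lambda>t. Q (cost_test b + t)) s \<Longrightarrow> wp (Cond b p q) Q s"
    unfolding wp_def by (blast intro: run_CondFalse)
  ultimately show ?thesis by auto
qed

lemma wp_mono: "wp p Q s \<Longrightarrow> (\<And>t s'. Q t s' \<Longrightarrow> Q' t s') \<Longrightarrow> wp p Q' s"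
  unfolding wp_def by blast

text \<open>By \<open>exec_frame\<close> a postcondition may assume that registers outside
  \<open>wregs p\<close> are unchanged. Invariants then need to mention only what a program
  writes.\<close>

lemma wp_frame:
  "wp p (\<lambda>t s'. (\<forall>r. r \<notin> wregs p \<longrightarrow> reg s' r = reg s r) \<longrightarrow> Q t s') s \<Longrightarrow> wp p Q s"
  unfolding wp_def run_def using exec_frame by blast

lemma wp_frameI:
  assumes "wp p P s"
    and "\<And>t s'. P t s' \<Longrightarrow> (\<And>r. r \<notin> wregs p \<Longrightarrow> reg s' r = reg s r) \<Longrightarrow> Q t s'"
  shows "wp p Q s"
  by (rule wp_frame, rule wp_mono[OF assms(1)]) (use assms(2) in blast)

lemma wp_WhileFalse: "\<not> eval_test s b \<Longrightarrow> Q (cost_test b) s \<Longrightarrow> wp (While b p) Q s"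
  unfolding wp_def by (blast intro: run_WhileFalse)

lemma wp_WhileTrue:
  assumes "eval_test s b" "wp p (\<lambda>t. wp (While b p) (\<lambda>u. Q (cost_test b + t + u))) s"
  shows "wp (While b p) Q s"
  using assms unfolding wp_def by (blast intro: run_WhileTrue)

text \<open>All loops of the program are counted: even where the test is a null-pointer check, the
  invariant fixes the number \<open>N\<close> of rounds beforehand. The time is then
  \<open>N\<close> times the worst cost \<open>C\<close> of a round, plus one last test. The frame
  condition is proved once here and handed to every premise.\<close>

lemma wp_for:
  assumes init: "I 0 s0"
    and step: "\<And>j s. j < N \<Longrightarrow> I j s \<Longrightarrow> (\<And>r. r \<notin> wregs p \<Longrightarrow> reg s r = reg s0 r) \<Longrightarrow>
       eval_test s b \<and> wp p (\<lambda>t s'. t + cost_test b \<le> C \<and> I (Suc j) s') s"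
    and exit: "\<And>s. I N s \<Longrightarrow> (\<And>r. r \<notin> wregs p \<Longrightarrow> reg s r = reg s0 r) \<Longrightarrow> \<not> eval_test s b"
    and post: "\<And>t s. t \<le> N * C + cost_test b \<Longrightarrow> I N s \<Longrightarrow>
       (\<And>r. r \<notin> wregs p \<Longrightarrow> reg s r = reg s0 r) \<Longrightarrow> Q t s"
  shows "wp (While b p) Q s0"
proof -
  have "wp (While b p) (\<lambda>t s'. t \<le> (N - j) * C + cost_test b \<and> I N s' \<and>
      (\<forall>r. r \<notin> wregs p \<longrightarrow> reg s' r = reg s0 r)) s"
    if "j \<le> N" "I j s" "\<forall>r. r \<notin> wregs p \<longrightarrow> reg s r = reg s0 r" for j s
    using that
  proof (induction "N - j" arbitrary: j s)
    case 0
    then show ?case using exit by (intro wp_WhileFalse) auto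
  next
    case (Suc d)
    then have j: "j < N" by simp
    have fr: "\<And>r. r \<notin> wregs p \<Longrightarrow> reg s r = reg s0 r" using Suc.prems by blast
    from step[OF j Suc.prems(2) fr]
    have b: "eval_test s b" and w: "wp p (\<lambda>t s'. t + cost_test b \<le> C \<and> I (Suc j) s') s"
      by auto
    show ?case
    proof (rule wp_WhileTrue[OF b], rule wp_frameI[OF w], elim conjE)
      fix t s' assume t: "t + cost_test b \<le> C" "I (Suc j) s'"
        "\<And>r. r \<notin> wregs p \<Longrightarrow> reg s' r = reg s r"
      have nj: "N - j = Suc (N - Suc j)" using j by simp
      have "wp (While b p) (\<lambda>t s'. t \<le> (N - Suc j) * C + cost_test b \<and> I N s' \<and>
          (\<forall>r. r \<notin> wregs p \<longrightarrow> reg s' r = reg s0 r)) s'"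
        by (rule Suc.hyps(1)) (use Suc j t in auto)
      then show "wp (While b p) (\<lambda>u s''. cost_test b + t + u \<le> (N - j) * C + cost_test b \<and>
          I N s'' \<and> (\<forall>r. r \<notin> wregs p \<longrightarrow> reg s'' r = reg s0 r)) s'"
        by (rule wp_mono) (use t nj in auto)
    qed
  qed
  then have "wp (While b p) (\<lambda>t s'. t \<le> (N - 0) * C + cost_test b \<and> I N s' \<and>
      (\<forall>r. r \<notin> wregs p \<longrightarrow> reg s' r = reg s0 r)) s0"
    using init by blast
  then show ?thesis by (rule wp_mono) (use post in auto)
qed

subsection \<open>Sizes of machine words\<close>

text \<open>The machine words of a run without uncontrolled additions grow linearly with time, so that
  the word bound can be ignored while reasoning about a program.\<close>

fun csum :: "exp \<Rightarrow> nat" where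
  "csum (Const k) = k"
| "csum (Reg r) = 0"
| "csum (Load e) = csum e"
| "csum (Add e f) = csum e + csum f"
| "csum (Sub e f) = csum e + csum f"

text \<open>Meant for stored values. The second summand has to be a constant, because the sum of two
  words could double the largest word in every step. A load yields an existing word, and a
  difference is at most its first operand.\<close>

fun slow :: "exp \<Rightarrow> bool" where
  "slow (Add e f) \<longleftrightarrow> slow e \<and> (case f of Const k \<Rightarrow> True | _ \<Rightarrow> False)"
| "slow (Sub e f) \<longleftrightarrow> slow e"
| "slow _ \<longleftrightarrow> True"

fun etest :: "test \<Rightarrow> exp \<times> exp" where
  "etest (Less e f) = (e, f)"
| "etest (Leq e f) = (e, f)"
| "etest (Eq e f) = (e, f)"
| "etest (Neq e f) = (e, f)"

definition small_exp :: "nat \<Rightarrow> exp \<Rightarrow> bool" where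
  "small_exp K e \<longleftrightarrow> csum e \<le> K \<and> cost_exp e \<le> K"

text \<open>Addresses and tests need only be small: their sums of registers are evaluated but not
  stored, so they exceed the largest word by a constant factor at most and this does not
  accumulate.\<close>

fun slow_com :: "nat \<Rightarrow> com \<Rightarrow> bool" where
  "slow_com K Skip \<longleftrightarrow> True"
| "slow_com K (Assign r e) \<longleftrightarrow> slow e \<and> small_exp K e"
| "slow_com K (Store a e) \<longleftrightarrow> small_exp K a \<and> slow e \<and> small_exp K e"
| "slow_com K (Seq p q) \<longleftrightarrow> slow_com K p \<and> slow_com K q"
| "slow_com K (Cond b p q) \<longleftrightarrow>
     small_exp K (fst (etest b)) \<and> small_exp K (snd (etest b)) \<and> slow_com K p \<and> slow_com K q"
| "slow_com K (While b p) \<longleftrightarrow>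
     small_exp K (fst (etest b)) \<and> small_exp K (snd (etest b)) \<and> slow_com K p"

definition bounded_state :: "nat \<Rightarrow> state \<Rightarrow> bool" where
  "bounded_state M s \<longleftrightarrow> (\<forall>r. reg s r \<le> M) \<and> (\<forall>a. mem s a \<le> M)"

lemma eval_slow: "bounded_state M s \<Longrightarrow> slow e \<Longrightarrow> eval_exp s e \<le> M + csum e"
proof (induction e)
  case (Load e)
  then show ?case by (simp add: bounded_state_def trans_le_add1)
next
  case (Add e f)
  then show ?case by (auto split: exp.splits)
next
  case (Sub e f)
  then show ?case by simp
qed (auto simp: bounded_state_def)

text \<open>Each register or load contributes at most \<open>M\<close>, there are at most
  \<open>cost_exp e\<close> of them, and the constants add up to at most \<open>csum e\<close>.
  Subexpressions obey the same bound, hence fit as well.\<close>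

lemma fits_exp_bounded:
  assumes "bounded_state M s"
  shows "fits_exp (Suc (cost_exp e * M + csum e)) s e \<and> eval_exp s e \<le> cost_exp e * M + csum e"
proof (induction e)
  case (Load e)
  then have "fits_exp (Suc (cost_exp (Load e) * M + csum (Load e))) s e"
    by (auto elim: fits_exp_mono)
  then show ?case using assms by (auto simp: bounded_state_def trans_le_add1 less_Suc_eq_le)
next
  case (Add e f)
  then have "fits_exp (Suc (cost_exp (Add e f) * M + csum (Add e f))) s e"
     "fits_exp (Suc (cost_exp (Add e f) * M + csum (Add e f))) s f"
    by (auto elim!: fits_exp_mono simp: algebra_simps)
  then show ?case using Add by (auto simp: algebra_simps)
next
  case (Sub e f)
  then have "fits_exp (Suc (cost_exp (Sub e f) * M + csum (Sub e f))) s e"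
     "fits_exp (Suc (cost_exp (Sub e f) * M + csum (Sub e f))) s f"
    by (auto elim!: fits_exp_mono simp: algebra_simps)
  then show ?case using Sub by (auto simp: algebra_simps)
qed (use assms in \<open>auto simp: bounded_state_def less_Suc_eq_le\<close>)

lemma fits_small:
  assumes "bounded_state M s" "small_exp K e" "K * M + K < B"
  shows "fits_exp B s e"
proof -
  have "cost_exp e * M + csum e \<le> K * M + K"
    using assms(2) by (auto simp: small_exp_def intro!: add_mono mult_le_mono1)
  then show ?thesis
    using fits_exp_bounded[OF assms(1), of e] assms(3) by (auto elim!: fits_exp_mono)
qed

lemma fits_small_test:
  assumes "bounded_state M s" "small_exp K (fst (etest b))" "small_exp K (snd (etest b))"
    "K * M + K < B"
  shows "fits_test B s b"
  using assms by (cases b) (auto intro: fits_small)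

lemma bounded_state_mono: "bounded_state M s \<Longrightarrow> M \<le> M' \<Longrightarrow> bounded_state M' s"
  unfolding bounded_state_def using le_trans by blast

text \<open>Storing raises the largest word by at most \<open>K\<close>, and every instruction takes
  time at least 1; hence \<open>M + K * t\<close> bounds the final state. Whatever is evaluated on
  the way is at most \<open>K\<close> times such a value plus \<open>K\<close>. The derivation under
  the arbitrary bound \<open>B'\<close> provides the shape of the run for the induction.\<close>

lemma exec_slow:
  assumes "exec B' p s t s'" "slow_com K p" "bounded_state M s" "K * (M + K * t) + K < B"
  shows "exec B p s t s' \<and> bounded_state (M + K * t) s'"
  using assms
proof (induction arbitrary: M rule: exec.induct)
  case (Skip s)
  then show ?case using exec.Skip[of B s] by (auto elim: bounded_state_mono)
next
  case (Assign s e r)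
  have le: "K * M + K < B" using Assign.prems(3) by (simp add: algebra_simps)
  have "eval_exp s e \<le> M + K * (1 + cost_exp e)"
    using eval_slow[of M s e] Assign.prems by (auto simp: small_exp_def)
  then have "bounded_state (M + K * (1 + cost_exp e)) (s\<lparr>reg := (reg s)(r := eval_exp s e)\<rparr>)"
    using Assign.prems(2) by (auto simp: bounded_state_def trans_le_add1)
  then show ?case
    using fits_small[OF Assign.prems(2) _ le] Assign.prems(1) exec.Assign[of B s e r] by auto
next
  case (Store s a e)
  let ?T = "1 + cost_exp a + cost_exp e"
  have le: "K * M + K < B" using Store.prems(3) by (simp add: algebra_simps)
  have "eval_exp s e \<le> M + K * ?T"
    using eval_slow[of M s e] Store.prems by (auto simp: small_exp_def)
  then have "bounded_state (M + K * ?T) (s\<lparr>mem := (mem s)(eval_exp s a := eval_exp s e)\<rparr>)"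
    using Store.prems(2) by (auto simp: bounded_state_def trans_le_add1)
  then show ?case
    using fits_small[OF Store.prems(2) _ le] Store.prems(1) exec.Store[of B s a e] by auto
next
  case (Seq p s t s' q u s'')
  have "K * (M + K * t) + K < B" "K * (M + K * t + K * u) + K < B"
    using Seq.prems(3) by (auto simp: algebra_simps)
  then show ?case using Seq.IH(1)[of M] Seq.IH(2)[of "M + K * t"] Seq.prems
    by (auto intro: exec.intros simp: algebra_simps)
next
  case (CondTrue s b p t s' q)
  have le: "K * M + K < B" "K * (M + K * t) + K < B"
    using CondTrue.prems(3) by (auto simp: algebra_simps)
  have "fits_test B s b"
    by (rule fits_small_test[OF CondTrue.prems(2) _ _ le(1)]) (use CondTrue.prems in auto)
  moreover have "exec B p s t s'" "bounded_state (M + K * t) s'"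
    using CondTrue.IH[OF _ CondTrue.prems(2) le(2)] CondTrue.prems(1) by auto
  ultimately show ?case using CondTrue.hyps
    by (auto intro!: exec.CondTrue elim!: bounded_state_mono)
next
  case (CondFalse s b q t s' p)
  have le: "K * M + K < B" "K * (M + K * t) + K < B"
    using CondFalse.prems(3) by (auto simp: algebra_simps)
  have "fits_test B s b"
    by (rule fits_small_test[OF CondFalse.prems(2) _ _ le(1)]) (use CondFalse.prems in auto)
  moreover have "exec B q s t s'" "bounded_state (M + K * t) s'"
    using CondFalse.IH[OF _ CondFalse.prems(2) le(2)] CondFalse.prems(1) by auto
  ultimately show ?case using CondFalse.hyps
    by (auto intro!: exec.CondFalse elim!: bounded_state_mono)
next
  case (WhileFalse s b p)
  have le: "K * M + K < B"
    using WhileFalse.prems(3) by (auto simp: algebra_simps)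
  have "fits_test B s b"
    by (rule fits_small_test[OF WhileFalse.prems(2) _ _ le]) (use WhileFalse.prems in auto)
  then show ?case using WhileFalse.prems(2) WhileFalse.hyps
    by (auto intro!: exec.WhileFalse elim!: bounded_state_mono)
next
  case (WhileTrue s b p t s' u s'')
  have le: "K * M + K < B" "K * (M + K * t) + K < B" "K * (M + K * t + K * u) + K < B"
    using WhileTrue.prems(3) by (auto simp: algebra_simps)
  have f: "fits_test B s b"
    by (rule fits_small_test[OF WhileTrue.prems(2) _ _ le(1)]) (use WhileTrue.prems in auto)
  have 1: "exec B p s t s'" "bounded_state (M + K * t) s'"
    using WhileTrue.IH(1)[OF _ WhileTrue.prems(2) le(2)] WhileTrue.prems(1) by auto
  have 2: "exec B (While b p) s' u s''" "bounded_state (M + K * t + K * u) s''"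
    using WhileTrue.IH(2)[OF WhileTrue.prems(1) 1(2) le(3)] by auto
  have "M + K * t + K * u \<le> M + K * (cost_test b + t + u)" by (simp add: algebra_simps)
  then have "bounded_state (M + K * (cost_test b + t + u)) s''"
    by (rule bounded_state_mono[OF 2(2)])
  then show ?case
    using exec.WhileTrue[OF f WhileTrue.hyps(2) 1(1) 2(1)] by simp
qed

section \<open>Registers, fresh memory and restricted unions of characteristic vectors\<close>

abbreviation (input) seq (infixr ";;" 60) where "p ;; q \<equiv> Seq p q"

abbreviation (input) "rFree \<equiv> (2::nat)"
abbreviation (input) "rM \<equiv> (3::nat)"
abbreviation (input) "rA \<equiv> (10::nat)"
abbreviation (input) "rB \<equiv> (11::nat)"
abbreviation (input) "rMask \<equiv> (12::nat)"
abbreviation (input) "rPol \<equiv> (13::nat)"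
abbreviation (input) "rRes \<equiv> (14::nat)"
abbreviation (input) "rI \<equiv> (15::nat)"
abbreviation (input) "rJ \<equiv> (16::nat)"
abbreviation (input) "rCell \<equiv> (17::nat)"
abbreviation (input) "rNode \<equiv> (18::nat)"
abbreviation (input) "rFlag \<equiv> (19::nat)"
abbreviation (input) "rK \<equiv> (20::nat)"
abbreviation (input) "rRoot \<equiv> (21::nat)"

abbreviation (input) "incr r k \<equiv> Assign r (Add (Reg r) (Const k))"
abbreviation (input) "at1 p i \<equiv> Add (Reg p) (Add (Const 1) (Reg i))"

definition fresh :: "state \<Rightarrow> bool" where
  "fresh s \<longleftrightarrow> (\<forall>a\<ge>reg s rFree. mem s a = 0)"

definition vec :: "(nat \<Rightarrow> nat) \<Rightarrow> nat \<Rightarrow> nat \<Rightarrow> nat set \<Rightarrow> bool" where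
  "vec \<mu> a m X \<longleftrightarrow> (\<forall>j<m. \<mu> (a + j) = of_bool (j \<in> X))"

definition mix :: "nat \<Rightarrow> nat set \<Rightarrow> bool \<Rightarrow> nat set \<Rightarrow> nat set \<Rightarrow> nat set" where
  "mix m P b X Y = {j. j < m \<and> (j \<in> X \<or> j \<in> Y) \<and> (j \<in> P) = b}"

lemma vec_cong: "vec \<mu> a m X \<Longrightarrow> (\<And>j. j < m \<Longrightarrow> \<mu>' (a + j) = \<mu> (a + j)) \<Longrightarrow> vec \<mu>' a m X"
  by (simp add: vec_def)

text \<open>The new cell consists of a word for a list link, left at 0 for now, and \<open>m\<close>
  bits. Only ones are written, since fresh memory is zero. The operands carry a link word too, hence
  the offset 1 in \<open>at1\<close>; the mask is a bare vector.\<close>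

definition mix_com :: com where
  "mix_com =
     Assign rCell (Reg rFree) ;; incr rFree 1 ;; Assign rK (Const 0) ;;
     While (Less (Reg rK) (Reg rM))
       (Cond (Eq (Load (Add (Reg rMask) (Reg rK))) (Reg rPol))
          (Cond (Less (Const 0) (Add (Load (at1 rI rK)) (Load (at1 rJ rK))))
             (Store (Reg rFree) (Const 1)) Skip) Skip ;;
        incr rFree 1 ;; incr rK 1)"

lemma wregs_mix_com [simp]: "wregs mix_com = {rCell, rFree, rK}"
  by (auto simp: mix_com_def)

lemma wp_mix_com:
  assumes "fresh s" and F: "reg s rFree = fr" and M: "reg s rM = m"
    and X: "vec (mem s) (reg s rI + 1) m X" "reg s rI + m < fr"
    and Y: "vec (mem s) (reg s rJ + 1) m Y" "reg s rJ + m < fr"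
    and P: "vec (mem s) (reg s rMask) m P" "reg s rMask + m \<le> fr" and b: "reg s rPol = of_bool b"
    and post: "\<And>t s'. t \<le> 60 * m + 20 \<Longrightarrow> fresh s' \<Longrightarrow> reg s' rFree = fr + m + 1 \<Longrightarrow>
      reg s' rCell = fr \<Longrightarrow> vec (mem s') (fr + 1) m (mix m P b X Y) \<Longrightarrow> 
      (\<And>a. a \<le> fr \<Longrightarrow> mem s' a = mem s a) \<Longrightarrow>
      (\<And>r. r \<notin> wregs mix_com \<Longrightarrow> reg s' r = reg s r) \<Longrightarrow> Q t s'"
  shows "wp mix_com Q s"
  unfolding mix_com_def
  apply simp
  apply (rule wp_for[where N = m and C = 60 and
      I = "\<lambda>k s'. reg s' rK = k \<and> reg s' rFree = fr + 1 + k \<and> fresh s' \<and>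
        (\<forall>a\<le>fr. mem s' a = mem s a) \<and> vec (mem s') (fr + 1) k (mix m P b X Y)"])
  subgoal using assms(1) F by (auto simp: fresh_def vec_def)
  subgoal premises prems for k s'
  proof -
    have reg: "\<And>r. r \<notin> {rCell, rFree, rK} \<Longrightarrow> reg s' r = reg s r"
      using prems(3) by (simp add: F)
    have e: "mem s' (reg s rI + (1 + k)) = of_bool (k \<in> X)"
      "mem s' (reg s rJ + (1 + k)) = of_bool (k \<in> Y)"
      "mem s' (reg s rMask + k) = of_bool (k \<in> P)"
      using prems(1,2) X Y P by (simp_all add: vec_def)
    show ?thesis using prems(1,2) e b M
      by (auto simp: reg fresh_def vec_def mix_def less_Suc_eq)
  qed
  subgoal using M F by simp
  subgoal premises prems for t s'
  proof -
    have reg: "\<And>r. r \<notin> {rCell, rFree, rK} \<Longrightarrow> reg s' r = reg s r"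
      using prems(3) by (simp add: F)
    have c: "reg s' rCell = fr" using prems(3)[of rCell] F by simp
    show ?thesis
      by (rule post) (use prems(1,2) c reg in auto)
  qed
  done

subsection \<open>Removing duplicates with a trie\<close>

text \<open>A trie over the characteristic vectors of sets of numbers below \<open>m\<close>. Its nodes are addressed
  by a partial map \<open>f\<close>: the node \<open>(i, Y)\<close> with \<open>Y \<subseteq> {..<i}\<close> is the common prefix of length \<open>i\<close> of
  all sets \<open>X\<close> with \<open>X \<inter> {..<i} = Y\<close>.\<close>

type_synonym trie = "nat \<times> nat set \<Rightarrow> nat option"

definition ptr :: "nat option \<Rightarrow> nat" where
  "ptr x = (case x of None \<Rightarrow> 0 | Some q \<Rightarrow> q)"

lemma ptr_simps [simp]: "ptr None = 0" "ptr (Some q) = q"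
  by (simp_all add: ptr_def)

definition addrs :: "trie \<Rightarrow> nat set" where
  "addrs f = ran f \<union> Suc ` ran f"

definition members :: "nat \<Rightarrow> trie \<Rightarrow> nat set set" where
  "members m f = {X. f (m, X) \<noteq> None}"

text \<open>A node takes the two words \<open>q\<close> and \<open>Suc q\<close>, the pointers to
  its children for the bits 0 and 1, where 0 means no child. The second conjunct, read for both
  orders of the two nodes, makes these pairs of words disjoint; the fourth closes the domain under
  prefixes. Nodes of depth \<open>m\<close> represent complete vectors, and nothing is required of
  their words.\<close>

definition trie_at :: "(nat \<Rightarrow> nat) \<Rightarrow> nat \<Rightarrow> nat \<Rightarrow> nat \<Rightarrow> trie \<Rightarrow> bool" where
  "trie_at \<mu> lo hi m f \<longleftrightarrow>
     (\<forall>q\<in>ran f. 0 < q \<and> lo \<le> q \<and> Suc q < hi) \<and>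
     (\<forall>w w' q q'. f w = Some q \<longrightarrow> f w' = Some q' \<longrightarrow> w \<noteq> w' \<longrightarrow> q' \<noteq> q \<and> q' \<noteq> Suc q) \<and>
     (\<forall>i Y q. f (i, Y) = Some q \<longrightarrow> Y \<subseteq> {..<i}) \<and>
     (\<forall>i Y q. f (Suc i, Y) = Some q \<longrightarrow> f (i, Y \<inter> {..<i}) \<noteq> None) \<and>
     (\<forall>i Y q. f (i, Y) = Some q \<longrightarrow> i < m \<longrightarrow>
        \<mu> q = ptr (f (Suc i, Y)) \<and> \<mu> (Suc q) = ptr (f (Suc i, insert i Y)))"

lemma trie_atD:
  assumes "trie_at \<mu> lo hi m f"
  shows trie_at_bounds: "f w = Some q \<Longrightarrow> 0 < q \<and> lo \<le> q \<and> Suc q < hi"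
    and trie_at_separated: "f w = Some q \<Longrightarrow> f w' = Some q' \<Longrightarrow> w \<noteq> w' \<Longrightarrow> q' \<noteq> q \<and> q' \<noteq> Suc q"
    and trie_at_key: "f (i, Y) = Some q \<Longrightarrow> Y \<subseteq> {..<i}"
    and trie_at_prefix: "f (Suc i, Y) \<noteq> None \<Longrightarrow> f (i, Y \<inter> {..<i}) \<noteq> None"
    and trie_at_child: "f (i, Y) = Some q \<Longrightarrow> i < m \<Longrightarrow>
        \<mu> q = ptr (f (Suc i, Y)) \<and> \<mu> (Suc q) = ptr (f (Suc i, insert i Y))"
proof -
  note T = assms[unfolded trie_at_def]
  show "f w = Some q \<Longrightarrow> 0 < q \<and> lo \<le> q \<and> Suc q < hi"
    using T[THEN conjunct1] ranI[of f w q] by simp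
  show "f w = Some q \<Longrightarrow> f w' = Some q' \<Longrightarrow> w \<noteq> w' \<Longrightarrow> q' \<noteq> q \<and> q' \<noteq> Suc q"
    using T[THEN conjunct2, THEN conjunct1, rule_format] .
  show "f (i, Y) = Some q \<Longrightarrow> Y \<subseteq> {..<i}"
    using T[THEN conjunct2, THEN conjunct2, THEN conjunct1, rule_format] .
  show "f (Suc i, Y) \<noteq> None \<Longrightarrow> f (i, Y \<inter> {..<i}) \<noteq> None"
    using T[THEN conjunct2, THEN conjunct2, THEN conjunct2, THEN conjunct1, rule_format, of i Y]
    by (cases "f (Suc i, Y)") simp_all
  show "f (i, Y) = Some q \<Longrightarrow> i < m \<Longrightarrow>
        \<mu> q = ptr (f (Suc i, Y)) \<and> \<mu> (Suc q) = ptr (f (Suc i, insert i Y))"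
    using T[THEN conjunct2, THEN conjunct2, THEN conjunct2, THEN conjunct2, rule_format] .
qed

lemma trie_at_cong:
  assumes "trie_at \<mu> lo hi m f" "\<And>a. a \<in> addrs f \<Longrightarrow> \<mu>' a = \<mu> a" "hi \<le> hi'"
  shows "trie_at \<mu>' lo hi' m f"
proof -
  have "\<mu>' q = \<mu> q \<and> \<mu>' (Suc q) = \<mu> (Suc q)" if "f w = Some q" for w q
    using assms(2) ranI[of f, OF that] by (simp add: addrs_def)
  then have "(\<forall>i Y q. f (i, Y) = Some q \<longrightarrow> i < m \<longrightarrow>
        \<mu>' q = ptr (f (Suc i, Y)) \<and> \<mu>' (Suc q) = ptr (f (Suc i, insert i Y)))"
    using assms(1) unfolding trie_at_def by simp
  moreover have "\<forall>q\<in>ran f. 0 < q \<and> lo \<le> q \<and> Suc q < hi'"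
    using assms(1,3) unfolding trie_at_def by force
  ultimately show ?thesis using assms(1) unfolding trie_at_def by blast
qed

lemma addrs_less: "trie_at \<mu> lo hi m f \<Longrightarrow> a \<in> addrs f \<Longrightarrow> lo \<le> a \<and> a < hi"
  by (auto simp: trie_at_def addrs_def dest: Suc_lessD)

lemma trie_at_root:
  assumes "\<And>a. hi \<le> a \<Longrightarrow> \<mu> a = 0" "0 < hi"
  shows "trie_at \<mu> hi (hi + 2) m [(0, {}) \<mapsto> hi]"
  using assms by (auto simp: trie_at_def)

text \<open>As the pairs of words are disjoint, the write at \<open>q + of_bool b\<close> changes
  one child slot of one node. The words of the new node at \<open>hi\<close> are still zero, so that
  it has no children.\<close>

lemma trie_at_extend:
  assumes T: "trie_at \<mu> lo hi m f" and q: "f (i, Y) = Some q" and im: "i < m"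
    and Y': "Y' = (if b then insert i Y else Y)" and None: "f (Suc i, Y') = None"
    and z: "\<And>a. hi \<le> a \<Longrightarrow> \<mu> a = 0" and lo: "lo \<le> hi" 
  shows "trie_at (\<mu>(q + of_bool b := hi)) lo (hi + 2) m (f((Suc i, Y') \<mapsto> hi))"
proof -
  let ?\<mu> = "\<mu>(q + of_bool b := hi)" and ?f = "f((Suc i, Y') \<mapsto> hi)"
  note sub = trie_at_key[OF T] and pre = trie_at_prefix[OF T] and sep = trie_at_separated[OF T]
    and ch = trie_at_child[OF T] and bd = trie_at_bounds[OF T]
  have Ysub: "Y \<subseteq> {..<i}" using sub[OF q] .
  have Y'i: "Y' \<inter> {..<i} = Y" and Y'sub: "Y' \<subseteq> {..<Suc i}" using Y' Ysub by auto
  have 1: "\<forall>r\<in>ran ?f. 0 < r \<and> lo \<le> r \<and> Suc r < hi + 2"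
  proof
    fix r assume "r \<in> ran ?f"
    then obtain w where "?f w = Some r" by (auto simp: ran_def)
    then have "r = hi \<or> f w = Some r" by (auto split: if_splits)
    then show "0 < r \<and> lo \<le> r \<and> Suc r < hi + 2" using bd[OF q] bd[of w r] lo by auto
  qed
  have 2: "\<forall>w w' q q'. ?f w = Some q \<longrightarrow> ?f w' = Some q' \<longrightarrow> w \<noteq> w' \<longrightarrow> q' \<noteq> q \<and> q' \<noteq> Suc q"
  proof (intro allI impI)
    fix w w' r r' assume r: "?f w = Some r" "?f w' = Some r'" "w \<noteq> w'"
    have "r = hi \<and> w = (Suc i, Y') \<or> f w = Some r" "r' = hi \<and> w' = (Suc i, Y') \<or> f w' = Some r'"
      using r(1,2) by (simp_all split: if_splits)
    then consider "f w' = Some r'" "r = hi" | "f w = Some r" "r' = hi" | "f w = Some r" "f w' = Some r'"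
      using r(3) by blast
    then show "r' \<noteq> r \<and> r' \<noteq> Suc r"
    proof cases
      case 1 then show ?thesis using bd[OF 1(1)] by simp
    next
      case 2 then show ?thesis using bd[OF 2(1)] by simp
    next
      case 3 then show ?thesis using sep[OF 3 r(3)] by simp
    qed
  qed
  have 3: "\<forall>i Y q. ?f (i, Y) = Some q \<longrightarrow> Y \<subseteq> {..<i}"
  proof (intro allI impI)
    fix j Z r assume "?f (j, Z) = Some r"
    then have "(j = Suc i \<and> Z = Y') \<or> f (j, Z) = Some r" by (simp split: if_splits)
    then show "Z \<subseteq> {..<j}"
    proof
      assume "j = Suc i \<and> Z = Y'"
      then show ?thesis using Y'sub by simp
    qed (rule sub)
  qed
  have 4: "\<forall>j Z q. ?f (Suc j, Z) = Some q \<longrightarrow> ?f (j, Z \<inter> {..<j}) \<noteq> None"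
  proof (intro allI impI)
    fix j Z r assume "?f (Suc j, Z) = Some r"
    then have "(j = i \<and> Z = Y') \<or> f (Suc j, Z) \<noteq> None" by (auto split: if_splits)
    then have "f (j, Z \<inter> {..<j}) \<noteq> None"
    proof
      assume "j = i \<and> Z = Y'"
      then show ?thesis using q Y'i by simp
    qed (rule pre)
    then show "?f (j, Z \<inter> {..<j}) \<noteq> None" by auto
  qed
  have 5: "?\<mu> r = ptr (?f (Suc j, Z)) \<and> ?\<mu> (Suc r) = ptr (?f (Suc j, insert j Z))"
    if fr: "?f (j, Z) = Some r" and j: "j < m" for j Z r
  proof (cases "(j, Z) = (Suc i, Y')")
    case True
    \<comment> \<open>A child of the new node would have that node as a prefix, but \<open>f\<close>
      is undefined there.\<close>
    have "f (Suc j, Z) = None" "f (Suc j, insert j Z) = None"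
    proof -
      have "Z \<inter> {..<j} = Y'" "insert j Z \<inter> {..<j} = Y'" using True Y'sub by auto
      then show "f (Suc j, Z) = None" "f (Suc j, insert j Z) = None"
        using pre[of j Z] pre[of j "insert j Z"] None True by auto
    qed
    moreover have "r = hi" using fr True by simp
    moreover have "q + of_bool b < hi" using bd[OF q] by auto
    ultimately show ?thesis using z True by auto
  next
    case False
    then have f: "f (j, Z) = Some r" using fr by (metis fun_upd_other)
    have Zsub: "Z \<subseteq> {..<j}" using sub[OF f] .
    show ?thesis
    proof (cases "(j, Z) = (i, Y)")
      case True
      then have "r = q" using f q by simp
      \<comment> \<open>The two children of \<open>(i, Y)\<close> have different keys, so the other
        one keeps its pointer.\<close>
      moreover have "insert i Y \<noteq> Y" using Ysub by auto
      ultimately show ?thesis using ch[OF f j] True Y' by auto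
    next
      case ne: False
      have "r \<noteq> q" "r \<noteq> Suc q" "q \<noteq> Suc r" using sep[OF q f] sep[OF f q] ne by auto
      then have "?\<mu> r = \<mu> r" "?\<mu> (Suc r) = \<mu> (Suc r)" by (cases b; simp)+
      moreover have "(Suc j, Z) \<noteq> (Suc i, Y')" "(Suc j, insert j Z) \<noteq> (Suc i, Y')"
        using ne Zsub Y'i by auto
      ultimately have "?\<mu> r = \<mu> r" "?\<mu> (Suc r) = \<mu> (Suc r)"
        "?f (Suc j, Z) = f (Suc j, Z)" "?f (Suc j, insert j Z) = f (Suc j, insert j Z)"
        by (simp_all only: fun_upd_other not_False_eq_True)
      then show ?thesis using ch[OF f j] by simp
    qed
  qed
  show ?thesis unfolding trie_at_def using 5 by (intro conjI 1 2 3 4) blast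
qed

text \<open>Iterated prefix closure. It shows that a missing prefix of \<open>X\<close> means that
  \<open>X\<close> itself is missing, which is what makes the flag of an insertion
  meaningful.\<close>

lemma trie_prefixes:
  assumes "trie_at \<mu> lo hi m f" "f (k, X) \<noteq> None" "i \<le> k"
  shows "f (i, X \<inter> {..<i}) \<noteq> None"
  using assms(2,3)
proof (induction k arbitrary: X)
  case 0
  then have "X \<subseteq> {..<0}" using trie_at_key[OF assms(1)] by blast
  then have "X = {}" by simp
  then show ?case using 0 by simp
next
  case (Suc k)
  have X: "X \<subseteq> {..<Suc k}" using trie_at_key[OF assms(1)] Suc.prems(1) by blast
  have pre: "f (k, X \<inter> {..<k}) \<noteq> None" using trie_at_prefix[OF assms(1) Suc.prems(1)] .
  show ?case
  proof (cases "i = Suc k")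
    case True
    then show ?thesis using Suc.prems X by (simp add: Int_absorb2)
  next
    case False
    then have "f (i, (X \<inter> {..<k}) \<inter> {..<i}) \<noteq> None" using Suc.IH[OF pre] Suc.prems(2) by simp
    moreover have "(X \<inter> {..<k}) \<inter> {..<i} = X \<inter> {..<i}" using False Suc.prems(2) by auto
    ultimately show ?thesis by simp
  qed
qed

abbreviation (input) "child_exp \<equiv> Add (Reg rNode) (Load (at1 rCell rK))"

text \<open>Adding the current bit of the vector to the node address selects one of the two words of
  the node (\<open>child_exp\<close>). The flag records whether any node had to be created.\<close>

definition insert_com :: com where
  "insert_com =
     Assign rNode (Reg rRoot) ;; Assign rFlag (Const 0) ;; Assign rK (Const 0) ;;
     While (Less (Reg rK) (Reg rM))
       (Cond (Eq (Load child_exp) (Const 0))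
          (Store child_exp (Reg rFree) ;; incr rFree 2 ;; Assign rFlag (Const 1)) Skip ;;
        Assign rNode (Load child_exp) ;; incr rK 1)"

lemma wregs_insert_com [simp]: "wregs insert_com = {rNode, rFlag, rK, rFree}"
  by (auto simp: insert_com_def)

text \<open>The state after \<open>k\<close> steps of the insertion of \<open>X\<close> into the trie \<open>f\<^sub>0\<close> of the state \<open>s\<^sub>0\<close>.\<close>

definition insert_inv ::
    "state \<Rightarrow> nat \<Rightarrow> nat \<Rightarrow> trie \<Rightarrow> nat set \<Rightarrow> nat \<Rightarrow> state \<Rightarrow> bool" where
  "insert_inv s\<^sub>0 lo m f\<^sub>0 X k s \<longleftrightarrow> reg s rK = k \<and> fresh s \<and> reg s\<^sub>0 rFree \<le> reg s rFree \<and>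
     (\<forall>a<reg s\<^sub>0 rFree. a \<notin> addrs f\<^sub>0 \<longrightarrow> mem s a = mem s\<^sub>0 a) \<and>
     (\<exists>f. trie_at (mem s) lo (reg s rFree) m f \<and> f\<^sub>0 \<subseteq>\<^sub>m f \<and>
        dom f = dom f\<^sub>0 \<union> {(i, X \<inter> {..<i}) | i. i \<le> k} \<and>
        addrs f \<subseteq> addrs f\<^sub>0 \<union> {reg s\<^sub>0 rFree..} \<and>
        f (k, X \<inter> {..<k}) = Some (reg s rNode) \<and> reg s rFlag = of_bool (dom f \<noteq> dom f\<^sub>0))"

lemma insert_invI:
  assumes "reg s rK = k" "fresh s" "reg s\<^sub>0 rFree \<le> reg s rFree"
    "\<And>a. a < reg s\<^sub>0 rFree \<Longrightarrow> a \<notin> addrs f\<^sub>0 \<Longrightarrow> mem s a = mem s\<^sub>0 a"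
    "trie_at (mem s) lo (reg s rFree) m f" "f\<^sub>0 \<subseteq>\<^sub>m f"
    "dom f = dom f\<^sub>0 \<union> {(i, X \<inter> {..<i}) | i. i \<le> k}"
    "addrs f \<subseteq> addrs f\<^sub>0 \<union> {reg s\<^sub>0 rFree..}"
    "f (k, X \<inter> {..<k}) = Some (reg s rNode)" "reg s rFlag = of_bool (dom f \<noteq> dom f\<^sub>0)"
  shows "insert_inv s\<^sub>0 lo m f\<^sub>0 X k s"
  using assms unfolding insert_inv_def by (intro conjI exI[of _ f] allI impI) assumption+

lemma wp_insert_com:
  assumes T: "trie_at (mem s) lo (reg s rFree) m f\<^sub>0" and R: "f\<^sub>0 (0, {}) = Some (reg s rRoot)"
    and M: "reg s rM = m" and fr: "fresh s"
    and X: "vec (mem s) (reg s rCell + 1) m X" and Xm: "X \<subseteq> {..<m}"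
    and C: "{reg s rCell..reg s rCell + m} \<inter> addrs f\<^sub>0 = {}" "reg s rCell + m < reg s rFree"
    and post: "\<And>t s' f. t \<le> 100 * m + 20 \<Longrightarrow> fresh s' \<Longrightarrow> reg s rFree \<le> reg s' rFree \<Longrightarrow>
      trie_at (mem s') lo (reg s' rFree) m f \<Longrightarrow> f (0, {}) = Some (reg s rRoot) \<Longrightarrow>
      members m f = insert X (members m f\<^sub>0) \<Longrightarrow> reg s' rFlag = of_bool (X \<notin> members m f\<^sub>0) \<Longrightarrow>
      addrs f \<subseteq> addrs f\<^sub>0 \<union> {reg s rFree..} \<Longrightarrow>
      (\<And>a. a < reg s rFree \<Longrightarrow> a \<notin> addrs f\<^sub>0 \<Longrightarrow> mem s' a = mem s a) \<Longrightarrow>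
      (\<And>r. r \<notin> wregs insert_com \<Longrightarrow> reg s' r = reg s r) \<Longrightarrow> Q t s'"
  shows "wp insert_com Q s"
  unfolding insert_com_def
  apply simp
  apply (rule wp_for[where N = m and C = 100 and I = "insert_inv s lo m f\<^sub>0 X"])
  subgoal
    by (rule insert_invI[where f = f\<^sub>0]) (use T R fr in \<open>auto simp: fresh_def\<close>)
  subgoal premises prems for k s'
  proof -
    have reg: "\<And>r. r \<notin> {rNode, rFlag, rK, rFree} \<Longrightarrow> reg s' r = reg s r"
      using prems(3) by simp
    note I = prems(2)[unfolded insert_inv_def]
    from I obtain f where f: "trie_at (mem s') lo (reg s' rFree) m f" "f\<^sub>0 \<subseteq>\<^sub>m f"
      "dom f = dom f\<^sub>0 \<union> {(i, X \<inter> {..<i}) | i. i \<le> k}"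
      "addrs f \<subseteq> addrs f\<^sub>0 \<union> {reg s rFree..}"
      "f (k, X \<inter> {..<k}) = Some (reg s' rNode)" "reg s' rFlag = of_bool (dom f \<noteq> dom f\<^sub>0)"
      by blast
    let ?q = "reg s' rNode" and ?Y = "X \<inter> {..<k}" and ?b = "k \<in> X"
    let ?Y' = "X \<inter> {..<Suc k}" and ?c = "?q + of_bool ?b" and ?fr = "reg s' rFree"
    have k: "reg s' rK = k" "fresh s'" "reg s rFree \<le> ?fr" using I by auto
    have fr': "\<And>a. a < reg s rFree \<Longrightarrow> a \<notin> addrs f\<^sub>0 \<Longrightarrow> mem s' a = mem s a" using I by blast
    \<comment> \<open>The vector lies outside the old trie and below the old allocation pointer, so
      the pointers written so far have not touched it.\<close>
    have bit: "mem s' (reg s rCell + (1 + k)) = of_bool ?b"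
    proof -
      have "reg s rCell + (1 + k) \<in> {reg s rCell..reg s rCell + m}" using prems(1) by simp
      then have "reg s rCell + (1 + k) \<notin> addrs f\<^sub>0" using C(1) by blast
      then show ?thesis
        using fr'[of "reg s rCell + (1 + k)"] C(2) prems(1) X by (simp add: vec_def)
    qed
    have nc: "Suc (reg s rCell + k) \<notin> addrs f\<^sub>0"
    proof -
      have "Suc (reg s rCell + k) \<in> {reg s rCell..reg s rCell + m}" using prems(1) by simp
      then show ?thesis using C(1) by blast
    qed
    have Y': "?Y' = (if ?b then insert k ?Y else ?Y)" by (auto simp: less_Suc_eq)
    have mc: "mem s' ?c = ptr (f (Suc k, ?Y'))"
      using trie_at_child[OF f(1) f(5) prems(1)] Y' by (cases ?b) auto
    have qran: "?q \<in> ran f" using f(5) by (auto simp: ran_def)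
    then have cad: "?c \<in> addrs f" by (auto simp: addrs_def)
    have klt: "Suc ?q < ?fr" and lo: "lo \<le> ?q" using trie_at_bounds[OF f(1) f(5)] by auto
    have pos: "0 < ?fr" using klt by simp
    have nz: "0 < q'" if "f w = Some q'" for w q'
      using trie_at_bounds[OF f(1) that] by simp
    have lek: "{(i, X \<inter> {..<i}) |i. i \<le> Suc k} = {(i, X \<inter> {..<i}) |i. i \<le> k} \<union> {(Suc k, ?Y')}"
      by (auto simp: le_Suc_eq)
    have cost: "eval_test s' (Less (Reg rK) (Reg rM))" using k M prems(1) reg by simp
    show ?thesis
    proof (cases "f (Suc k, ?Y')")
      case (Some q')
      then have ne: "mem s' ?c \<noteq> 0" "mem s' ?c = q'" using mc nz[OF Some] by auto
      have dom: "(Suc k, ?Y') \<in> dom f" using Some by auto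
      have "insert_inv s lo m f\<^sub>0 X (Suc k)
        (s'\<lparr>reg := (reg s')(rNode := q', rK := Suc k)\<rparr>)"
      proof (rule insert_invI[where f = f])
        show "dom f = dom f\<^sub>0 \<union> {(i, X \<inter> {..<i}) |i. i \<le> Suc k}"
          unfolding lek using f(3) dom by blast
      qed (use k fr' f Some in \<open>simp_all add: fresh_def\<close>)
      then show ?thesis using cost ne bit k reg by simp
    next
      case None
      let ?f = "f((Suc k, ?Y') \<mapsto> ?fr)" and ?\<mu> = "(mem s')(?c := ?fr)"
      have z: "mem s' ?c = 0" using None mc by simp
      have T': "trie_at ?\<mu> lo (?fr + 2) m ?f"
        by (rule trie_at_extend[OF f(1) f(5) prems(1) Y' None]) (use k(2) lo klt in \<open>auto simp: fresh_def\<close>)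
      have n0: "(Suc k, ?Y') \<notin> dom f\<^sub>0" using None f(2) unfolding map_le_def by (metis domIff)
      have "ran ?f \<subseteq> insert ?fr (ran f)" by (auto simp: ran_def split: if_splits)
      then have "addrs ?f \<subseteq> insert ?fr (insert (Suc ?fr) (addrs f))" unfolding addrs_def by blast
      then have ad: "addrs ?f \<subseteq> addrs f\<^sub>0 \<union> {reg s rFree..}"
        using f(4) k(3) by (auto dest!: subsetD)
      have le: "f\<^sub>0 \<subseteq>\<^sub>m ?f" using f(2) n0 unfolding map_le_def by (metis fun_upd_other)
      have c0: "?c \<in> addrs f\<^sub>0 \<or> reg s rFree \<le> ?c" using cad f(4) by auto
      have "(Suc k, ?Y') \<in> dom ?f" by simp
      then have neq: "dom ?f \<noteq> dom f\<^sub>0" using n0 by metis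
      have "insert_inv s lo m f\<^sub>0 X (Suc k)
        (s'\<lparr>mem := ?\<mu>,
           reg := (reg s')(rFree := Suc (Suc ?fr), rFlag := Suc 0, rNode := ?fr, rK := Suc k)\<rparr>)"
      proof (rule insert_invI[where f = ?f])
        show "dom ?f = dom f\<^sub>0 \<union> {(i, X \<inter> {..<i}) |i. i \<le> Suc k}"
          unfolding lek using f(3) by simp
        show "fresh (s'\<lparr>mem := ?\<mu>,
           reg := (reg s')(rFree := Suc (Suc ?fr), rFlag := Suc 0, rNode := ?fr, rK := Suc k)\<rparr>)"
          using k(2) klt by (auto simp: fresh_def)
        fix a assume "a < reg s rFree" "a \<notin> addrs f\<^sub>0"
        then show "mem (s'\<lparr>mem := ?\<mu>,
           reg := (reg s')(rFree := Suc (Suc ?fr), rFlag := Suc 0, rNode := ?fr, rK := Suc k)\<rparr>) a = mem s a"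
          using c0 fr' by auto
      qed (use k T' neq ad le in simp_all)
      \<comment> \<open>\<open>child_exp\<close> is evaluated again after the store, so the store
        must not hit the bit that it reads.\<close>
      moreover have "Suc (reg s rCell + k) \<noteq> ?c" using nc c0 C(2) prems(1) by auto
      ultimately show ?thesis using cost z bit k reg by (cases ?b) (simp_all add: fun_upd_twist)
    qed
  qed
  subgoal using M by (simp add: insert_inv_def)
  subgoal premises prems for t s'
  proof -
    have reg: "\<And>r. r \<notin> {rNode, rFlag, rK, rFree} \<Longrightarrow> reg s' r = reg s r"
      using prems(3) by simp
    note I = prems(2)[unfolded insert_inv_def]
    from I obtain f where f: "trie_at (mem s') lo (reg s' rFree) m f" "f\<^sub>0 \<subseteq>\<^sub>m f"
      "dom f = dom f\<^sub>0 \<union> {(i, X \<inter> {..<i}) | i. i \<le> m}"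
      "addrs f \<subseteq> addrs f\<^sub>0 \<union> {reg s rFree..}"
      "reg s' rFlag = of_bool (dom f \<noteq> dom f\<^sub>0)"
      by blast
    have XX: "X \<inter> {..<m} = X" using Xm by auto
    have mem: "members m f = insert X (members m f\<^sub>0)"
    proof -
      have "f (m, Z) \<noteq> None \<longleftrightarrow> f\<^sub>0 (m, Z) \<noteq> None \<or> Z = X" for Z
        using f(3) XX unfolding dom_def by (auto simp: set_eq_iff)
      then show ?thesis by (auto simp: members_def)
    qed
    \<comment> \<open>The flag reports a new node anywhere on the path of \<open>X\<close>. If there
      is one, prefix closure of the old trie excludes \<open>X\<close>; conversely, for a new
      \<open>X\<close> the end of the path is itself a new node.\<close>
    have "dom f \<noteq> dom f\<^sub>0 \<longleftrightarrow> X \<notin> members m f\<^sub>0"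
    proof
      assume "dom f \<noteq> dom f\<^sub>0"
      then obtain i where i: "i \<le> m" "f\<^sub>0 (i, X \<inter> {..<i}) = None" using f(3) by auto
      then show "X \<notin> members m f\<^sub>0" using trie_prefixes[OF T, of m X i] i unfolding members_def by blast
    next
      assume "X \<notin> members m f\<^sub>0"
      then have "(m, X) \<notin> dom f\<^sub>0" by (auto simp: members_def)
      moreover have "(m, X) \<in> dom f" using mem by (auto simp: members_def)
      ultimately show "dom f \<noteq> dom f\<^sub>0" by auto
    qed
    moreover have "f (0, {}) = Some (reg s rRoot)" using f(2) R unfolding map_le_def by (metis domI)
    ultimately show ?thesis
      by (intro post[of _ s' f]) (use prems(1) f I mem reg in auto)
  qed
  done

subsection \<open>Products of families\<close>

text \<open>A cell is a link followed by \<open>m\<close> bits, and 0 ends the list.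
  \<open>U\<close> is a region that contains all cells: the list survives any write outside
  it.\<close>

fun flist :: "(nat \<Rightarrow> nat) \<Rightarrow> nat set \<Rightarrow> nat \<Rightarrow> nat \<Rightarrow> nat set list \<Rightarrow> bool" where
  "flist \<mu> U m p [] \<longleftrightarrow> p = 0"
| "flist \<mu> U m p (X # Xs) \<longleftrightarrow>
     p \<noteq> 0 \<and> {p..p + m} \<subseteq> U \<and> vec \<mu> (p + 1) m X \<and> flist \<mu> U m (\<mu> p) Xs"

lemma flist_mono:
  assumes "flist \<mu> U m p Xs" "U \<subseteq> U'" "\<And>a. a \<in> U \<Longrightarrow> \<mu>' a = \<mu> a"
  shows "flist \<mu>' U' m p Xs"
  using assms(1)
proof (induction Xs arbitrary: p)
  case (Cons X Xs)
  then have p: "{p..p + m} \<subseteq> U" "vec \<mu> (p + 1) m X" "flist \<mu> U m (\<mu> p) Xs" "p \<noteq> 0" by auto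
  have "\<mu>' a = \<mu> a" if "p \<le> a" "a \<le> p + m" for a
    using that p(1) by (intro assms(3)) auto
  then have "\<mu>' p = \<mu> p" "vec \<mu>' (p + 1) m X" using p(2) by (auto simp: vec_def)
  then show ?case using Cons.IH[OF p(3)] p(1,4) assms(2) by auto
qed simp

text \<open>A cell holding a duplicate is left unlinked. Its memory is not reclaimed, so that
  everything above the allocation pointer stays zero.\<close>

definition product_body :: com where
  "product_body =
     mix_com ;; insert_com ;;
     Cond (Eq (Reg rFlag) (Const 1)) (Store (Reg rCell) (Reg rRes) ;; Assign rRes (Reg rCell)) Skip ;;
     Assign rJ (Load (Reg rJ))"

definition product_com :: com where
  "product_com =
     Assign rRes (Const 0) ;; Assign rRoot (Reg rFree) ;; incr rFree 2 ;; Assign rI (Reg rA) ;;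
     While (Neq (Reg rI) (Const 0))
       (Assign rJ (Reg rB) ;;
        While (Neq (Reg rJ) (Const 0)) product_body ;;
        Assign rI (Load (Reg rI)))"

lemma wregs_product_body [simp]:
  "wregs product_body = {rRes, rFree, rJ, rCell, rK, rNode, rFlag}"
  by (auto simp: product_body_def)

lemma wregs_product_com [simp]:
  "wregs product_com = {rRes, rRoot, rFree, rI, rJ, rCell, rK, rNode, rFlag}"
  by (auto simp: product_com_def)

text \<open>\<open>product_inv s\<^sub>0 lo m \<S> s\<close>: the list of results of \<open>s\<close> and the members of its trie are \<open>\<S>\<close>,
  and everything below \<open>lo\<close> is as in \<open>s\<^sub>0\<close>. Trie and list live in disjoint sets of addresses.\<close>

definition product_inv :: "state \<Rightarrow> nat \<Rightarrow> nat \<Rightarrow> nat set set \<Rightarrow> state \<Rightarrow> bool" where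
  "product_inv s\<^sub>0 lo m \<S> s \<longleftrightarrow> fresh s \<and> 0 < lo \<and> lo \<le> reg s rFree \<and>
     (\<forall>a<lo. mem s a = mem s\<^sub>0 a) \<and>
     (\<exists>f Xs. trie_at (mem s) lo (reg s rFree) m f \<and> f (0, {}) = Some (reg s rRoot) \<and>
        members m f = \<S> \<and> distinct Xs \<and> set Xs = \<S> \<and>
        flist (mem s) ({lo..<reg s rFree} - addrs f) m (reg s rRes) Xs)"

lemma product_invI:
  assumes "fresh s" "0 < lo" "lo \<le> reg s rFree" "\<And>a. a < lo \<Longrightarrow> mem s a = mem s\<^sub>0 a"
    "trie_at (mem s) lo (reg s rFree) m f" "f (0, {}) = Some (reg s rRoot)"
    "members m f = \<S>" "distinct Xs" "set Xs = \<S>"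
    "flist (mem s) ({lo..<reg s rFree} - addrs f) m (reg s rRes) Xs"
  shows "product_inv s\<^sub>0 lo m \<S> s"
  using assms unfolding product_inv_def by (intro conjI exI[of _ f] exI[of _ Xs] allI impI) assumption+

lemma wp_product_body:
  assumes I: "product_inv s\<^sub>0 lo m \<S> s" and M: "reg s rM = m"
    and X: "vec (mem s\<^sub>0) (reg s rI + 1) m X" "reg s rI + m < lo"
    and Y: "vec (mem s\<^sub>0) (reg s rJ + 1) m Y" "reg s rJ + m < lo"
    and P: "vec (mem s\<^sub>0) (reg s rMask) m P" "reg s rMask + m \<le> lo" and b: "reg s rPol = of_bool b"
    and post: "\<And>t s'. t \<le> 160 * m + 60 \<Longrightarrow> product_inv s\<^sub>0 lo m (insert (mix m P b X Y) \<S>) s' \<Longrightarrow>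
      reg s' rJ = mem s\<^sub>0 (reg s rJ) \<Longrightarrow> 
      (\<And>r. r \<notin> wregs product_body \<Longrightarrow> reg s' r = reg s r) \<Longrightarrow> Q t s'"
  shows "wp product_body Q s"
proof -
  note I' = I[unfolded product_inv_def]
  then obtain f Xs where fr: "fresh s" "0 < lo" "lo \<le> reg s rFree" "\<And>a. a < lo \<Longrightarrow> mem s a = mem s\<^sub>0 a"
    and f: "trie_at (mem s) lo (reg s rFree) m f" "f (0, {}) = Some (reg s rRoot)"
    "members m f = \<S>" and Xs: "distinct Xs" "set Xs = \<S>"
    "flist (mem s) ({lo..<reg s rFree} - addrs f) m (reg s rRes) Xs"
    by blast
  have v: "vec (mem s) (reg s rI + 1) m X" "vec (mem s) (reg s rJ + 1) m Y" "vec (mem s) (reg s rMask) m P"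
    by (rule vec_cong[OF X(1)], use X(2) fr(4) in simp, rule vec_cong[OF Y(1)], use Y(2) fr(4) in simp,
      rule vec_cong[OF P(1)], use P(2) fr(4) in simp)
  let ?Z = "mix m P b X Y" and ?c = "reg s rFree"
  show ?thesis
    unfolding product_body_def wp_Seq
  proof (rule wp_mix_com[OF fr(1) refl M v(1) _ v(2) _ v(3) _ b])
    fix t1 s1
    assume t1: "t1 \<le> 60 * m + 20" and fr1: "fresh s1" and F1: "reg s1 rFree = ?c + m + 1"
      and c1: "reg s1 rCell = ?c" and v1: "vec (mem s1) (?c + 1) m ?Z"
      and m1: "\<And>a. a \<le> ?c \<Longrightarrow> mem s1 a = mem s a"
      and r1: "\<And>r. r \<notin> wregs mix_com \<Longrightarrow> reg s1 r = reg s r"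
    have ad: "\<And>a. a \<in> addrs f \<Longrightarrow> lo \<le> a \<and> a < ?c" using addrs_less[OF f(1)] .
    have T1: "trie_at (mem s1) lo (reg s1 rFree) m f"
      by (rule trie_at_cong[OF f(1)]) (use m1 ad F1 in \<open>auto simp: less_imp_le\<close>)
    have disj: "{?c..?c + m} \<inter> addrs f = {}" using ad by force
    show "wp insert_com (\<lambda>t s2. wp (Cond (Eq (Reg rFlag) (Const 1))
        (Store (Reg rCell) (Reg rRes) ;; Assign rRes (Reg rCell)) Skip)
        (\<lambda>ta s3. wp (Assign rJ (Load (Reg rJ))) (\<lambda>u s4. Q (t1 + (t + (ta + u))) s4) s3) s2) s1"
    proof (rule wp_insert_com[where s = s1, OF T1])
      show "f (0, {}) = Some (reg s1 rRoot)" "reg s1 rM = m" using f(2) M r1 by simp_all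
      show "fresh s1" "vec (mem s1) (reg s1 rCell + 1) m ?Z" "?Z \<subseteq> {..<m}"
        "{reg s1 rCell..reg s1 rCell + m} \<inter> addrs f = {}" "reg s1 rCell + m < reg s1 rFree"
        using fr1 v1 c1 disj F1 by (auto simp: mix_def)
      fix t2 s2 f2
      assume t2: "t2 \<le> 100 * m + 20" and fr2: "fresh s2" and F2: "reg s1 rFree \<le> reg s2 rFree"
        and f2: "trie_at (mem s2) lo (reg s2 rFree) m f2" "f2 (0, {}) = Some (reg s1 rRoot)"
          "members m f2 = insert ?Z (members m f)" "addrs f2 \<subseteq> addrs f \<union> {reg s1 rFree..}"
        and fl: "reg s2 rFlag = of_bool (?Z \<notin> members m f)"
        and m2: "\<And>a. a < reg s1 rFree \<Longrightarrow> a \<notin> addrs f \<Longrightarrow> mem s2 a = mem s1 a"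
        and r2: "\<And>r. r \<notin> wregs insert_com \<Longrightarrow> reg s2 r = reg s1 r"
      have reg: "reg s2 r = reg s r" if "r \<notin> {rFree, rCell, rK, rNode, rFlag}" for r
        using r1[of r] r2[of r] that by simp
      have cell: "reg s2 rCell = ?c" using r2[of rCell] c1 by simp
      have lo2: "lo \<le> reg s2 rFree" using fr(3) F1 F2 by simp
      have mlo: "mem s2 a = mem s\<^sub>0 a" if "a < lo" for a
        using m2[of a] m1[of a] fr(3,4) that ad[of a] F1 by force
      let ?U = "{lo..<?c} - addrs f" and ?U2 = "{lo..<reg s2 rFree} - addrs f2"
      \<comment> \<open>New trie nodes come from above the pointer at the time of the insertion and
        thus avoid the cells of the old result list.\<close>
      have sub: "?U \<subseteq> ?U2" using F1 F2 f2(4) by auto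
      have mU: "mem s2 a = mem s a" if "a \<in> ?U" for a
        using m2[of a] m1[of a] that F1 by auto
      have L2: "flist (mem s2) ?U2 m (reg s2 rRes) Xs"
        using flist_mono[OF Xs(3) sub mU] reg[of rRes] by simp
      have cU: "{?c..?c + m} \<subseteq> ?U2" using F1 F2 f2(4) ad disj fr(3) by auto
      show "wp (Cond (Eq (Reg rFlag) (Const 1))
        (Store (Reg rCell) (Reg rRes) ;; Assign rRes (Reg rCell)) Skip)
        (\<lambda>ta s3. wp (Assign rJ (Load (Reg rJ))) (\<lambda>u s4. Q (t1 + (t2 + (ta + u))) s4) s3) s2"
      proof (cases "?Z \<in> \<S>")
        case True
        have J: "mem s2 (reg s2 rJ) = mem s\<^sub>0 (reg s rJ)" using mlo[of "reg s rJ"] Y(2) reg by simp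
        let ?s = "s2\<lparr>reg := (reg s2)(rJ := mem s\<^sub>0 (reg s rJ))\<rparr>"
        have "product_inv s\<^sub>0 lo m (insert ?Z \<S>) ?s"
          by (rule product_invI[where f = f2 and Xs = Xs])
            (use fr2 fr(2) lo2 mlo f2 f(3) reg r1[of rRoot] L2 Xs True in \<open>auto simp: fresh_def insert_absorb\<close>)
        moreover have "reg ?s r = reg s r" if "r \<notin> wregs product_body" for r
          using that reg[of r] by simp
        ultimately show ?thesis
          using True fl f(3) t1 t2 J by (auto intro!: post)
      next
        case False
        have J: "mem s2 (reg s2 rJ) = mem s\<^sub>0 (reg s rJ)" "reg s2 rJ \<noteq> ?c"
          using mlo[of "reg s rJ"] Y(2) reg fr(3) by simp_all
        \<comment> \<open>The new cell becomes the head of the result list: its link receives the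
          old head.\<close>
        let ?\<mu> = "(mem s2)(?c := reg s rRes)"
        let ?s = "s2\<lparr>mem := ?\<mu>, reg := (reg s2)(rRes := ?c, rJ := mem s\<^sub>0 (reg s rJ))\<rparr>"
        have cf: "?c \<notin> addrs f2" using cU subsetD[OF cU, of ?c] by simp
        have T3: "trie_at ?\<mu> lo (reg s2 rFree) m f2"
          by (rule trie_at_cong[OF f2(1)]) (use cf in auto)
        have v3: "vec ?\<mu> (?c + 1) m ?Z"
        proof (rule vec_cong[OF v1])
          fix j assume "j < m"
          then have "?c + 1 + j \<in> {?c..?c + m}" by simp
          then have "?c + 1 + j \<notin> addrs f" using disj by blast
          then show "?\<mu> (?c + 1 + j) = mem s1 (?c + 1 + j)"
            using m2[of "?c + 1 + j"] F1 \<open>j < m\<close> by simp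
        qed
        have L3: "flist ?\<mu> ?U2 m (reg s rRes) Xs"
        proof -
          have "flist ?\<mu> ?U m (reg s rRes) Xs"
            by (rule flist_mono[OF Xs(3)]) (use mU in auto)
          then show ?thesis by (rule flist_mono) (use sub in auto)
        qed
        have "product_inv s\<^sub>0 lo m (insert ?Z \<S>) ?s"
        proof (rule product_invI[where f = f2 and Xs = "?Z # Xs"])
          show "flist (mem ?s) ({lo..<reg ?s rFree} - addrs f2) m (reg ?s rRes) (?Z # Xs)"
            using L3 v3 cU fr(2,3) by simp
          show "fresh ?s" using fr2 F1 F2 by (auto simp: fresh_def)
          show "distinct (?Z # Xs)" "set (?Z # Xs) = insert ?Z \<S>" using Xs False by auto
          show "members m f2 = insert ?Z \<S>" using f2(3) f(3) by simp
          show "mem ?s a = mem s\<^sub>0 a" if "a < lo" for a using mlo that fr(3) by simp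
          show "trie_at (mem ?s) lo (reg ?s rFree) m f2" using T3 by simp
          show "f2 (0, {}) = Some (reg ?s rRoot)" using f2(2) r2[of rRoot] by simp
        qed (use fr(2) lo2 in simp_all)
        moreover have "reg ?s r = reg s r" if "r \<notin> wregs product_body" for r
          using that reg[of r] by simp
        ultimately show ?thesis
          using False fl f(3) t1 t2 J cell reg by (auto intro!: post)
      qed
    qed
  qed (use X(2) Y(2) P(2) fr(3) in auto)
qed

lemma flist_drop:
  assumes "flist \<mu> {..<lo} m p (drop j Xs)" "j < length Xs"
  shows "p \<noteq> 0" "p + m < lo" "vec \<mu> (p + 1) m (Xs ! j)" "flist \<mu> {..<lo} m (\<mu> p) (drop (Suc j) Xs)"
  using assms by (auto simp: Cons_nth_drop_Suc[symmetric] subset_eq)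

lemma wp_product_row:
  assumes I: "product_inv s\<^sub>0 lo m \<S> s" and M: "reg s rM = m"
    and X: "vec (mem s\<^sub>0) (reg s rI + 1) m X" "reg s rI + m < lo"
    and B: "flist (mem s\<^sub>0) {..<lo} m (reg s rJ) Bs"
    and P: "vec (mem s\<^sub>0) (reg s rMask) m P" "reg s rMask + m \<le> lo" and b: "reg s rPol = of_bool b"
    and post: "\<And>t s'. t \<le> length Bs * (160 * m + 70) + 3 \<Longrightarrow>
      product_inv s\<^sub>0 lo m (\<S> \<union> mix m P b X ` set Bs) s' \<Longrightarrow>
      (\<And>r. r \<notin> wregs product_body \<Longrightarrow> reg s' r = reg s r) \<Longrightarrow> Q t s'"
  shows "wp (While (Neq (Reg rJ) (Const 0)) product_body) Q s"
proof (rule wp_for[where N = "length Bs" and C = "160 * m + 70" and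
      I = "\<lambda>j s'. product_inv s\<^sub>0 lo m (\<S> \<union> mix m P b X ` set (take j Bs)) s' \<and>
        flist (mem s\<^sub>0) {..<lo} m (reg s' rJ) (drop j Bs)"])
  show "product_inv s\<^sub>0 lo m (\<S> \<union> mix m P b X ` set (take 0 Bs)) s \<and>
    flist (mem s\<^sub>0) {..<lo} m (reg s rJ) (drop 0 Bs)" using I B by simp
next
  fix j s' assume j: "j < length Bs" and I': "product_inv s\<^sub>0 lo m (\<S> \<union> mix m P b X ` set (take j Bs)) s' \<and>
        flist (mem s\<^sub>0) {..<lo} m (reg s' rJ) (drop j Bs)"
    and r: "\<And>r. r \<notin> wregs product_body \<Longrightarrow> reg s' r = reg s r"
  note d = flist_drop[OF conjunct2[OF I'] j]
  have tk: "insert (mix m P b X (Bs ! j)) (\<S> \<union> mix m P b X ` set (take j Bs)) =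
      \<S> \<union> mix m P b X ` set (take (Suc j) Bs)"
    using j by (auto simp: take_Suc_conv_app_nth)
  have "wp product_body (\<lambda>t s''. t + cost_test (Neq (Reg rJ) (Const 0)) \<le> 160 * m + 70 \<and>
      product_inv s\<^sub>0 lo m (\<S> \<union> mix m P b X ` set (take (Suc j) Bs)) s'' \<and>
      flist (mem s\<^sub>0) {..<lo} m (reg s'' rJ) (drop (Suc j) Bs)) s'"
    by (rule wp_product_body[OF conjunct1[OF I'] _ _ _ d(3) d(2)])
      (use M X P b r d(4) tk in auto)
  then show "eval_test s' (Neq (Reg rJ) (Const 0)) \<and>
     wp product_body (\<lambda>t s''. t + cost_test (Neq (Reg rJ) (Const 0)) \<le> 160 * m + 70 \<and>
      product_inv s\<^sub>0 lo m (\<S> \<union> mix m P b X ` set (take (Suc j) Bs)) s'' \<and>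
      flist (mem s\<^sub>0) {..<lo} m (reg s'' rJ) (drop (Suc j) Bs)) s'"
    using d(1) by simp
qed (auto intro!: post)

definition products :: "nat \<Rightarrow> nat set \<Rightarrow> bool \<Rightarrow> nat set set \<Rightarrow> nat set set \<Rightarrow> nat set set" where
  "products m P b \<A> \<B> = (\<Union>X\<in>\<A>. mix m P b X ` \<B>)"

text \<open>Nonempty lists and a positive \<open>m\<close> allow the overhead of each row and of the
  whole call to be charged to the pairs, so the time is a pure multiple of
  \<open>length As * length Bs * m\<close>. Both operands lie below the initial allocation pointer
  and are never written to.\<close>

lemma wp_product_com:
  assumes fr: "fresh s" and M: "reg s rM = m" and pos: "0 < m" "0 < reg s rFree"
    and A: "flist (mem s) {..<reg s rFree} m (reg s rA) As" "As \<noteq> []"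
    and B: "flist (mem s) {..<reg s rFree} m (reg s rB) Bs" "Bs \<noteq> []"
    and P: "vec (mem s) (reg s rMask) m P" "reg s rMask + m \<le> reg s rFree"
    and b: "reg s rPol = of_bool b"
    and post: "\<And>t s' Xs. t \<le> 300 * (length As * length Bs * m) \<Longrightarrow> fresh s' \<Longrightarrow>
      reg s rFree \<le> reg s' rFree \<Longrightarrow> (\<And>a. a < reg s rFree \<Longrightarrow> mem s' a = mem s a) \<Longrightarrow>
      distinct Xs \<Longrightarrow> set Xs = products m P b (set As) (set Bs) \<Longrightarrow>
      flist (mem s') {..<reg s' rFree} m (reg s' rRes) Xs \<Longrightarrow>
      (\<And>r. r \<notin> wregs product_com \<Longrightarrow> reg s' r = reg s r) \<Longrightarrow> Q t s'"
  shows "wp product_com Q s"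
proof -
  let ?lo = "reg s rFree" and ?C = "length Bs * (160 * m + 70) + 20"
  let ?s1 = "s\<lparr>reg := (reg s)(rRes := 0, rRoot := ?lo, rFree := Suc (Suc ?lo), rI := reg s rA)\<rparr>"
  let ?body = "Assign rJ (Reg rB) ;; While (Neq (Reg rJ) (Const 0)) product_body ;;
        Assign rI (Load (Reg rI))"
  define S where "S i = products m P b (set (take i As)) (set Bs)" for i
  have z: "\<And>a. ?lo \<le> a \<Longrightarrow> mem s a = 0" using fr by (simp add: fresh_def)
  have "product_inv s ?lo m (S 0) ?s1"
    by (rule product_invI[where f = "[(0, {}) \<mapsto> ?lo]" and Xs = "[]"])
      (use z pos trie_at_root[of ?lo "mem s" m] in
        \<open>auto simp: fresh_def S_def products_def members_def\<close>)
  \<comment> \<open>The four initial assignments cost 10.\<close>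
  then have "wp (While (Neq (Reg rI) (Const 0)) ?body) (\<lambda>t. Q (10 + t)) ?s1"
  proof (rule_tac wp_for[where N = "length As" and C = ?C and
      I = "\<lambda>i s'. product_inv s ?lo m (S i) s' \<and>
        flist (mem s) {..<?lo} m (reg s' rI) (drop i As)"])
    fix i s' assume i: "i < length As" and I: "product_inv s ?lo m (S i) s' \<and>
        flist (mem s) {..<?lo} m (reg s' rI) (drop i As)"
      and r': "\<And>r. r \<notin> wregs ?body \<Longrightarrow> reg s' r = reg ?s1 r"
    have r: "reg s' r = reg s r" if "r \<notin> wregs product_com" for r
      using r'[of r] that by simp
    note d = flist_drop[OF conjunct2[OF I] i]
    have I2: "product_inv s ?lo m (S i) (s'\<lparr>reg := (reg s')(rJ := reg s rB)\<rparr>)"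
      using I by (simp add: product_inv_def fresh_def)
    have S: "S i \<union> mix m P b (As ! i) ` set Bs = S (Suc i)"
      using i by (auto simp: S_def products_def take_Suc_conv_app_nth)
    have "wp (While (Neq (Reg rJ) (Const 0)) product_body) (\<lambda>t. \<lambda>s3.
        10 + t \<le> ?C \<and> product_inv s ?lo m (S (Suc i)) (s3\<lparr>reg := (reg s3)(rI := mem s3 (reg s3 rI))\<rparr>) \<and>
        flist (mem s) {..<?lo} m (mem s3 (reg s3 rI)) (drop (Suc i) As))
       (s'\<lparr>reg := (reg s')(rJ := reg s rB)\<rparr>)"
    proof (rule wp_product_row[OF I2, where X = "As ! i" and Bs = Bs and P = P and b = b])
      fix t s3 assume t: "t \<le> length Bs * (160 * m + 70) + 3"
        and I3: "product_inv s ?lo m (S i \<union> mix m P b (As ! i) ` set Bs) s3"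
        and r3: "\<And>r. r \<notin> wregs product_body \<Longrightarrow>
           reg s3 r = reg (s'\<lparr>reg := (reg s')(rJ := reg s rB)\<rparr>) r"
      have "reg s3 rI = reg s' rI" using r3[of rI] by simp
      moreover have "mem s3 (reg s' rI) = mem s (reg s' rI)"
        using I3 d(2) by (simp add: product_inv_def)
      ultimately have "flist (mem s) {..<?lo} m (mem s3 (reg s3 rI)) (drop (Suc i) As)"
        using d(4) by simp
      moreover have "product_inv s ?lo m (S (Suc i)) (s3\<lparr>reg := (reg s3)(rI := mem s3 (reg s3 rI))\<rparr>)"
        using I3 unfolding S by (simp add: product_inv_def fresh_def)
      ultimately show "10 + t \<le> ?C \<and>
        product_inv s ?lo m (S (Suc i)) (s3\<lparr>reg := (reg s3)(rI := mem s3 (reg s3 rI))\<rparr>) \<and>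
        flist (mem s) {..<?lo} m (mem s3 (reg s3 rI)) (drop (Suc i) As)"
        using t by simp
    qed (use M r d B P b in simp_all)
    then show "eval_test s' (Neq (Reg rI) (Const 0)) \<and>
      wp ?body (\<lambda>t s''. t + cost_test (Neq (Reg rI) (Const 0)) \<le> ?C \<and>
        product_inv s ?lo m (S (Suc i)) s'' \<and>
        flist (mem s) {..<?lo} m (reg s'' rI) (drop (Suc i) As)) s'"
      using d(1) r[of rB] by (auto elim!: wp_mono)
  next
    fix t s' assume t: "t \<le> length As * ?C + cost_test (Neq (Reg rI) (Const 0))"
      and I: "product_inv s ?lo m (S (length As)) s' \<and>
        flist (mem s) {..<?lo} m (reg s' rI) (drop (length As) As)"
      and r': "\<And>r. r \<notin> wregs ?body \<Longrightarrow> reg s' r = reg ?s1 r"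
    have r: "reg s' r = reg s r" if "r \<notin> wregs product_com" for r
      using r'[of r] that by simp
    from I obtain f Xs where *: "fresh s'" "?lo \<le> reg s' rFree" "\<And>a. a < ?lo \<Longrightarrow> mem s' a = mem s a"
      "distinct Xs" "set Xs = S (length As)"
      "flist (mem s') ({?lo..<reg s' rFree} - addrs f) m (reg s' rRes) Xs"
      unfolding product_inv_def by blast
    have le: "1 \<le> length Bs * m" "1 \<le> length As" "1 \<le> length Bs" "1 \<le> m"
      using pos A(2) B(2) by (simp_all add: Suc_le_eq)
    have bm: "length Bs \<le> length Bs * m" using le(4) by simp
    have "?C = 160 * (length Bs * m) + 70 * length Bs + 20" by (simp add: algebra_simps)
    then have "?C + 20 \<le> 270 * (length Bs * m)" using le(1) bm by linarith
    then have "length As * (?C + 20) \<le> length As * (270 * (length Bs * m))"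
      by (rule mult_le_mono2)
    moreover have "length As * ?C + 20 \<le> length As * (?C + 20)"
      using le(2) by (simp add: algebra_simps)
    ultimately have "10 + t \<le> 300 * (length As * length Bs * m)"
      using t by (simp add: algebra_simps)
    then show "Q (10 + t) s'"
      using * r by (intro post[of _ s' Xs]) (auto simp: S_def elim!: flist_mono)
  qed (use A in auto)
  then show ?thesis
    unfolding product_com_def by (simp, elim wp_mono, simp add: eval_nat_numeral)
qed

subsection \<open>Precisely satisfiable sets along the tree\<close>

text \<open>Total assignments replace those of \<open>vars (restr F C X)\<close>, a set that depends
  on \<open>C\<close> and may be smaller than \<open>X\<close>. Assignments of different
  restrictions can then be combined without adjusting their domains.\<close>

definition ps_sets :: "('c, 'v) cnf \<Rightarrow> 'c set \<Rightarrow> 'v set \<Rightarrow> 'c set set" where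
  "ps_sets F C X = range (\<lambda>\<tau>. {c \<in> C. \<exists>l\<in>lits F c. lit_var l \<in> X \<and> lit_val \<tau> l})"

lemma PS_restr: "PS (restr F C X) = ps_sets F C X"
proof -
  let ?V = "vars (restr F C X)"
  let ?S = "\<lambda>\<tau>. {c \<in> C. \<exists>l\<in>lits F c. lit_var l \<in> X \<and> lit_val \<tau> l}"
  have sat: "sat (restr F C X) \<tau> = ?S \<tau>" for \<tau> by (auto simp: sat_def restr_def)
  \<comment> \<open>Variables that do not occur in the restricted clauses have no influence.\<close>
  have "?S \<tau> = ?S (restrict \<tau> ?V)" for \<tau>
  proof -
    have "lit_val (restrict \<tau> ?V) l = lit_val \<tau> l"
      if "c \<in> C" "l \<in> lits F c" "lit_var l \<in> X" for c l
    proof -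
      have "lit_var l \<in> ?V" using that by (auto simp: vars_def restr_def)
      then show ?thesis by (cases l) auto
    qed
    then have "c \<in> ?S \<tau> \<longleftrightarrow> c \<in> ?S (restrict \<tau> ?V)" for c by (simp cong: bex_cong conj_cong)
    then show ?thesis by blast
  qed
  moreover have "restrict \<tau> ?V \<in> assignments ?V" for \<tau> by (simp add: assignments_def)
  ultimately have "range ?S \<subseteq> ?S ` assignments ?V" by (intro image_subsetI) (rule image_eqI)
  then have "range ?S = ?S ` assignments ?V" by (intro equalityI) (auto simp only: image_mono[OF subset_UNIV])
  moreover have "PS (restr F C X) = ?S ` assignments ?V" unfolding PS_def sat by (simp add: setcompr_eq_image)
  ultimately show ?thesis unfolding ps_sets_def by simp
qed

lemma ps_sets_subset: "S \<in> ps_sets F C X \<Longrightarrow> S \<subseteq> C"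
  by (auto simp: ps_sets_def)

lemma ps_sets_empty: "ps_sets F C {} = {{}}"
  by (auto simp: ps_sets_def)

lemma ps_sets_single:
  "ps_sets F C {x} = {{c \<in> C. Pos x \<in> lits F c}, {c \<in> C. Neg x \<in> lits F c}}"
proof -
  have "{c \<in> C. \<exists>l\<in>lits F c. lit_var l \<in> {x} \<and> lit_val \<tau> l} =
      (if \<tau> x then {c \<in> C. Pos x \<in> lits F c} else {c \<in> C. Neg x \<in> lits F c})" for \<tau>
  proof -
    have *: "lit_var l \<in> {x} \<longleftrightarrow> l = Pos x \<or> l = Neg x" for l by (cases l) auto
    have "(\<exists>l\<in>lits F c. (l = Pos x \<or> l = Neg x) \<and> lit_val \<tau> l) \<longleftrightarrow>
      (if \<tau> x then Pos x \<in> lits F c else Neg x \<in> lits F c)" for c by auto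
    then show ?thesis unfolding * by simp
  qed
  then have "ps_sets F C {x} =
      (\<lambda>b. if b then {c \<in> C. Pos x \<in> lits F c} else {c \<in> C. Neg x \<in> lits F c}) ` range (\<lambda>\<tau>. \<tau> x)"
    unfolding ps_sets_def by (simp only: image_image)
  moreover have "b \<in> range (\<lambda>\<tau>. \<tau> x)" for b :: bool by (rule range_eqI[of _ _ "\<lambda>_. b"]) simp
  then have "range (\<lambda>\<tau>. \<tau> x) = (UNIV :: bool set)" by blast
  ultimately show ?thesis by (simp add: UNIV_bool insert_commute)
qed

text \<open>As \<open>X1\<close> and \<open>X2\<close> are disjoint, two assignments can be glued
  along them. Intersecting with \<open>C\<close> discards the clauses that \<open>C1\<close> or
  \<open>C2\<close> contains in addition. Keeping \<open>C1\<close> and \<open>C2\<close> separate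
  makes the lemma fit both directions: bottom-up they are the clauses outside either child, top-down
  the clauses below the parent and those outside the sibling.\<close>

lemma ps_sets_Un:
  assumes "X1 \<inter> X2 = {}" "C \<subseteq> C1" "C \<subseteq> C2"
  shows "ps_sets F C (X1 \<union> X2) = {(S1 \<union> S2) \<inter> C |S1 S2. S1 \<in> ps_sets F C1 X1 \<and> S2 \<in> ps_sets F C2 X2}"
    (is "?L = ?R")
proof -
  define S where "S C X \<tau> = {c \<in> C. \<exists>l\<in>lits F c. lit_var l \<in> X \<and> lit_val \<tau> l}" for C X \<tau>
  have ps: "ps_sets F C X = range (S C X)" for C X by (simp add: ps_sets_def S_def)
  have Un: "S C (X1 \<union> X2) \<tau> = (S C1 X1 \<tau> \<union> S C2 X2 \<tau>) \<inter> C" for \<tau>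
    using assms(2,3) unfolding S_def by blast
  have "(S C1 X1 \<tau>1 \<union> S C2 X2 \<tau>2) \<inter> C \<in> range (S C (X1 \<union> X2))" for \<tau>1 \<tau>2
  proof -
    define \<tau> where "\<tau> x = (if x \<in> X1 then \<tau>1 x else \<tau>2 x)" for x
    have "lit_val \<tau> l = lit_val \<tau>1 l" if "lit_var l \<in> X1" for l
      using that by (cases l) (auto simp: \<tau>_def)
    then have 1: "S C1 X1 \<tau> = S C1 X1 \<tau>1" unfolding S_def by blast
    have "lit_val \<tau> l = lit_val \<tau>2 l" if "lit_var l \<in> X2" for l
    proof -
      have "lit_var l \<notin> X1" using that assms(1) by blast
      then show ?thesis by (cases l) (auto simp: \<tau>_def)
    qed
    then have 2: "S C2 X2 \<tau> = S C2 X2 \<tau>2" unfolding S_def by blast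
    show ?thesis using Un[of \<tau>] rangeI[of "S C (X1 \<union> X2)" \<tau>] unfolding 1 2 by simp
  qed
  then have "?R \<subseteq> range (S C (X1 \<union> X2))" unfolding ps by fast
  moreover have "S C (X1 \<union> X2) \<tau> \<in> ?R" for \<tau>
    unfolding ps Un
    by (rule CollectI, rule exI[of _ "S C1 X1 \<tau>"], rule exI[of _ "S C2 X2 \<tau>"]) simp
  ultimately show ?thesis unfolding ps[of C] by (intro equalityI image_subsetI)
qed

lemma UN_setcompr: "{g x y |x y. x \<in> A \<and> y \<in> B} = (\<Union>x\<in>A. g x ` B)"
  by blast

section \<open>Nodes and leaves of a binary tree\<close>

lemma mem_nodes: "v \<in> set (nodes v)"
  by (cases v) auto

lemma nodes_trans: "v \<in> set (nodes u) \<Longrightarrow> set (nodes v) \<subseteq> set (nodes u)"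
  by (induction u) auto

lemma nodes_leaves: "v \<in> set (nodes u) \<Longrightarrow> set (leaves v) \<subseteq> set (leaves u)"
  by (induction u) auto

lemma nodes_distinct: "v \<in> set (nodes u) \<Longrightarrow> distinct (leaves u) \<Longrightarrow> distinct (leaves v)"
  by (induction u) auto

lemma length_nodes: "length (nodes u) + 1 = 2 * length (leaves u)"
  by (induction u) auto

lemma leaves_nonempty: "leaves u \<noteq> []"
  by (induction u) auto

lemma below_Branch:
  "clauses_below (Branch l r) = clauses_below l \<union> clauses_below r"
  "vars_below (Branch l r) = vars_below l \<union> vars_below r"
  by (auto simp: clauses_below_def vars_below_def)

lemma below_Leaf:
  "clauses_below (Leaf (Inl c)) = {c}" "vars_below (Leaf (Inl c)) = {}"
  "clauses_below (Leaf (Inr x)) = {}" "vars_below (Leaf (Inr x)) = {x}"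
  by (auto simp: clauses_below_def vars_below_def)

section \<open>The families of the cuts as sets of clause numbers\<close>

locale decomposed_cnf =
  fixes F :: "('c, 'v) cnf" and T :: "('c + 'v) btree" and \<gamma> :: "'c \<Rightarrow> nat" and \<nu> :: "'v \<Rightarrow> nat"
    and m n k :: nat
  assumes wf: "wf_cnf F" and m: "m = card (cla F)" and n: "n = card (vars F)"
    and bd: "branch_decomposition F T" and k: "k = ps_width F T"
    and \<gamma>: "numbering \<gamma> (cla F)" and \<nu>: "numbering \<nu> (vars F)"
begin

definition below :: "('c + 'v) btree \<Rightarrow> nat set" where
  "below v = \<gamma> ` clauses_below v"

definition fam :: "('c + 'v) btree \<Rightarrow> nat set set" where
  "fam v = (`) \<gamma> ` PS (F_node F v)"

definition cofam :: "('c + 'v) btree \<Rightarrow> nat set set" where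
  "cofam v = (`) \<gamma> ` PS (F_conode F v)"

definition occurs :: "'v literal \<Rightarrow> nat set" where
  "occurs l = \<gamma> ` {c \<in> cla F. l \<in> lits F c}"

lemma finite_cla: "finite (cla F)" using wf by (simp add: wf_cnf_def)

lemma finite_vars: "finite (vars F)"
  using wf by (auto simp: wf_cnf_def vars_def)

lemma \<gamma>_inj: "inj_on \<gamma> (cla F)" and \<gamma>_image: "\<gamma> ` cla F = {..<m}"
  using \<gamma> unfolding numbering_def m bij_betw_def by auto

lemma \<nu>_inj: "inj_on \<nu> (vars F)" and \<nu>_image: "\<nu> ` vars F = {..<n}"
  using \<nu> unfolding numbering_def n bij_betw_def by auto

lemma leaves_T: "distinct (leaves T)" "set (leaves T) = Inl ` cla F \<union> Inr ` vars F"
  using bd by (auto simp: branch_decomposition_def)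

lemma node_below:
  assumes "v \<in> set (nodes T)"
  shows "clauses_below v \<subseteq> cla F" "vars_below v \<subseteq> vars F"
  using nodes_leaves[OF assms] leaves_T(2) by (auto simp: clauses_below_def vars_below_def)

lemma root_below: "clauses_below T = cla F" "vars_below T = vars F"
  using leaves_T(2) by (auto simp: clauses_below_def vars_below_def)

lemma branch_disjoint:
  assumes "Branch l r \<in> set (nodes T)"
  shows "clauses_below l \<inter> clauses_below r = {}" "vars_below l \<inter> vars_below r = {}"
    "l \<in> set (nodes T)" "r \<in> set (nodes T)"
  using nodes_distinct[OF assms leaves_T(1)] nodes_trans[OF assms] mem_nodes[of l] mem_nodes[of r]
  by (auto simp: clauses_below_def vars_below_def)

lemma mix_image:
  assumes "S1 \<subseteq> cla F" "S2 \<subseteq> cla F" "\<And>c. c \<in> cla F \<Longrightarrow> (\<gamma> c \<in> P) = b \<longleftrightarrow> c \<in> C"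
  shows "mix m P b (\<gamma> ` S1) (\<gamma> ` S2) = \<gamma> ` ((S1 \<union> S2) \<inter> C)"
proof (rule set_eqI)
  fix j
  have "\<gamma> c < m" if "c \<in> S1 \<union> S2" for c
    using \<gamma>_image that assms(1,2) by blast
  then have "j \<in> mix m P b (\<gamma> ` S1) (\<gamma> ` S2) \<longleftrightarrow> (\<exists>c\<in>S1 \<union> S2. j = \<gamma> c \<and> (\<gamma> c \<in> P) = b)"
    by (auto simp: mix_def)
  also have "\<dots> \<longleftrightarrow> j \<in> \<gamma> ` ((S1 \<union> S2) \<inter> C)" using assms by blast
  finally show "j \<in> mix m P b (\<gamma> ` S1) (\<gamma> ` S2) \<longleftrightarrow> j \<in> \<gamma> ` ((S1 \<union> S2) \<inter> C)" .
qed

text \<open>\<open>ps_sets_Un\<close> carried over to clause numbers. The mask \<open>P\<close> with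
  polarity \<open>b\<close> singles out \<open>C\<close> among the clauses, so that the intersection
  with \<open>C\<close> becomes a test of one bit.\<close>

lemma products_image:
  assumes "X1 \<inter> X2 = {}" "C \<subseteq> C1" "C \<subseteq> C2" "C1 \<subseteq> cla F" "C2 \<subseteq> cla F"
    and "\<And>c. c \<in> cla F \<Longrightarrow> (\<gamma> c \<in> P) = b \<longleftrightarrow> c \<in> C"
  shows "products m P b ((`) \<gamma> ` ps_sets F C1 X1) ((`) \<gamma> ` ps_sets F C2 X2) =
    (`) \<gamma> ` ps_sets F C (X1 \<union> X2)"
proof -
  let ?P1 = "ps_sets F C1 X1" and ?P2 = "ps_sets F C2 X2"
  have *: "mix m P b (\<gamma> ` S1) (\<gamma> ` S2) = \<gamma> ` ((S1 \<union> S2) \<inter> C)"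
    if "S1 \<in> ?P1" "S2 \<in> ?P2" for S1 S2
  proof (rule mix_image)
    show "S1 \<subseteq> cla F" using ps_sets_subset[OF that(1)] assms(4) by simp
    show "S2 \<subseteq> cla F" using ps_sets_subset[OF that(2)] assms(5) by simp
  qed (rule assms(6))
  have "products m P b ((`) \<gamma> ` ?P1) ((`) \<gamma> ` ?P2) =
      (\<Union>S1\<in>?P1. (\<lambda>S2. mix m P b (\<gamma> ` S1) (\<gamma> ` S2)) ` ?P2)"
    by (simp add: products_def image_image)
  also have "\<dots> = (\<Union>S1\<in>?P1. (\<lambda>S2. \<gamma> ` ((S1 \<union> S2) \<inter> C)) ` ?P2)"
    using * by (intro SUP_cong image_cong) auto
  also have "\<dots> = (`) \<gamma> ` {(S1 \<union> S2) \<inter> C |S1 S2. S1 \<in> ?P1 \<and> S2 \<in> ?P2}"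
    by (simp only: UN_setcompr image_UN image_image)
  also have "\<dots> = (`) \<gamma> ` ps_sets F C (X1 \<union> X2)"
    by (simp only: ps_sets_Un[OF assms(1-3)])
  finally show ?thesis .
qed

lemma in_below: "v \<in> set (nodes T) \<Longrightarrow> c \<in> cla F \<Longrightarrow> \<gamma> c \<in> below v \<longleftrightarrow> c \<in> clauses_below v"
  by (simp add: below_def inj_on_image_mem_iff[OF \<gamma>_inj _ node_below(1)])

lemma fam_ps_sets: "fam v = (`) \<gamma> ` ps_sets F (cla F - clauses_below v) (vars_below v)"
  by (simp add: fam_def F_node_def PS_restr)

lemma cofam_ps_sets: "cofam v = (`) \<gamma> ` ps_sets F (clauses_below v) (vars F - vars_below v)"
  by (simp add: cofam_def F_conode_def PS_restr)

lemma fam_Branch: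
  assumes v: "Branch l r \<in> set (nodes T)"
  shows "products m (below (Branch l r)) False (fam l) (fam r) = fam (Branch l r)"
proof -
  note d = branch_disjoint[OF v]
  show ?thesis
    unfolding fam_ps_sets below_Branch(2)
  proof (rule products_image)
    fix c assume "c \<in> cla F"
    then show "(\<gamma> c \<in> below (Branch l r)) = False \<longleftrightarrow> c \<in> cla F - clauses_below (Branch l r)"
      using in_below[OF v] by simp
  qed (use d in \<open>simp_all add: below_Branch Diff_mono\<close>)
qed

text \<open>The variables outside \<open>u\<close> are those outside its parent \<open>v\<close>
  together with those below its sibling \<open>w\<close>. Either child may take the role of
  \<open>u\<close>, which yields \<open>cofam_left\<close> and \<open>cofam_right\<close>.\<close>

lemma cofam_child:
  assumes v: "v \<in> set (nodes T)" and u: "u \<in> set (nodes T)" and w: "w \<in> set (nodes T)"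
    and below: "clauses_below v = clauses_below u \<union> clauses_below w" "vars_below v = vars_below u \<union> vars_below w"
    and disj: "clauses_below u \<inter> clauses_below w = {}" "vars_below u \<inter> vars_below w = {}"
  shows "products m (below u) True (cofam v) (fam w) = cofam u"
proof -
  have eq: "vars F - vars_below u = (vars F - vars_below v) \<union> vars_below w"
    using below(2) disj(2) node_below(2)[OF w] by blast
  show ?thesis
    unfolding cofam_ps_sets fam_ps_sets eq
  proof (rule products_image)
    show "(vars F - vars_below v) \<inter> vars_below w = {}" using below(2) by blast
    show "clauses_below u \<subseteq> clauses_below v" using below(1) by blast
    show "clauses_below u \<subseteq> cla F - clauses_below w" using disj(1) node_below(1)[OF u] by blast
    show "clauses_below v \<subseteq> cla F" using node_below(1)[OF v] .
    fix c assume "c \<in> cla F"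
    then show "(\<gamma> c \<in> below u) = True \<longleftrightarrow> c \<in> clauses_below u"
      using in_below[OF u] by simp
  qed simp
qed

lemma cofam_left:
  assumes v: "Branch l r \<in> set (nodes T)"
  shows "products m (below l) True (cofam (Branch l r)) (fam r) = cofam l"
  using branch_disjoint[OF v] by (intro cofam_child[OF v]) (simp_all add: below_Branch)

lemma cofam_right:
  assumes v: "Branch l r \<in> set (nodes T)"
  shows "products m (below r) True (cofam (Branch l r)) (fam l) = cofam r"
  using branch_disjoint[OF v] by (intro cofam_child[OF v]) (simp_all add: below_Branch Un_commute Int_commute)

text \<open>No variable lies outside the root, so every restricted clause is empty and never
  satisfied.\<close>

lemma cofam_root: "cofam T = {{}}"
  by (simp add: cofam_ps_sets root_below ps_sets_empty)

text \<open>There is no variable below a clause leaf, so \<open>{}\<close> is its only precisely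
  satisfiable set; under any mask the trivial product yields just that.\<close>

lemma fam_clause: "products m P b {{}} {{}} = fam (Leaf (Inl c))"
  by (auto simp: fam_ps_sets below_Leaf ps_sets_empty products_def mix_def)

text \<open>The two columns of a variable coincide if all its clauses contain both literals. The
  product with \<open>{{}}\<close> is there to merge them, since the machine removes duplicates only
  in products. No clause lies below the leaf, so the mask is empty and cuts off nothing.\<close>

lemma fam_var: "products m (below (Leaf (Inr x))) False {occurs (Neg x), occurs (Pos x)} {{}} =
    fam (Leaf (Inr x))"
proof -
  have "{occurs (Neg x), occurs (Pos x)} = (`) \<gamma> ` ps_sets F (cla F) {x}"
    unfolding ps_sets_single by (auto simp: occurs_def)
  moreover have "{{}} = (`) \<gamma> ` ps_sets F (cla F) {}" by (simp add: ps_sets_empty)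
  ultimately show ?thesis
    using products_image[of "{x}" "{}" "cla F" "cla F" "cla F" "{}" False]
    by (simp add: fam_ps_sets below_Leaf below_def)
qed

lemma ps_sets_finite: "C \<subseteq> cla F \<Longrightarrow> finite (ps_sets F C X)"
proof (rule finite_subset)
  show "ps_sets F C X \<subseteq> Pow C" using ps_sets_subset by blast
qed (use finite_cla in \<open>auto elim: finite_subset\<close>)

lemma fam_facts:
  assumes v: "v \<in> set (nodes T)"
  shows "fam v \<noteq> {}" "cofam v \<noteq> {}" "\<And>X. X \<in> fam v \<Longrightarrow> X \<subseteq> {..<m}" "\<And>X. X \<in> cofam v \<Longrightarrow> X \<subseteq> {..<m}"
    "finite (fam v)" "finite (cofam v)" "card (fam v) \<le> k" "card (cofam v) \<le> k"
proof -
  show "fam v \<noteq> {}" "cofam v \<noteq> {}" by (auto simp: fam_ps_sets cofam_ps_sets ps_sets_def)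
  show "X \<subseteq> {..<m}" if "X \<in> fam v" for X
    using that \<gamma>_image ps_sets_subset by (fastforce simp: fam_ps_sets)
  show "X \<subseteq> {..<m}" if "X \<in> cofam v" for X
    using that \<gamma>_image ps_sets_subset node_below(1)[OF v] by (fastforce simp: cofam_ps_sets)
  have f: "finite (PS (F_node F v))" "finite (PS (F_conode F v))"
    using node_below[OF v] by (auto simp: F_node_def F_conode_def PS_restr intro!: ps_sets_finite)
  then show "finite (fam v)" "finite (cofam v)" by (auto simp: fam_def cofam_def)
  have "ps_value F v \<le> k" unfolding k ps_width_def using v by (intro Max_ge) auto
  then show "card (fam v) \<le> k" "card (cofam v) \<le> k"
    using card_image_le[OF f(1), of "(`) \<gamma>"] card_image_le[OF f(2), of "(`) \<gamma>"]
    by (auto simp: fam_def cofam_def ps_value_def)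
qed

lemma length_leaves_T: "length (leaves T) = m + n"
proof -
  have "length (leaves T) = card (set (leaves T))" using leaves_T(1) by (simp add: distinct_card)
  also have "\<dots> = card (Inl ` cla F :: ('c + 'v) set) + card (Inr ` vars F :: ('c + 'v) set)"
    unfolding leaves_T(2) by (rule card_Un_disjoint) (use finite_cla finite_vars in auto)
  also have "\<dots> = m + n" by (simp add: card_image m n)
  finally show ?thesis .
qed

text \<open>Without clauses there are no variables either, and no label remains for the leaf that
  every tree has.\<close>

lemma m_pos: "0 < m"
proof (rule ccontr)
  assume "\<not> 0 < m"
  then have "cla F = {}" using finite_cla by (simp add: m)
  then have "vars F = {}" by (simp add: vars_def)
  moreover have "leaves T \<noteq> []" by (rule leaves_nonempty)
  ultimately show False using leaves_T(2) \<open>cla F = {}\<close> by simp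
qed

lemma k_pos: "0 < k"
  using fam_facts[OF mem_nodes[of T]] by (metis card_0_eq gr0I le_zero_eq)

end

subsection \<open>Reading the formula\<close>

abbreviation (input) "rN \<equiv> (4::nat)"
abbreviation (input) "rRows \<equiv> (5::nat)"
abbreviation (input) "rZero \<equiv> (6::nat)"
abbreviation (input) "rPos \<equiv> (7::nat)"
abbreviation (input) "rCount \<equiv> (26::nat)"
abbreviation (input) "rRow \<equiv> (33::nat)"
abbreviation (input) "rQ \<equiv> (34::nat)"

definition seg :: "(nat \<Rightarrow> nat) \<Rightarrow> nat \<Rightarrow> nat list \<Rightarrow> bool" where
  "seg \<mu> a ws \<longleftrightarrow> (\<forall>i<length ws. \<mu> (a + i) = ws ! i)"

lemma seg_Nil [simp]: "seg \<mu> a []"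
  by (simp add: seg_def)

lemma seg_Cons [simp]: "seg \<mu> a (w # ws) \<longleftrightarrow> \<mu> a = w \<and> seg \<mu> (Suc a) ws"
  by (auto simp: seg_def nth_Cons less_Suc_eq_0_disj split: nat.splits)

lemma seg_append [simp]: "seg \<mu> a (ws @ vs) \<longleftrightarrow> seg \<mu> a ws \<and> seg \<mu> (a + length ws) vs"
  by (induction ws arbitrary: a) auto

lemma seg_cong: "seg \<mu> a ws \<Longrightarrow> (\<And>b. a \<le> b \<Longrightarrow> b < a + length ws \<Longrightarrow> \<mu>' b = \<mu> b) \<Longrightarrow> seg \<mu>' a ws"
  by (simp add: seg_def)

text \<open>The pointer is advanced in constant steps, because assigning a sum of two registers
  would not be \<open>slow\<close>.\<close>

definition skip_com :: "nat \<Rightarrow> nat \<Rightarrow> com" where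
  "skip_com r k =
     Assign rQ (Const 0) ;; While (Less (Reg rQ) (Reg r)) (incr rFree k ;; incr rQ 1)"

lemma wregs_skip_com [simp]: "wregs (skip_com r k) = {rQ, rFree}"
  by (auto simp: skip_com_def)

lemma wp_skip_com:
  assumes r: "r \<notin> {rQ, rFree}"
    and post: "\<And>t s'. t \<le> 20 * reg s r + 10 \<Longrightarrow> reg s' rFree = reg s rFree + k * reg s r \<Longrightarrow>
      mem s' = mem s \<Longrightarrow> (\<And>q. q \<notin> {rQ, rFree} \<Longrightarrow> reg s' q = reg s q) \<Longrightarrow> Q t s'"
  shows "wp (skip_com r k) Q s"
  unfolding skip_com_def
  apply simp
  apply (rule wp_for[where N = "reg s r" and C = 20 and
      I = "\<lambda>j s'. reg s' rQ = j \<and> reg s' rFree = reg s rFree + k * j \<and> mem s' = mem s"])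
  subgoal by simp
  subgoal for j s' using r by auto
  subgoal for s' using r by auto
  subgoal for t s' by (rule post) auto
  done

lemma work_bounds:
  fixes m n :: nat
  assumes "0 < m"
  shows "m * n \<le> m * (m + n)" "m \<le> m * (m + n)" "n \<le> m * (m + n)" "1 \<le> m * (m + n)"
  using assms by (cases m; simp add: algebra_simps)+

text \<open>The program is not told how long its input is, so allocation starts at a safe upper
  bound: two header words, at most \<open>m * (2 * n + 1)\<close> words for the clauses and fewer
  than \<open>3 * (m + n)\<close> for the tree.\<close>

definition heap_com :: com where
  "heap_com =
     Assign rN (Load (Const 0)) ;; Assign rM (Load (Const 1)) ;; Assign rFree (Const 2) ;;
     Assign rCount (Const 0) ;;
     While (Less (Reg rCount) (Reg rM)) (skip_com rN 2 ;; incr rFree 5 ;; incr rCount 1) ;;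
     skip_com rN 4"

lemma wp_heap_com:
  assumes mn: "mem s 0 = n" "mem s 1 = m" and pos: "0 < m"
    and post: "\<And>t s'. t \<le> 100 * (m * (m + n)) \<Longrightarrow> reg s' rFree = 2 + m * (2 * n + 5) + 4 * n \<Longrightarrow>
      reg s' rN = n \<Longrightarrow> reg s' rM = m \<Longrightarrow> mem s' = mem s \<Longrightarrow> Q t s'"
  shows "wp heap_com Q s"
  unfolding heap_com_def
  apply (simp add: mn[unfolded One_nat_def])
  apply (rule wp_for[where N = m and C = "20 * n + 30" and
      I = "\<lambda>j s'. reg s' rCount = j \<and> reg s' rFree = 2 + j * (2 * n + 5) \<and> mem s' = mem s"])
  subgoal by simp
  subgoal for j s'
    by (simp, rule wp_skip_com) (auto simp: algebra_simps)
  subgoal for s' by simp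
  subgoal premises prems for t1 s1
  proof -
    have r: "reg s1 rN = n" "reg s1 rM = m" using prems(3) by simp_all
    show ?thesis
    proof (rule wp_skip_com)
      fix t and s' :: state assume t: "t \<le> 20 * reg s1 rN + 10" and s': "reg s' rFree = reg s1 rFree + 4 * reg s1 rN"
        "mem s' = mem s1" "\<And>q. q \<notin> {rQ, rFree} \<Longrightarrow> reg s' q = reg s1 q"
      have "m * (20 * n + 30) = 20 * (m * n) + 30 * m"
        by (simp add: algebra_simps)
      then have "Suc (Suc (Suc (Suc (Suc (Suc (Suc (Suc (Suc (Suc (t1 + t)))))))))) \<le> 100 * (m * (m + n))"
        using prems(1) t[unfolded r] work_bounds[OF pos, of n] unfolding cost_test.simps cost_exp.simps by linarith
      then show "Q (Suc (Suc (Suc (Suc (Suc (Suc (Suc (Suc (Suc (Suc (t1 + t))))))))))) s'"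
        by (rule post) (use prems(2) s' r in auto)
    qed simp
  qed
  done

section \<open>The table of literal occurrences\<close>

text \<open>A row holds, for one clause, the address of the next row and one bit for each literal code.\<close>

definition row_at :: "(nat \<Rightarrow> nat) \<Rightarrow> nat \<Rightarrow> nat \<Rightarrow> nat set \<Rightarrow> bool" where
  "row_at \<mu> n q L \<longleftrightarrow> \<mu> q = q + 2 * n + 1 \<and> vec \<mu> (q + 1) (2 * n) L"

lemma row_at_cong:
  "row_at \<mu> n q L \<Longrightarrow> (\<And>a. q \<le> a \<Longrightarrow> a \<le> q + 2 * n \<Longrightarrow> \<mu>' a = \<mu> a) \<Longrightarrow> row_at \<mu>' n q L"
  by (auto simp: row_at_def vec_def)

text \<open>A list of literal codes is turned into bits, so that membership of a literal becomes a
  single load. The link to the next row lets a column be traversed without multiplying by the row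
  length.\<close>

definition row_com :: com where
  "row_com =
     Assign rRow (Reg rFree) ;; incr rFree 1 ;; skip_com rN 2 ;; Store (Reg rRow) (Reg rFree) ;;
     Assign rK (Load (Reg rPos)) ;; incr rPos 1 ;; Assign rQ (Const 0) ;;
     While (Less (Reg rQ) (Reg rK))
       (Store (Add (Reg rRow) (Add (Const 1) (Load (Reg rPos)))) (Const 1) ;; incr rPos 1 ;; incr rQ 1) ;;
     incr rCount 1"

lemma wregs_row_com [simp]: "wregs row_com = {rRow, rFree, rQ, rK, rPos, rCount}"
  by (auto simp: row_com_def)

lemma wp_row_com:
  assumes fr: "fresh s" and n: "reg s rN = n" 
    and ls: "seg (mem s) (reg s rPos) (length ls # ls)" "reg s rPos + length ls < reg s rFree"
      "set ls \<subseteq> {..<2 * n}" "length ls \<le> 2 * n"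
    and post: "\<And>t s'. t \<le> 100 * n + 50 \<Longrightarrow> fresh s' \<Longrightarrow> reg s' rFree = reg s rFree + 2 * n + 1 \<Longrightarrow>
      reg s' rPos = reg s rPos + length ls + 1 \<Longrightarrow> reg s' rCount = reg s rCount + 1 \<Longrightarrow>
      (\<And>a. a < reg s rFree \<Longrightarrow> mem s' a = mem s a) \<Longrightarrow> row_at (mem s') n (reg s rFree) (set ls) \<Longrightarrow>
      (\<And>r. r \<notin> wregs row_com \<Longrightarrow> reg s' r = reg s r) \<Longrightarrow> Q t s'"
  shows "wp row_com Q s"
proof -
  let ?fr = "reg s rFree" and ?p = "reg s rPos"
  let ?I = "\<lambda>j s'. reg s' rQ = j \<and> reg s' rPos = ?p + 1 + j \<and> fresh s' \<and>
     (\<forall>a<?fr. mem s' a = mem s a) \<and> mem s' ?fr = ?fr + 2 * n + 1 \<and>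
     vec (mem s') (?fr + 1) (2 * n) (set (take j ls))"
  have z: "\<And>a. ?fr \<le> a \<Longrightarrow> mem s a = 0" using fr by (simp add: fresh_def)
  have inp: "mem s ?p = length ls" "\<And>j. j < length ls \<Longrightarrow> mem s (?p + 1 + j) = ls ! j"
    using ls(1)[unfolded seg_Cons] by (simp_all add: seg_def)
  show ?thesis
    unfolding row_com_def
    apply simp
    apply (rule wp_skip_com)
     apply simp
    subgoal premises prems for t1 s1
    proof -
      have r1: "reg s1 q = reg s q" if "q \<notin> {rQ, rFree, rRow}" for q
        using prems(4)[of q] that by simp
      have R: "reg s1 rRow = ?fr" using prems(4)[of rRow] by simp
      have F: "reg s1 rFree = ?fr + 2 * n + 1" using prems(2) n by simp
      have m1: "mem s1 = mem s" using prems(3) by simp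
      have t1: "t1 \<le> 20 * n + 10" using prems(1) n by simp
      have p: "reg s1 rPos = ?p" using r1 by simp
      have pfr: "?p \<noteq> ?fr" using ls(2) by simp
      show ?thesis
        apply (simp add: R F m1 p pfr inp)
        apply (rule wp_for[where N = "length ls" and C = 30 and I = ?I])
        subgoal using z F by (auto simp: fresh_def vec_def)
        subgoal premises st for j s'
        proof -
          have r: "reg s' rK = length ls" "reg s' rRow = ?fr" "reg s' rFree = ?fr + 2 * n + 1"
            using st(3)[of rK] st(3)[of rRow] st(3)[of rFree] R F by auto
          have v: "mem s' (?p + 1 + j) = ls ! j"
            using st(1,2) inp(2)[OF st(1)] ls(2) by simp
          have lj: "ls ! j < 2 * n" using ls(3) nth_mem[OF st(1)] by blast
          have tk: "set (take (Suc j) ls) = insert (ls ! j) (set (take j ls))"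
            using st(1) by (simp add: take_Suc_conv_app_nth)
          show ?thesis
            using st(1,2) v lj by (auto simp: r fresh_def vec_def tk)
        qed
        subgoal premises st for s'
          using st(1) st(2)[of rK] by simp
        subgoal premises st for t s'
        proof -
          have r: "reg s' q = reg s q" if "q \<notin> wregs row_com" for q
            using st(3)[of q] r1[of q] that by simp
          have r': "reg s' rFree = ?fr + 2 * n + 1" "reg s' rCount = reg s rCount"
            using st(3)[of rFree] st(3)[of rCount] r1[of rCount] F by auto
          show ?thesis
            by (rule post) (use st(1,2) r r' t1 ls(4) in \<open>auto simp: row_at_def fresh_def\<close>)
        qed
        done
    qed
    done
qed

definition rows_com :: com where
  "rows_com = Assign rRows (Reg rFree) ;; Assign rPos (Const 2) ;; Assign rCount (Const 0) ;;
     While (Less (Reg rCount) (Reg rM)) row_com"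

lemma wregs_rows_com [simp]: "wregs rows_com = {rRows, rRow, rFree, rQ, rK, rPos, rCount}"
  by (auto simp: rows_com_def)

definition rows_at :: "(nat \<Rightarrow> nat) \<Rightarrow> nat \<Rightarrow> nat \<Rightarrow> nat list list \<Rightarrow> bool" where
  "rows_at \<mu> n q Ls \<longleftrightarrow> (\<forall>j<length Ls. row_at \<mu> n (q + j * (2 * n + 1)) (set (Ls ! j)))"

abbreviation clause_words :: "nat list list \<Rightarrow> nat list" where
  "clause_words Ls \<equiv> concat (map (\<lambda>ls. length ls # ls) Ls)"

lemma clause_words_take:
  "j < length Ls \<Longrightarrow>
     length (clause_words (take (Suc j) Ls)) = length (clause_words (take j Ls)) + length (Ls ! j) + 1"
  by (simp add: take_Suc_conv_app_nth)

lemma clause_words_seg: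
  assumes "seg \<mu> a (clause_words Ls)" "j < length Ls"
  shows "seg \<mu> (a + length (clause_words (take j Ls))) (length (Ls ! j) # Ls ! j)"
    "length (clause_words (take j Ls)) + length (Ls ! j) < length (clause_words Ls)"
proof -
  have e: "take j Ls @ Ls ! j # drop (Suc j) Ls = Ls" using assms(2) by (rule id_take_nth_drop[symmetric])
  have "clause_words (take j Ls @ Ls ! j # drop (Suc j) Ls) =
      clause_words (take j Ls) @ (length (Ls ! j) # Ls ! j) @ clause_words (drop (Suc j) Ls)"
    by simp
  then have *: "clause_words Ls = clause_words (take j Ls) @ (length (Ls ! j) # Ls ! j) @
      clause_words (drop (Suc j) Ls)"
    unfolding e .
  show "seg \<mu> (a + length (clause_words (take j Ls))) (length (Ls ! j) # Ls ! j)"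
    using assms(1) unfolding * seg_append by blast
  show "length (clause_words (take j Ls)) + length (Ls ! j) < length (clause_words Ls)"
    using arg_cong[OF *, of length] by simp
qed

lemma wp_rows_com:
  assumes fr: "fresh s" and n: "reg s rN = n" and m: "reg s rM = length Ls" and pos: "Ls \<noteq> []"
    and Ls: "seg (mem s) 2 (clause_words Ls)" "2 + length (clause_words Ls) \<le> reg s rFree"
      "\<And>ls. ls \<in> set Ls \<Longrightarrow> set ls \<subseteq> {..<2 * n} \<and> length ls \<le> 2 * n"
    and post: "\<And>t s'. t \<le> 200 * (length Ls * (length Ls + n)) \<Longrightarrow> fresh s' \<Longrightarrow>
      reg s' rFree = reg s rFree + length Ls * (2 * n + 1) \<Longrightarrow>
      reg s' rPos = 2 + length (clause_words Ls) \<Longrightarrow> reg s' rRows = reg s rFree \<Longrightarrow>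
      (\<And>a. a < reg s rFree \<Longrightarrow> mem s' a = mem s a) \<Longrightarrow> rows_at (mem s') n (reg s rFree) Ls \<Longrightarrow>
      (\<And>r. r \<notin> wregs rows_com \<Longrightarrow> reg s' r = reg s r) \<Longrightarrow> Q t s'"
  shows "wp rows_com Q s"
proof -
  let ?fr = "reg s rFree"
  let ?I = "\<lambda>j s'. reg s' rCount = j \<and> reg s' rPos = 2 + length (clause_words (take j Ls)) \<and> fresh s' \<and>
     reg s' rFree = ?fr + j * (2 * n + 1) \<and> (\<forall>a<?fr. mem s' a = mem s a) \<and>
     (\<forall>i<j. row_at (mem s') n (?fr + i * (2 * n + 1)) (set (Ls ! i)))"
  show ?thesis
    unfolding rows_com_def
    apply simp
    apply (rule wp_for[where N = "length Ls" and C = "100 * n + 70" and I = ?I])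
    subgoal using fr by (simp add: fresh_def)
    subgoal premises st for j s'
    proof -
      have I: "reg s' rCount = j" "reg s' rPos = 2 + length (clause_words (take j Ls))" "fresh s'"
        "reg s' rFree = ?fr + j * (2 * n + 1)" "\<And>a. a < ?fr \<Longrightarrow> mem s' a = mem s a"
        "\<And>i. i < j \<Longrightarrow> row_at (mem s') n (?fr + i * (2 * n + 1)) (set (Ls ! i))"
        using st(2) by blast+
      have r: "reg s' rM = length Ls" "reg s' rN = n"
        using st(3)[of rM] st(3)[of rN] m n by simp_all
      note sg = clause_words_seg[OF Ls(1) st(1)]
      have seg': "seg (mem s') (reg s' rPos) (length (Ls ! j) # Ls ! j)"
        unfolding I(2) by (rule seg_cong[OF sg(1)]) (use sg(2) Ls(2) I(5) in simp)
      have mem: "Ls ! j \<in> set Ls" using st(1) by simp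
      have "wp row_com (\<lambda>t s''. t + cost_test (Less (Reg rCount) (Reg rM)) \<le> 100 * n + 70 \<and>
         ?I (Suc j) s'') s'"
      proof (rule wp_row_com[OF I(3) r(2) seg'])
        fix t s''
        assume t: "t \<le> 100 * n + 50" and fr'': "fresh s''"
          and F: "reg s'' rFree = reg s' rFree + 2 * n + 1"
          and P: "reg s'' rPos = reg s' rPos + length (Ls ! j) + 1" "reg s'' rCount = reg s' rCount + 1"
          and m'': "\<And>a. a < reg s' rFree \<Longrightarrow> mem s'' a = mem s' a"
          and row: "row_at (mem s'') n (reg s' rFree) (set (Ls ! j))"
        have "row_at (mem s'') n (?fr + i * (2 * n + 1)) (set (Ls ! i))" if "i < Suc j" for i
        proof (cases "i = j")
          case True
          then show ?thesis using row I(4) by simp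
        next
          case False
          then have i: "i < j" using that by simp
          then have "Suc i * (2 * n + 1) \<le> j * (2 * n + 1)" by (intro mult_le_mono1) simp
          then have "?fr + i * (2 * n + 1) + 2 * n < reg s' rFree" using I(4) by simp
          then show ?thesis by (intro row_at_cong[OF I(6)[OF i]] m'') simp
        qed
        moreover have "\<And>a. a < ?fr \<Longrightarrow> mem s'' a = mem s a" using I(4,5) m'' by simp
        ultimately show "t + cost_test (Less (Reg rCount) (Reg rM)) \<le> 100 * n + 70 \<and> ?I (Suc j) s''"
          using t fr'' F P I(1,2,4) clause_words_take[OF st(1)] by simp
      qed (use sg(2) Ls(2) I(2,4) Ls(3)[OF mem] in auto)
      then show ?thesis using r(1) I(1) st(1) by simp
    qed
    subgoal premises st for s'
      using st(1) st(2)[of rM] m by simp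
    subgoal premises st for t s'
    proof -
      have r: "reg s' q = reg s q" if "q \<notin> wregs rows_com" for q
        using st(3)[of q] that by simp
      have R: "reg s' rRows = ?fr" using st(3)[of rRows] by simp
      have "length Ls * (100 * n + 70) = 100 * (length Ls * n) + 70 * length Ls"
        by (simp add: algebra_simps)
      then have t: "Suc (Suc (Suc (Suc (Suc (Suc t))))) \<le> 200 * (length Ls * (length Ls + n))"
        using st(1) work_bounds[of "length Ls" n] pos unfolding cost_test.simps cost_exp.simps length_greater_0_conv by linarith
      show ?thesis
        by (rule post) (use t st(2) r R in \<open>auto simp: rows_at_def\<close>)
    qed
    done
qed

subsection \<open>Reading the tree\<close>

abbreviation (input) "rToks \<equiv> (8::nat)"
abbreviation (input) "rNeed \<equiv> (27::nat)"

text \<open>Reserving \<open>m + 1\<close> zero words already produces a cell with null link and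
  empty set. The list \<open>[{}]\<close> is the trivial factor in the products of the leaves and
  also the family of the complement of the root.\<close>

definition zero_com :: com where
  "zero_com = Assign rZero (Reg rFree) ;; incr rFree 1 ;; skip_com rM 1"

lemma wregs_zero_com [simp]: "wregs zero_com = {rZero, rFree, rQ}"
  by (auto simp: zero_com_def)

lemma wp_zero_com:
  assumes fr: "fresh s" "0 < reg s rFree" and m: "reg s rM = m"
    and post: "\<And>t s'. t \<le> 20 * m + 20 \<Longrightarrow> fresh s' \<Longrightarrow> reg s rFree \<le> reg s' rFree \<Longrightarrow> mem s' = mem s \<Longrightarrow>
      flist (mem s') {..<reg s' rFree} m (reg s' rZero) [{}] \<Longrightarrow>
      (\<And>r. r \<notin> wregs zero_com \<Longrightarrow> reg s' r = reg s r) \<Longrightarrow> Q t s'"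
  shows "wp zero_com Q s"
  unfolding zero_com_def
  apply simp
  apply (rule wp_skip_com)
   apply simp
  subgoal premises prems for t s'
  proof -
    have r: "reg s' r = reg s r" if "r \<notin> wregs zero_com" for r
      using prems(4)[of r] that by simp
    have Z: "reg s' rZero = reg s rFree" using prems(4)[of rZero] by simp
    have F: "reg s' rFree = reg s rFree + m + 1" using prems(2) m by simp
    have z: "\<And>a. reg s rFree \<le> a \<Longrightarrow> mem s a = 0" using fr(1) by (simp add: fresh_def)
    show ?thesis
      by (rule post) (use prems(1,3) m F Z z fr r in \<open>auto simp: fresh_def vec_def\<close>)
  qed
  done

fun children :: "'a btree \<Rightarrow> 'a btree list" where
  "children (Leaf a) = []"
| "children (Branch l r) = [l, r]"

lemma nodes_children: "nodes t = t # concat (map nodes (children t))"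
  by (cases t) auto

lemma nodes_nonempty: "nodes t \<noteq> []"
  by (cases t) auto

fun head_code :: "('c \<Rightarrow> nat) \<Rightarrow> ('v \<Rightarrow> nat) \<Rightarrow> ('c + 'v) btree \<Rightarrow> nat list" where
  "head_code \<gamma> \<nu> (Leaf (Inl c)) = [1, \<gamma> c]"
| "head_code \<gamma> \<nu> (Leaf (Inr x)) = [2, \<nu> x]"
| "head_code \<gamma> \<nu> (Branch l r) = [0]"

lemma tree_code_children:
  "tree_code \<gamma> \<nu> t = head_code \<gamma> \<nu> t @ concat (map (tree_code \<gamma> \<nu>) (children t))"
  by (cases "(\<gamma>, \<nu>, t)" rule: head_code.cases) auto

text \<open>A cell points to the code of a node in the input. Prepending puts the nodes into reverse
  preorder, where children precede their parents, as the bottom-up pass requires.\<close>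

fun toks_at :: "('c \<Rightarrow> nat) \<Rightarrow> ('v \<Rightarrow> nat) \<Rightarrow> (nat \<Rightarrow> nat) \<Rightarrow> nat \<Rightarrow> nat \<Rightarrow> ('c + 'v) btree list \<Rightarrow> bool" where
  "toks_at \<gamma> \<nu> \<mu> u p [] \<longleftrightarrow> p = 0"
| "toks_at \<gamma> \<nu> \<mu> u p (t # ts) \<longleftrightarrow> p \<noteq> 0 \<and> p + 1 < u \<and> seg \<mu> (\<mu> p) (head_code \<gamma> \<nu> t) \<and>
     \<mu> p + length (head_code \<gamma> \<nu> t) \<le> u \<and> toks_at \<gamma> \<nu> \<mu> u (\<mu> (p + 1)) ts"

lemma toks_at_mono:
  assumes "toks_at \<gamma> \<nu> \<mu> u p ts" "u \<le> u'" "\<And>a. a < u \<Longrightarrow> \<mu>' a = \<mu> a"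
  shows "toks_at \<gamma> \<nu> \<mu>' u' p ts"
  using assms(1)
proof (induction ts arbitrary: p)
  case (Cons t ts)
  then have *: "p \<noteq> 0" "p + 1 < u" "seg \<mu> (\<mu> p) (head_code \<gamma> \<nu> t)" "\<mu> p + length (head_code \<gamma> \<nu> t) \<le> u"
    "toks_at \<gamma> \<nu> \<mu>' u' (\<mu> (p + 1)) ts" by auto
  have "\<mu>' p = \<mu> p" "\<mu>' (p + 1) = \<mu> (p + 1)" using *(2) by (simp_all add: assms(3))
  moreover have "seg \<mu>' (\<mu> p) (head_code \<gamma> \<nu> t)"
    by (rule seg_cong[OF *(3)]) (use *(4) assms(3) in simp)
  ultimately show ?case using * assms(2) by simp
qed simp

text \<open>The tree code carries no length. \<open>rNeed\<close> counts the subtrees still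
  expected: a branch turns one into two, a leaf completes one, and the code ends when none is
  left.\<close>

definition toks_com :: com where
  "toks_com = Assign rToks (Const 0) ;; Assign rNeed (Const 1) ;;
     While (Less (Const 0) (Reg rNeed))
       (Store (Reg rFree) (Reg rPos) ;; Store (Add (Reg rFree) (Const 1)) (Reg rToks) ;;
        Assign rToks (Reg rFree) ;; incr rFree 2 ;;
        Cond (Eq (Load (Reg rPos)) (Const 0))
          (incr rNeed 1 ;; incr rPos 1) (Assign rNeed (Sub (Reg rNeed) (Const 1)) ;; incr rPos 2))"

lemma wregs_toks_com [simp]: "wregs toks_com = {rToks, rNeed, rFree, rPos}"
  by (auto simp: toks_com_def)

lemma wp_toks_com:
  assumes fr: "fresh s" "0 < reg s rFree"
    and T: "seg (mem s) (reg s rPos) (tree_code \<gamma> \<nu> T)" "reg s rPos + length (tree_code \<gamma> \<nu> T) \<le> reg s rFree"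
    and post: "\<And>t s'. t \<le> 40 * length (nodes T) + 20 \<Longrightarrow> fresh s' \<Longrightarrow> reg s rFree \<le> reg s' rFree \<Longrightarrow>
      (\<And>a. a < reg s rFree \<Longrightarrow> mem s' a = mem s a) \<Longrightarrow>
      toks_at \<gamma> \<nu> (mem s') (reg s' rFree) (reg s' rToks) (rev (nodes T)) \<Longrightarrow>
      (\<And>r. r \<notin> wregs toks_com \<Longrightarrow> reg s' r = reg s r) \<Longrightarrow> Q t s'"
  shows "wp toks_com Q s"
proof -
  let ?fr = "reg s rFree" and ?code = "tree_code \<gamma> \<nu>" and ?hd = "head_code \<gamma> \<nu>"
  \<comment> \<open>\<open>ps\<close> is the forest of subtrees still to be read. Its size is the
    value of \<open>rNeed\<close>, and its codes are the unread input.\<close>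
  let ?I = "\<lambda>j s'. fresh s' \<and> ?fr \<le> reg s' rFree \<and> (\<forall>a<?fr. mem s' a = mem s a) \<and>
     toks_at \<gamma> \<nu> (mem s') (reg s' rFree) (reg s' rToks) (rev (take j (nodes T))) \<and>
     (\<exists>ps. concat (map nodes ps) = drop j (nodes T) \<and> reg s' rNeed = length ps \<and>
        seg (mem s) (reg s' rPos) (concat (map ?code ps)) \<and>
        reg s' rPos + length (concat (map ?code ps)) \<le> ?fr)"
  show ?thesis
    unfolding toks_com_def
    apply simp
    apply (rule wp_for[where N = "length (nodes T)" and C = 40 and I = ?I])
    subgoal using fr T by (auto simp: fresh_def intro!: exI[of _ "[T]"])
    subgoal premises st for j s'
    proof -
      let ?u = "reg s' rFree" and ?p = "reg s' rPos"
      have I: "fresh s'" "?fr \<le> ?u" "\<And>a. a < ?fr \<Longrightarrow> mem s' a = mem s a"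
        "toks_at \<gamma> \<nu> (mem s') ?u (reg s' rToks) (rev (take j (nodes T)))"
        using st(2) by blast+
      from st(2) obtain ps where ps: "concat (map nodes ps) = drop j (nodes T)" "reg s' rNeed = length ps"
        "seg (mem s) ?p (concat (map ?code ps))" "?p + length (concat (map ?code ps)) \<le> ?fr"
        by blast
      let ?t = "nodes T ! j"
      have dj: "drop j (nodes T) = ?t # drop (Suc j) (nodes T)"
        using st(1) by (simp add: Cons_nth_drop_Suc)
      then obtain t ts where p: "ps = t # ts" using ps(1) by (cases ps) auto
      \<comment> \<open>Reading a node replaces it in the pending forest by its children.\<close>
      have t: "t = ?t" and rest: "concat (map nodes (children t @ ts)) = drop (Suc j) (nodes T)"
        using ps(1) dj unfolding p by (auto simp: nodes_children[of t])
      have sg: "seg (mem s) ?p (?hd t)" "?p + length (?hd t) \<le> ?fr"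
        "seg (mem s) (?p + length (?hd t)) (concat (map ?code (children t @ ts)))"
        "?p + length (?hd t) + length (concat (map ?code (children t @ ts))) \<le> ?fr"
        using ps(3,4) unfolding p by (simp_all add: tree_code_children[of \<gamma> \<nu> t])
      have len: "0 < length (?hd t)" by (cases "(\<gamma>, \<nu>, t)" rule: head_code.cases) auto
      have hd0: "mem s ?p = 0 \<longleftrightarrow> children t \<noteq> []" "length (?hd t) = (if children t = [] then 2 else 1)"
         "length (children t @ ts) = (if children t = [] then length ps - 1 else length ps + 1)"
        using sg(1) p by (cases "(\<gamma>, \<nu>, t)" rule: head_code.cases; simp)+
      have pfr: "?p < ?fr" using sg(2) len by linarith
      then have mp: "mem s' ?p = mem s ?p" and pu: "?p < ?u" using I(2,3) by simp_all
      define \<mu> where "\<mu> = (mem s')(?u := ?p, Suc ?u := reg s' rToks)"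
      have \<mu>: "\<And>a. a < ?u \<Longrightarrow> \<mu> a = mem s' a" "\<mu> ?u = ?p" "\<mu> (Suc ?u) = reg s' rToks"
        by (auto simp: \<mu>_def)
      have "toks_at \<gamma> \<nu> \<mu> (?u + 2) (reg s' rToks) (rev (take j (nodes T)))"
        by (rule toks_at_mono[OF I(4)]) (use \<mu> in auto)
      moreover have "seg \<mu> ?p (?hd t)"
        by (rule seg_cong[OF sg(1)]) (use sg(2) I(2,3) \<mu>(1) in simp)
      ultimately have toks: "toks_at \<gamma> \<nu> \<mu> (?u + 2) ?u (rev (take (Suc j) (nodes T)))"
        using st(1) \<mu> I(2) fr(2) sg(2) t by (simp add: take_Suc_conv_app_nth)
      have frm: "\<forall>a\<ge>?u + 2. \<mu> a = 0" "\<forall>a<?fr. \<mu> a = mem s a"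
        using I(1,2,3) by (auto simp: \<mu>_def fresh_def)
      have ex: "\<exists>ps. concat (map nodes ps) = drop (Suc j) (nodes T) \<and> q = length ps \<and>
          seg (mem s) p' (concat (map ?code ps)) \<and> p' + length (concat (map ?code ps)) \<le> ?fr"
        if "q = length (children t @ ts)" "p' = ?p + length (?hd t)" for q p'
        using rest sg(3,4) that by (intro exI[of _ "children t @ ts"]) simp
      have need: "0 < reg s' rNeed" using ps(2) p by simp
      show ?thesis
      proof (cases "children t = []")
        case True
        then have "mem s ?p \<noteq> 0" using hd0 by simp
        then show ?thesis
          using need mp pu toks frm I(2) ex[of "length ps - 1" "?p + 2"] hd0 True ps(2)
          by (simp add: \<mu>_def[symmetric] fresh_def)
      next
        case False
        then have "mem s ?p = 0" using hd0 by simp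
        then show ?thesis
          using need mp pu toks frm I(2) ex[of "length ps + 1" "?p + 1"] hd0 False ps(2)
          by (simp add: \<mu>_def[symmetric] fresh_def)
      qed
    qed
    subgoal premises st for s'
    proof -
      from st(1) obtain ps where
        ps: "concat (map nodes ps) = drop (length (nodes T)) (nodes T)" "reg s' rNeed = length ps"
        by blast
      then have "ps = []" by (cases ps) (auto simp: nodes_nonempty)
      then show ?thesis using ps(2) by simp
    qed
    subgoal premises st for t s'
    proof -
      have r: "reg s' q = reg s q" if "q \<notin> wregs toks_com" for q
        using st(3)[of q] that by simp
      show ?thesis
        by (rule post) (use st(1,2) r in auto)
    qed
    done
qed

subsection \<open>The families of the nodes, bottom-up\<close>

abbreviation (input) "rStack \<equiv> (9::nat)"
abbreviation (input) "rKind \<equiv> (22::nat)"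
abbreviation (input) "rLeft \<equiv> (23::nat)"
abbreviation (input) "rRight \<equiv> (24::nat)"
abbreviation (input) "rVar \<equiv> (25::nat)"

text \<open>Copies the column of the literal code \<open>2 * x + c\<close> by following the row
  links. The offset is \<open>Suc c\<close> because a row starts with its link, and the doubling of
  \<open>rVar\<close> happens inside an address.\<close>

definition col_com :: "nat \<Rightarrow> com" where
  "col_com c =
     Assign rCell (Reg rFree) ;; incr rFree 1 ;; Assign rRow (Reg rRows) ;; Assign rK (Const 0) ;;
     While (Less (Reg rK) (Reg rM))
       (Store (Reg rFree) (Load (Add (Reg rRow) (Add (Const (Suc c)) (Add (Reg rVar) (Reg rVar))))) ;;
        incr rFree 1 ;; Assign rRow (Load (Reg rRow)) ;; incr rK 1)"

lemma wregs_col_com [simp]: "wregs (col_com c) = {rCell, rFree, rRow, rK}"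
  by (auto simp: col_com_def)

lemma wp_col_com:
  assumes fr: "fresh s" and m: "reg s rM = length Ls" and x: "reg s rVar = x" "x < n" and c: "c < 2"
    and rows: "rows_at (mem s) n (reg s rRows) Ls" "reg s rRows + length Ls * (2 * n + 1) \<le> reg s rFree"
    and post: "\<And>t s'. t \<le> 40 * length Ls + 20 \<Longrightarrow> fresh s' \<Longrightarrow> reg s' rCell = reg s rFree \<Longrightarrow>
      reg s' rFree = reg s rFree + length Ls + 1 \<Longrightarrow> (\<And>a. a \<le> reg s rFree \<Longrightarrow> mem s' a = mem s a) \<Longrightarrow>
      vec (mem s') (reg s rFree + 1) (length Ls) {j. 2 * x + c \<in> set (Ls ! j)} \<Longrightarrow>
      (\<And>r. r \<notin> wregs (col_com c) \<Longrightarrow> reg s' r = reg s r) \<Longrightarrow> Q t s'"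
  shows "wp (col_com c) Q s"
proof -
  let ?fr = "reg s rFree" and ?R = "reg s rRows" and ?w = "2 * n + 1"
  let ?V = "{j. 2 * x + c \<in> set (Ls ! j)}"
  let ?I = "\<lambda>j s'. reg s' rK = j \<and> reg s' rFree = ?fr + 1 + j \<and> reg s' rRow = ?R + j * ?w \<and>
     fresh s' \<and> (\<forall>a\<le>?fr. mem s' a = mem s a) \<and> vec (mem s') (?fr + 1) j ?V"
  show ?thesis
    unfolding col_com_def
    apply simp
    apply (rule wp_for[where N = "length Ls" and C = 40 and I = ?I])
    subgoal using fr by (simp add: fresh_def vec_def)
    subgoal premises st for j s'
    proof -
      have r: "reg s' rM = length Ls" "reg s' rVar = x"
        using st(3)[of rM] st(3)[of rVar] m x by simp_all
      have row: "row_at (mem s) n (?R + j * ?w) (set (Ls ! j))" using rows(1) st(1) by (simp add: rows_at_def)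
      have "Suc j * ?w \<le> length Ls * ?w" by (rule mult_le_mono1) (use st(1) in simp)
      then have lt: "?R + j * ?w + ?w \<le> ?fr" using rows(2) by simp
      have i: "2 * x + c < 2 * n" using x(2) c by simp
      have a: "mem s' (?R + j * ?w) = mem s (?R + j * ?w)"
        "mem s' (?R + j * ?w + 1 + (2 * x + c)) = mem s (?R + j * ?w + 1 + (2 * x + c))"
        using st(2) lt i by simp_all
      have b: "mem s' (?R + j * ?w) = ?R + Suc j * ?w"
         "mem s' (?R + j * ?w + 1 + (2 * x + c)) = of_bool (2 * x + c \<in> set (Ls ! j))"
        unfolding a using row i by (simp_all add: row_at_def vec_def)
      define q q' f v where "q = ?R + j * ?w" and "q' = ?R + Suc j * ?w" and "f = ?fr + 1 + j"
        and "v = (of_bool (2 * x + c \<in> set (Ls ! j)) :: nat)"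
      have e: "q + Suc (c + (x + x)) = ?R + j * ?w + 1 + (2 * x + c)" by (simp add: q_def)
      have ev: "mem s' (q + Suc (c + (x + x))) = v" "mem s' q = q'" "q \<noteq> f"
        "reg s' rRow = q" "reg s' rFree = f" "reg s' rK = j"
        unfolding e b v_def using b(1) st(2) lt by (simp_all add: q_def q'_def f_def)
      have \<mu>: "vec ((mem s')(f := v)) (?fr + 1) (Suc j) ?V" "\<And>a. f < a \<Longrightarrow> ((mem s')(f := v)) a = 0"
        "\<And>a. a \<le> ?fr \<Longrightarrow> ((mem s')(f := v)) a = mem s a"
        using st(2) by (auto simp: f_def v_def fresh_def vec_def less_Suc_eq)
      have fq: "Suc f = ?fr + 1 + Suc j" "q' = ?R + Suc j * ?w" by (simp_all add: f_def q'_def)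
      show ?thesis using st(1) r ev \<mu> fq by (simp add: fresh_def)
    qed
    subgoal premises st for s'
      using st(1) st(2)[of rM] m by simp
    subgoal premises st for t s'
    proof -
      have r: "reg s' q = reg s q" if "q \<notin> wregs (col_com c)" for q
        using st(3)[of q] that by simp
      have C: "reg s' rCell = ?fr" using st(3)[of rCell] by simp
      show ?thesis by (rule post) (use st(1,2) r C in auto)
    qed
    done
qed

text \<open>Field 4 of a record is the address of its mask. The target region is zero, so only ones
  are stored.\<close>

definition union_com :: com where
  "union_com = Assign rK (Const 0) ;;
     While (Less (Reg rK) (Reg rM))
       (Cond (Less (Const 0)
            (Add (Load (Add (Load (Add (Reg rLeft) (Const 4))) (Reg rK)))
                 (Load (Add (Load (Add (Reg rRight) (Const 4))) (Reg rK)))))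
          (Store (Add (Reg rMask) (Reg rK)) (Const 1)) Skip ;;
        incr rK 1)"

lemma wregs_union_com [simp]: "wregs union_com = {rK}"
  by (auto simp: union_com_def)

lemma wp_union_com:
  assumes m: "reg s rM = m" and lo: "reg s rMask = lo" "reg s rLeft + 4 < lo" "reg s rRight + 4 < lo"
    and X: "vec (mem s) (mem s (reg s rLeft + 4)) m X" "mem s (reg s rLeft + 4) + m \<le> lo"
    and Y: "vec (mem s) (mem s (reg s rRight + 4)) m Y" "mem s (reg s rRight + 4) + m \<le> lo"
    and z: "\<And>a. lo \<le> a \<Longrightarrow> mem s a = 0"
    and post: "\<And>t s'. t \<le> 40 * m + 20 \<Longrightarrow> (\<And>a. a < lo \<or> lo + m \<le> a \<Longrightarrow> mem s' a = mem s a) \<Longrightarrow>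
      vec (mem s') lo m (X \<union> Y) \<Longrightarrow> (\<And>r. r \<notin> {rK} \<Longrightarrow> reg s' r = reg s r) \<Longrightarrow> Q t s'"
  shows "wp union_com Q s"
proof -
  let ?I = "\<lambda>j s'. reg s' rK = j \<and> (\<forall>a. a < lo \<or> lo + j \<le> a \<longrightarrow> mem s' a = mem s a) \<and>
     vec (mem s') lo j (X \<union> Y)"
  show ?thesis
    unfolding union_com_def
    apply simp
    apply (rule wp_for[where N = m and C = 40 and I = ?I])
    subgoal by (simp add: vec_def)
    subgoal premises st for j s'
    proof -
      have r: "reg s' r = reg s r" if "r \<noteq> rK" for r
        using st(3)[of r] that by simp
      have p: "mem s' (reg s rLeft + 4) = mem s (reg s rLeft + 4)" "mem s' (reg s rRight + 4) = mem s (reg s rRight + 4)"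
        using st(2) lo by simp_all
      have b: "mem s' (mem s (reg s rLeft + 4) + j) = of_bool (j \<in> X)"
        "mem s' (mem s (reg s rRight + 4) + j) = of_bool (j \<in> Y)"
        using st(1,2) X Y by (simp_all add: vec_def)
      have z': "mem s' (lo + j) = 0" using st(2) z by simp
      show ?thesis
        using st(1,2) b z' by (auto simp: r m lo p vec_def less_Suc_eq)
    qed
    subgoal premises st for s'
      using st(1) st(2)[of rM] m by simp
    subgoal premises st for t s'
    proof -
      have r: "reg s' q = reg s q" if "q \<notin> {rK}" for q
        using st(3)[of q] that by simp
      show ?thesis by (rule post) (use st(1,2) r in auto)
    qed
    done
qed

abbreviation (input) "field p i \<equiv> Load (Add (Reg p) (Const i))"

text \<open>Preorder is processed backwards: the left child is finished after the right one and lies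
  on top of it on the stack. Field 5 is the stack link and field 3 the family.\<close>

definition branch_com :: com where
  "branch_com =
     Assign rLeft (Reg rStack) ;; Assign rRight (field rLeft 5) ;; Assign rStack (field rRight 5) ;;
     Assign rKind (Const 0) ;; Assign rA (field rLeft 3) ;; Assign rB (field rRight 3) ;; union_com"

definition clause_com :: com where
  "clause_com =
     Store (Add (Reg rMask) (field rPos 1)) (Const 1) ;; Assign rKind (Const 1) ;;
     Assign rA (Reg rZero) ;; Assign rB (Reg rZero)"

text \<open>The cell of the negative column is linked to that of the positive one. The mask stays
  zero, as no clause lies below a variable leaf.\<close>

definition var_com :: com where
  "var_com =
     Assign rVar (field rPos 1) ;; col_com 0 ;; Assign rA (Reg rCell) ;; col_com 1 ;;
     Store (Reg rCell) (Reg rA) ;; Assign rA (Reg rCell) ;; Assign rB (Reg rZero) ;;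
     Assign rKind (Const 1)"

definition prep_com :: com where
  "prep_com = Cond (Eq (Load (Reg rPos)) (Const 0)) branch_com
     (Cond (Eq (Load (Reg rPos)) (Const 1)) clause_com var_com)"

lemma wregs_prep_com [simp]:
  "wregs prep_com = {rLeft, rRight, rStack, rKind, rA, rB, rVar, rCell, rFree, rRow, rK}"
  by (auto simp: prep_com_def branch_com_def clause_com_def var_com_def)

locale encoded_cnf = decomposed_cnf +
  fixes Ls :: "nat list list"
  assumes length_Ls: "length Ls = m"
    and set_Ls: "\<And>c. c \<in> cla F \<Longrightarrow> set (Ls ! \<gamma> c) = lit_code \<nu> ` lits F c"
begin

text \<open>Repetitions are excluded so that the length of the list is the cardinality of the
  family, which the width bounds by \<open>k\<close>.\<close>

definition family_at :: "(nat \<Rightarrow> nat) \<Rightarrow> nat \<Rightarrow> nat \<Rightarrow> nat set set \<Rightarrow> bool" where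
  "family_at \<mu> u p \<S> \<longleftrightarrow> (\<exists>Xs. distinct Xs \<and> set Xs = \<S> \<and> flist \<mu> {..<u} m p Xs)"

lemma family_at_mono:
  "family_at \<mu> u p \<S> \<Longrightarrow> u \<le> u' \<Longrightarrow> (\<And>a. a < u \<Longrightarrow> \<mu>' a = \<mu> a) \<Longrightarrow> family_at \<mu>' u' p \<S>"
  unfolding family_at_def using flist_mono[where U = "{..<u}" and U' = "{..<u'}"]
  by (metis lessThan_iff lessThan_subset_iff)

text \<open>The record of a node consists of its kind (0 for a branch), its two children, the family
  \<^term>\<open>fam t\<close>, the characteristic vector of \<^term>\<open>below t\<close>, and a link for stacks.\<close>

definition data_at :: "(nat \<Rightarrow> nat) \<Rightarrow> nat \<Rightarrow> nat \<Rightarrow> ('a + 'b) btree \<Rightarrow> bool" where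
  "data_at \<mu> u p t \<longleftrightarrow> p \<noteq> 0 \<and> p + 5 < u \<and> family_at \<mu> u (\<mu> (p + 3)) (fam t) \<and>
     vec \<mu> (\<mu> (p + 4)) m (below t) \<and> \<mu> (p + 4) + m \<le> u"

lemma data_at_mono:
  assumes "data_at \<mu> u p t" "u \<le> u'" "\<And>a. a < u \<Longrightarrow> \<mu>' a = \<mu> a"
  shows "data_at \<mu>' u' p t"
proof -
  note d = assms(1)[unfolded data_at_def]
  have e: "\<mu>' (p + 3) = \<mu> (p + 3)" "\<mu>' (p + 4) = \<mu> (p + 4)" using d by (simp_all add: assms(3))
  have "family_at \<mu>' u' (\<mu> (p + 3)) (fam t)" using d family_at_mono assms(2,3) by blast
  moreover have "vec \<mu>' (\<mu> (p + 4)) m (below t)"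
    by (rule vec_cong[where \<mu> = \<mu>]) (use d assms(3) in auto)
  ultimately show ?thesis using d assms(2) unfolding data_at_def e by auto
qed

fun node_at :: "(nat \<Rightarrow> nat) \<Rightarrow> nat \<Rightarrow> nat \<Rightarrow> ('a + 'b) btree \<Rightarrow> bool" where
  "node_at \<mu> u p (Leaf a) \<longleftrightarrow> data_at \<mu> u p (Leaf a) \<and> \<mu> p = 1"
| "node_at \<mu> u p (Branch l r) \<longleftrightarrow> data_at \<mu> u p (Branch l r) \<and> \<mu> p = 0 \<and>
     node_at \<mu> u (\<mu> (p + 1)) l \<and> node_at \<mu> u (\<mu> (p + 2)) r"

lemma node_at_data: "node_at \<mu> u p t \<Longrightarrow> data_at \<mu> u p t"
  by (cases t) auto

lemma node_at_mono:
  assumes "node_at \<mu> u p t" "u \<le> u'" "\<And>a. a < u \<Longrightarrow> \<mu>' a = \<mu> a"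
  shows "node_at \<mu>' u' p t"
  using assms(1)
proof (induction t arbitrary: p)
  case (Leaf a)
  then have "p + 5 < u" by (simp add: data_at_def)
  then have "\<mu>' p = \<mu> p" by (simp add: assms(3))
  then show ?case using Leaf data_at_mono[OF _ assms(2,3)] by auto
next
  case (Branch l r)
  then have "p + 5 < u" by (simp add: data_at_def)
  then have "\<mu>' p = \<mu> p" "\<mu>' (p + 1) = \<mu> (p + 1)" "\<mu>' (p + 2) = \<mu> (p + 2)" by (simp_all add: assms(3))
  then show ?case using Branch data_at_mono[OF _ assms(2,3)] by auto
qed

fun stack_at :: "(nat \<Rightarrow> nat) \<Rightarrow> nat \<Rightarrow> nat \<Rightarrow> ('a + 'b) btree list \<Rightarrow> bool" where
  "stack_at \<mu> u p [] \<longleftrightarrow> p = 0"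
| "stack_at \<mu> u p (t # ts) \<longleftrightarrow> node_at \<mu> u p t \<and> stack_at \<mu> u (\<mu> (p + 5)) ts"

lemma stack_at_mono:
  assumes "stack_at \<mu> u p ts" "u \<le> u'" "\<And>a. a < u \<Longrightarrow> \<mu>' a = \<mu> a"
  shows "stack_at \<mu>' u' p ts"
  using assms(1)
proof (induction ts arbitrary: p)
  case (Cons t ts)
  then have n: "node_at \<mu> u p t" by simp
  then have "p + 5 < u" using node_at_data by (auto simp: data_at_def)
  then have "\<mu>' (p + 5) = \<mu> (p + 5)" by (simp add: assms(3))
  then show ?case using Cons node_at_mono[OF n assms(2,3)] by simp
qed simp

text \<open>Parity separates the codes of positive and negative literals, injectivity of \<nu>
  identifies the variable, and each row below \<open>m\<close> belongs to a clause.\<close>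

lemma occurs_column:
  assumes x: "x \<in> vars F"
  shows "{j. j < m \<and> 2 * \<nu> x + 0 \<in> set (Ls ! j)} = occurs (Pos x)"
    "{j. j < m \<and> 2 * \<nu> x + 1 \<in> set (Ls ! j)} = occurs (Neg x)"
proof -
  have V: "y \<in> vars F" if "c \<in> cla F" "l \<in> lits F c" "lit_var l = y" for c l y
    using that by (auto simp: vars_def)
  have code: "2 * \<nu> x + 0 \<in> lit_code \<nu> ` lits F c \<longleftrightarrow> Pos x \<in> lits F c"
    "2 * \<nu> x + 1 \<in> lit_code \<nu> ` lits F c \<longleftrightarrow> Neg x \<in> lits F c" if c: "c \<in> cla F" for c
  proof -
    have P: "l = Pos x" if "lit_code \<nu> l = 2 * \<nu> x + 0" "l \<in> lits F c" for l
    proof (cases l)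
      case (Pos y)
      then have "\<nu> y = \<nu> x" "y \<in> vars F" using that V[OF c that(2)] by auto
      then show ?thesis using Pos \<nu>_inj x by (auto simp: inj_on_def)
    next
      case (Neg y)
      then have "2 * \<nu> y + 1 = 2 * \<nu> x" using that by simp
      then have False by presburger
      then show ?thesis ..
    qed
    have N: "l = Neg x" if "lit_code \<nu> l = 2 * \<nu> x + 1" "l \<in> lits F c" for l
    proof (cases l)
      case (Neg y)
      then have "\<nu> y = \<nu> x" "y \<in> vars F" using that V[OF c that(2)] by auto
      then show ?thesis using Neg \<nu>_inj x by (auto simp: inj_on_def)
    next
      case (Pos y)
      then have "2 * \<nu> y = 2 * \<nu> x + 1" using that by simp
      then have False by presburger
      then show ?thesis ..
    qed
    show "2 * \<nu> x + 0 \<in> lit_code \<nu> ` lits F c \<longleftrightarrow> Pos x \<in> lits F c"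
    proof
      assume "2 * \<nu> x + 0 \<in> lit_code \<nu> ` lits F c"
      then obtain l where "2 * \<nu> x + 0 = lit_code \<nu> l" "l \<in> lits F c" by (rule imageE)
      then show "Pos x \<in> lits F c" using P[of l] by simp
    qed (rule image_eqI[of _ _ "Pos x"], simp)
    show "2 * \<nu> x + 1 \<in> lit_code \<nu> ` lits F c \<longleftrightarrow> Neg x \<in> lits F c"
    proof
      assume "2 * \<nu> x + 1 \<in> lit_code \<nu> ` lits F c"
      then obtain l where "2 * \<nu> x + 1 = lit_code \<nu> l" "l \<in> lits F c" by (rule imageE)
      then show "Neg x \<in> lits F c" using N[of l] by simp
    qed (rule image_eqI[of _ _ "Neg x"], simp)
  qed
  have "{j. j < m \<and> i \<in> set (Ls ! j)} = \<gamma> ` {c \<in> cla F. i \<in> lit_code \<nu> ` lits F c}" for i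
  proof -
    have "{j. j < m \<and> i \<in> set (Ls ! j)} = {j \<in> \<gamma> ` cla F. i \<in> set (Ls ! j)}"
      by (simp add: \<gamma>_image)
    also have "\<dots> = \<gamma> ` {c \<in> cla F. i \<in> set (Ls ! \<gamma> c)}" by blast
    also have "\<dots> = \<gamma> ` {c \<in> cla F. i \<in> lit_code \<nu> ` lits F c}"
      using set_Ls by (intro arg_cong[of _ _ "(`) \<gamma>"] Collect_cong) blast
    finally show ?thesis .
  qed
  note * = this
  show "{j. j < m \<and> 2 * \<nu> x + 0 \<in> set (Ls ! j)} = occurs (Pos x)"
    "{j. j < m \<and> 2 * \<nu> x + 1 \<in> set (Ls ! j)} = occurs (Neg x)"
    unfolding * occurs_def using code
    by (intro arg_cong[of _ _ "(`) \<gamma>"] Collect_cong; blast)+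
qed

lemma vec_below: "vec \<mu> a m {j. P j} \<Longrightarrow> {j. j < m \<and> P j} = X \<Longrightarrow> vec \<mu> a m X"
  by (auto simp: vec_def)

text \<open>What all later passes rely on. By \<open>ctx_mono\<close> it survives any program that
  restores freshness and leaves alone three registers and the memory below the allocation
  pointer.\<close>

definition ctx :: "state \<Rightarrow> bool" where
  "ctx s \<longleftrightarrow> fresh s \<and> reg s rM = m \<and> 0 < reg s rFree \<and>
     rows_at (mem s) n (reg s rRows) Ls \<and> reg s rRows + m * (2 * n + 1) \<le> reg s rFree \<and>
     flist (mem s) {..<reg s rFree} m (reg s rZero) [{}]"

lemma rows_at_mono:
  assumes "rows_at \<mu> n q Ls" "q + m * (2 * n + 1) \<le> u" "\<And>a. a < u \<Longrightarrow> \<mu>' a = \<mu> a"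
  shows "rows_at \<mu>' n q Ls"
  unfolding rows_at_def
proof (intro allI impI)
  fix j assume j: "j < length Ls"
  have "Suc j * (2 * n + 1) \<le> m * (2 * n + 1)" by (rule mult_le_mono1) (use j length_Ls in simp)
  then have "q + j * (2 * n + 1) + 2 * n < u" using assms(2) by simp
  then have "\<mu>' a = \<mu> a" if "a \<le> q + j * (2 * n + 1) + 2 * n" for a
    using that by (intro assms(3)) simp
  moreover have "row_at \<mu> n (q + j * (2 * n + 1)) (set (Ls ! j))"
    using assms(1) j by (simp add: rows_at_def)
  ultimately show "row_at \<mu>' n (q + j * (2 * n + 1)) (set (Ls ! j))"
    by (rule row_at_cong[rotated]) simp
qed

lemma ctx_mono:
  assumes "ctx s" "fresh s'" "reg s rFree \<le> reg s' rFree" "\<And>a. a < reg s rFree \<Longrightarrow> mem s' a = mem s a"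
    and "\<And>r. r \<in> {rM, rRows, rZero} \<Longrightarrow> reg s' r = reg s r"
  shows "ctx s'"
proof -
  note c = assms(1)[unfolded ctx_def]
  have "rows_at (mem s') n (reg s rRows) Ls"
    by (rule rows_at_mono[where \<mu> = "mem s" and u = "reg s rFree"]) (use c assms(4) in auto)
  moreover have "flist (mem s') {..<reg s' rFree} m (reg s rZero) [{}]"
    by (rule flist_mono[where \<mu> = "mem s" and U = "{..<reg s rFree}"]) (use c assms(3,4) in auto)
  ultimately show ?thesis using c assms(2,3,5) by (auto simp: ctx_def)
qed

text \<open>\<open>prepared \<mu> lo t ts s\<close>: all is set up to compute the family of \<open>t\<close> as a product. The memory
  \<open>\<mu>\<close> below \<open>lo\<close> is what was there before, and the vector of clauses below \<open>t\<close> stands at \<open>lo\<close>.\<close>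

definition prepared :: "(nat \<Rightarrow> nat) \<Rightarrow> nat \<Rightarrow> ('a + 'b) btree \<Rightarrow> ('a + 'b) btree list \<Rightarrow> state \<Rightarrow> bool" where
  "prepared \<mu> lo t ts s \<longleftrightarrow> fresh s \<and> lo + m \<le> reg s rFree \<and> (\<forall>a<lo. mem s a = \<mu> a) \<and>
     vec (mem s) lo m (below t) \<and> stack_at \<mu> lo (reg s rStack) ts \<and>
     (case t of Leaf a \<Rightarrow> reg s rKind = 1
      | Branch l r \<Rightarrow> reg s rKind = 0 \<and> node_at \<mu> lo (reg s rLeft) l \<and> node_at \<mu> lo (reg s rRight) r) \<and>
     (\<exists>As Bs. flist (mem s) {..<reg s rFree} m (reg s rA) As \<and> flist (mem s) {..<reg s rFree} m (reg s rB) Bs \<and>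
        As \<noteq> [] \<and> Bs \<noteq> [] \<and> length As * length Bs \<le> 2 * k * k \<and>
        products m (below t) False (set As) (set Bs) = fam t)"

lemma preparedI:
  assumes "fresh s" "lo + m \<le> reg s rFree" "\<And>a. a < lo \<Longrightarrow> mem s a = \<mu> a"
    "vec (mem s) lo m (below t)" "stack_at \<mu> lo (reg s rStack) ts"
    "case t of Leaf a \<Rightarrow> reg s rKind = 1
      | Branch l r \<Rightarrow> reg s rKind = 0 \<and> node_at \<mu> lo (reg s rLeft) l \<and> node_at \<mu> lo (reg s rRight) r"
    "flist (mem s) {..<reg s rFree} m (reg s rA) As" "flist (mem s) {..<reg s rFree} m (reg s rB) Bs"
    "As \<noteq> []" "Bs \<noteq> []" "length As * length Bs \<le> 2 * k * k"
    "products m (below t) False (set As) (set Bs) = fam t"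
  shows "prepared \<mu> lo t ts s"
  using assms unfolding prepared_def by (intro conjI exI[of _ As] exI[of _ Bs] allI impI) assumption+

text \<open>The product of a variable leaf has two pairs although \<open>k\<close> may be 1; this is
  why \<open>prepared\<close> allows \<open>2 * k * k\<close> pairs rather than
  \<open>k * k\<close>.\<close>

lemma k_square: "1 \<le> 2 * k * k" "2 \<le> 2 * k * k"
  using k_pos by (cases k; simp)+

lemma leaf_node:
  "Leaf (Inl c) \<in> set (nodes T) \<Longrightarrow> c \<in> cla F" "Leaf (Inr x) \<in> set (nodes T) \<Longrightarrow> x \<in> vars F"
  using node_below[of "Leaf (Inl c)"] node_below[of "Leaf (Inr x)"] by (simp_all add: below_Leaf)

lemma wp_branch_com:
  assumes c: "fresh s" "reg s rM = m" and mask: "reg s rMask = lo" "reg s rFree = lo + m"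
    and z: "\<And>a. lo \<le> a \<Longrightarrow> mem s a = 0"
    and st: "stack_at (mem s) lo (reg s rStack) (l # r # ts)" and t: "Branch l r \<in> set (nodes T)"
    and post: "\<And>i s'. i \<le> 40 * m + 80 \<Longrightarrow> prepared (mem s) lo (Branch l r) ts s' \<Longrightarrow> Q i s'"
  shows "wp branch_com Q s"
proof -
  let ?l = "reg s rStack" let ?r = "mem s (?l + 5)"
  have nl: "node_at (mem s) lo ?l l" and nr: "node_at (mem s) lo ?r r"
    and ts: "stack_at (mem s) lo (mem s (?r + 5)) ts" using st by auto
  note dl = node_at_data[OF nl, unfolded data_at_def] and dr = node_at_data[OF nr, unfolded data_at_def]
  obtain As where As: "distinct As" "set As = fam l" "flist (mem s) {..<lo} m (mem s (?l + 3)) As"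
    using dl unfolding family_at_def by blast
  obtain Bs where Bs: "distinct Bs" "set Bs = fam r" "flist (mem s) {..<lo} m (mem s (?r + 3)) Bs"
    using dr unfolding family_at_def by blast
  note ch = branch_disjoint(3,4)[OF t]
  note fl = fam_facts[OF ch(1)] and fr = fam_facts[OF ch(2)]
  have len: "length As \<le> k" "length Bs \<le> k" "As \<noteq> []" "Bs \<noteq> []"
    using fl(1,7) fr(1,7) As Bs distinct_card[OF As(1)] distinct_card[OF Bs(1)] by auto
  then have len2: "length As * length Bs \<le> 2 * k * k"
    using mult_le_mono[OF len(1,2)] by simp
  have bel: "below (Branch l r) = below l \<union> below r" by (simp add: below_def below_Branch image_Un)
  show ?thesis
  proof -
    let ?s1 = "s\<lparr>reg := (reg s)(rLeft := ?l, rRight := ?r, rStack := mem s (?r + 5), rKind := 0,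
      rA := mem s (?l + 3), rB := mem s (?r + 3))\<rparr>"
    \<comment> \<open>Asking for the postcondition at all times up to \<open>i + 60\<close> leaves
      slack, so that the exact cost of the surrounding assignments need not be computed. The same
      device is used in the later proofs.\<close>
    have "wp union_com (\<lambda>i s'. \<forall>j\<le>i + 60. Q j s') ?s1"
    proof (rule wp_union_com[where m = m and lo = lo and X = "below l" and Y = "below r"])
      fix i and s' :: state
      assume i: "i \<le> 40 * m + 20" and m': "\<And>a. a < lo \<or> lo + m \<le> a \<Longrightarrow> mem s' a = mem ?s1 a"
        and v: "vec (mem s') lo m (below l \<union> below r)"
        and r': "\<And>r. r \<notin> {rK} \<Longrightarrow> reg s' r = reg ?s1 r"
      have r: "reg s' rStack = mem s (?r + 5)" "reg s' rLeft = ?l" "reg s' rRight = ?r"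
        "reg s' rKind = 0" "reg s' rA = mem s (?l + 3)" "reg s' rB = mem s (?r + 3)" "reg s' rFree = lo + m"
        using r' mask by simp_all
      have "prepared (mem s) lo (Branch l r) ts s'"
      proof (rule preparedI)
        show "flist (mem s') {..<reg s' rFree} m (reg s' rA) As"
          unfolding r by (rule flist_mono[OF As(3)]) (use m' in auto)
        show "flist (mem s') {..<reg s' rFree} m (reg s' rB) Bs"
          unfolding r by (rule flist_mono[OF Bs(3)]) (use m' in auto)
        show "products m (below (Branch l r)) False (set As) (set Bs) = fam (Branch l r)"
          unfolding As(2) Bs(2) by (rule fam_Branch[OF t])
        show "fresh s'" using m' r z by (simp add: fresh_def)
        show "vec (mem s') lo m (below (Branch l r))" using v unfolding bel .
      qed (use m' r ts nl nr len len2 in simp_all)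
      then show "\<forall>j\<le>i + 60. Q j s'" using i by (auto intro!: post)
    qed (use c(2) mask(1) dl dr z in simp_all)
    then show ?thesis
      unfolding branch_com_def by (simp, elim wp_mono, simp)
  qed
qed

lemma wp_clause_com:
  assumes c: "ctx s" and mask: "reg s rMask = lo" "reg s rFree = lo + m"
    and Z: "flist (mem s) {..<lo} m (reg s rZero) [{}]"
    and z: "\<And>a. lo \<le> a \<Longrightarrow> mem s a = 0" and st: "stack_at (mem s) lo (reg s rStack) ts"
    and code: "mem s (reg s rPos + 1) = \<gamma> x" "reg s rPos + 1 < lo" and t: "Leaf (Inl x) \<in> set (nodes T)"
    and post: "\<And>i s'. i \<le> 20 \<Longrightarrow> prepared (mem s) lo (Leaf (Inl x)) ts s' \<Longrightarrow> Q i s'"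
  shows "wp clause_com Q s"
proof -
  have x: "\<gamma> x < m" using leaf_node(1)[OF t] \<gamma>_image by auto
  let ?s = "s\<lparr>mem := (mem s)(lo + \<gamma> x := 1), reg := (reg s)(rKind := 1, rA := reg s rZero, rB := reg s rZero)\<rparr>"
  have b: "below (Leaf (Inl x)) = {\<gamma> x}" by (simp add: below_def below_Leaf)
  have Z': "flist (mem ?s) {..<reg ?s rFree} m (reg s rZero) [{}]"
    by (rule flist_mono[OF Z]) (use mask in auto)
  have "prepared (mem s) lo (Leaf (Inl x)) ts ?s"
    by (rule preparedI[where As = "[{}]" and Bs = "[{}]"])
      (use c mask z st x Z' k_square fam_clause in \<open>auto simp: fresh_def b vec_def simp del: flist.simps\<close>)
  moreover have ne: "lo + \<gamma> x \<noteq> reg s rPos + 1" using code(2) by simp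
  ultimately show ?thesis
    unfolding clause_com_def by (simp add: mask code[unfolded add.commute[of _ 1] plus_1_eq_Suc] post)
qed

lemma wp_var_com:
  assumes c: "ctx s" and mask: "reg s rMask = lo" "reg s rFree = lo + m"
    and Z: "flist (mem s) {..<lo} m (reg s rZero) [{}]"
    and z: "\<And>a. lo \<le> a \<Longrightarrow> mem s a = 0" and st: "stack_at (mem s) lo (reg s rStack) ts"
    and code: "mem s (reg s rPos + 1) = \<nu> x" "reg s rPos + 1 < lo" and t: "Leaf (Inr x) \<in> set (nodes T)"
    and post: "\<And>i s'. i \<le> 80 * m + 80 \<Longrightarrow> prepared (mem s) lo (Leaf (Inr x)) ts s' \<Longrightarrow> Q i s'"
  shows "wp var_com Q s"
proof -
  have xv: "x \<in> vars F" using leaf_node(2)[OF t] .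
  have x: "\<nu> x < n" using xv \<nu>_image by auto
  note cd = c[unfolded ctx_def]
  have b: "below (Leaf (Inr x)) = {}" by (simp add: below_def below_Leaf)
  let ?fr = "reg s rFree"
  let ?s0 = "s\<lparr>reg := (reg s)(rVar := \<nu> x)\<rparr>"
  have "wp (col_com 0) (\<lambda>i. wp (Assign rA (Reg rCell) ;; col_com 1 ;;
     Store (Reg rCell) (Reg rA) ;; Assign rA (Reg rCell) ;; Assign rB (Reg rZero) ;;
     Assign rKind (Const 1)) (\<lambda>j. Q (5 + (i + j)))) ?s0"
  proof (rule wp_col_com[where Ls = Ls and n = n and x = "\<nu> x"])
    show "fresh ?s0" "reg ?s0 rM = length Ls" "reg ?s0 rVar = \<nu> x" "\<nu> x < n" "(0::nat) < 2"
      "rows_at (mem ?s0) n (reg ?s0 rRows) Ls" "reg ?s0 rRows + length Ls * (2 * n + 1) \<le> reg ?s0 rFree"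
      using cd x length_Ls by (simp_all add: fresh_def)
    fix i1 s1
    assume i1: "i1 \<le> 40 * length Ls + 20" and s1: "fresh s1" "reg s1 rCell = reg ?s0 rFree"
      "reg s1 rFree = reg ?s0 rFree + length Ls + 1"
      and m1: "\<And>a. a \<le> reg ?s0 rFree \<Longrightarrow> mem s1 a = mem ?s0 a"
      and v1: "vec (mem s1) (reg ?s0 rFree + 1) (length Ls) {j. 2 * \<nu> x + 0 \<in> set (Ls ! j)}"
      and r1: "\<And>r. r \<notin> wregs (col_com 0) \<Longrightarrow> reg s1 r = reg ?s0 r"
    have V1: "vec (mem s1) (?fr + 1) m (occurs (Pos x))"
      by (rule vec_below[OF _ occurs_column(1)[OF xv]]) (use v1 length_Ls in simp)
    have F1: "reg s1 rFree = ?fr + m + 1" "reg s1 rCell = ?fr" using s1 length_Ls by simp_all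
    have R1: "reg s1 r = reg s r" if "r \<notin> {rVar, rCell, rFree, rRow, rK}" for r
      using r1[of r] that by simp
    let ?s1 = "s1\<lparr>reg := (reg s1)(rA := ?fr)\<rparr>"
    have "wp (col_com 1) (\<lambda>i. wp (Store (Reg rCell) (Reg rA) ;; Assign rA (Reg rCell) ;;
       Assign rB (Reg rZero) ;; Assign rKind (Const 1)) (\<lambda>j. Q (5 + (i1 + (2 + (i + j)))))) ?s1"
    proof (rule wp_col_com[where Ls = Ls and n = n and x = "\<nu> x"])
      have "rows_at (mem s1) n (reg s rRows) Ls"
        by (rule rows_at_mono[where \<mu> = "mem s" and u = ?fr]) (use cd m1 in auto)
      then show "fresh ?s1" "reg ?s1 rM = length Ls" "reg ?s1 rVar = \<nu> x" "\<nu> x < n" "(1::nat) < 2"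
        "rows_at (mem ?s1) n (reg ?s1 rRows) Ls" "reg ?s1 rRows + length Ls * (2 * n + 1) \<le> reg ?s1 rFree"
        using cd x length_Ls s1(1) R1[of rM] R1[of rRows] r1[of rVar] F1 by (simp_all add: fresh_def)
      fix i2 s2
      assume i2: "i2 \<le> 40 * length Ls + 20" and s2: "fresh s2" "reg s2 rCell = reg ?s1 rFree"
        "reg s2 rFree = reg ?s1 rFree + length Ls + 1"
        and m2: "\<And>a. a \<le> reg ?s1 rFree \<Longrightarrow> mem s2 a = mem ?s1 a"
        and v2: "vec (mem s2) (reg ?s1 rFree + 1) (length Ls) {j. 2 * \<nu> x + 1 \<in> set (Ls ! j)}"
        and r2: "\<And>r. r \<notin> wregs (col_com 1) \<Longrightarrow> reg s2 r = reg ?s1 r"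
      let ?g = "?fr + m + 1"
      have V2: "vec (mem s2) (?g + 1) m (occurs (Neg x))"
        by (rule vec_below[OF _ occurs_column(2)[OF xv]]) (use v2 length_Ls F1 in simp)
      have F2: "reg s2 rFree = ?g + m + 1" "reg s2 rCell = ?g" "reg s2 rA = ?fr"
        using s2 length_Ls F1 r2[of rA] by simp_all
      have R2: "reg s2 r = reg s r" if "r \<notin> {rVar, rCell, rFree, rRow, rK, rA}" for r
        using r2[of r] R1[of r] that by simp
      let ?\<mu> = "(mem s2)(?g := ?fr)"
      let ?s3 = "s2\<lparr>mem := ?\<mu>, reg := (reg s2)(rA := ?g, rB := reg s rZero, rKind := 1)\<rparr>"
      have \<mu>: "?\<mu> a = mem s a" if "a \<le> ?fr" for a
        using that m1 m2 F1 by simp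
      have \<mu>1: "?\<mu> (?fr + 1 + j) = mem s1 (?fr + 1 + j)" if "j < m" for j
        using that m2[of "?fr + 1 + j"] F1 by simp
      have W1: "vec ?\<mu> (?fr + 1) m (occurs (Pos x))"
        by (rule vec_cong[OF V1]) (rule \<mu>1)
      have W2: "vec ?\<mu> (?g + 1) m (occurs (Neg x))"
        by (rule vec_cong[OF V2]) simp
      \<comment> \<open>The link of the positive column was never written; it is still 0 and ends
        the list.\<close>
      have z0: "?\<mu> ?fr = 0" using \<mu>[of ?fr] z mask(2) by simp
      have As: "flist ?\<mu> {..<?g + m + 1} m ?g [occurs (Neg x), occurs (Pos x)]"
        using W1 W2 z0 cd by (auto simp: subset_eq)
      have Bs: "flist ?\<mu> {..<?g + m + 1} m (reg s rZero) [{}]"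
        by (rule flist_mono[OF Z]) (use \<mu> mask in auto)
      have "prepared (mem s) lo (Leaf (Inr x)) ts ?s3"
      proof (rule preparedI[where As = "[occurs (Neg x), occurs (Pos x)]" and Bs = "[{}]"])
        show "flist (mem ?s3) {..<reg ?s3 rFree} m (reg ?s3 rA) [occurs (Neg x), occurs (Pos x)]"
          "flist (mem ?s3) {..<reg ?s3 rFree} m (reg ?s3 rB) [{}]"
          using As Bs F2 by (simp_all del: flist.simps)
        show "vec (mem ?s3) lo m (below (Leaf (Inr x)))"
          unfolding b vec_def using \<mu> mask z by simp
        show "fresh ?s3" using s2(1) F2 by (simp add: fresh_def)
        show "products m (below (Leaf (Inr x))) False (set [occurs (Neg x), occurs (Pos x)]) (set [{}]) =
          fam (Leaf (Inr x))" using fam_var by simp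
        show "length [occurs (Neg x), occurs (Pos x)] * length [{}] \<le> 2 * k * k"
          by (rule ord_eq_le_trans[OF _ k_square(2)]) simp
        show "stack_at (mem s) lo (reg ?s3 rStack) ts" using st R2[of rStack] by simp
        show "\<And>a. a < lo \<Longrightarrow> mem ?s3 a = mem s a" using \<mu> mask by simp
      qed (use F2 mask in simp_all)
      then show "wp (Store (Reg rCell) (Reg rA) ;; Assign rA (Reg rCell) ;;
       Assign rB (Reg rZero) ;; Assign rKind (Const 1)) (\<lambda>j. Q (5 + (i1 + (2 + (i2 + j))))) s2"
        using i1 i2 length_Ls F2 R2[of rZero] by (auto intro!: post)
    qed
    then show "wp (Assign rA (Reg rCell) ;; col_com 1 ;;
     Store (Reg rCell) (Reg rA) ;; Assign rA (Reg rCell) ;; Assign rB (Reg rZero) ;;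
     Assign rKind (Const 1)) (\<lambda>j. Q (5 + (i1 + j))) s1"
      using F1 by (simp, elim wp_mono, simp add: eval_nat_numeral)
  qed
  then show ?thesis
    unfolding var_com_def using code by (simp, elim wp_mono, simp add: eval_nat_numeral)
qed

end

section \<open>Assembling the bottom-up pass\<close>

definition finish_com :: com where
  "finish_com =
     Store (Reg rFree) (Reg rKind) ;; Store (Add (Reg rFree) (Const 1)) (Reg rLeft) ;;
     Store (Add (Reg rFree) (Const 2)) (Reg rRight) ;; Store (Add (Reg rFree) (Const 3)) (Reg rRes) ;;
     Store (Add (Reg rFree) (Const 4)) (Reg rMask) ;; Store (Add (Reg rFree) (Const 5)) (Reg rStack) ;;
     Assign rStack (Reg rFree) ;; incr rFree 6"

text \<open>The mask is reserved before \<open>prep_com\<close> fills it, and later allocations lie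
  above it, so its address can go into the record. Polarity 0 keeps the clauses that are not below
  the node.\<close>

definition build_body :: com where
  "build_body =
     Assign rPos (Load (Reg rToks)) ;; Assign rToks (field rToks 1) ;; Assign rMask (Reg rFree) ;;
     skip_com rM 1 ;; prep_com ;; Assign rPol (Const 0) ;; product_com ;; finish_com"

definition build_com :: com where
  "build_com = Assign rStack (Const 0) ;; While (Neq (Reg rToks) (Const 0)) build_body"

text \<open>The preorder of a tree begins with the tree itself, so the preorder of a forest can be
  parsed in only one way.\<close>

lemma concat_nodes_prefix:
  assumes "concat (map nodes us) = concat (map nodes ts) @ E"
  shows "\<exists>vs. us = ts @ vs \<and> E = concat (map nodes vs)"
  using assms
proof (induction ts arbitrary: us)
  case (Cons t ts)
  then obtain u us' where us: "us = u # us'" using nodes_nonempty[of t] by (cases us) auto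
  then have "u = t" using Cons.prems nodes_children[of u] nodes_children[of t] by simp
  then show ?case using Cons us by auto
qed simp

text \<open>A node is followed in preorder by the nodes of its child subtrees. Together with
  \<open>concat_nodes_prefix\<close> this shows that the children of the node to be processed are on
  top of the stack.\<close>

lemma nodes_split:
  assumes "nodes u = D @ t # E"
  shows "\<exists>E'. E = concat (map nodes (children t)) @ E'"
  using assms
proof (induction u arbitrary: D E)
  case (Leaf a)
  then show ?case by (cases D) auto
next
  case (Branch l r)
  show ?case
  proof (cases D)
    case Nil
    then show ?thesis using Branch.prems by auto
  next
    case (Cons x D')
    then have "nodes l @ nodes r = D' @ t # E" using Branch.prems by simp
    then consider X where "nodes l = D' @ X" "X @ nodes r = t # E" | X where "nodes r = X @ t # E"
      by (auto simp: append_eq_append_conv2)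
    then show ?thesis
    proof cases
      case (1 X)
      show ?thesis
      \<comment> \<open>If \<open>X\<close> is empty, \<open>t\<close> is the root of the right
        subtree.\<close>
      proof (cases X)
        case Nil
        then show ?thesis using Branch.IH(2)[of "[]" E] 1 by simp
      next
        case (Cons y X')
        then show ?thesis using Branch.IH(1)[of D' X'] 1 by auto
      qed
    next
      case (2 X)
      then show ?thesis by (rule Branch.IH(2))
    qed
  qed
qed

context encoded_cnf
begin

lemma wp_prep_com:
  assumes c: "ctx s" and mask: "reg s rMask = lo" "reg s rFree = lo + m"
    and Z: "flist (mem s) {..<lo} m (reg s rZero) [{}]"
    and z: "\<And>a. lo \<le> a \<Longrightarrow> mem s a = 0" and st: "stack_at (mem s) lo (reg s rStack) (children t @ ts)"
    and code: "seg (mem s) (reg s rPos) (head_code \<gamma> \<nu> t)" "reg s rPos + length (head_code \<gamma> \<nu> t) \<le> lo"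
    and t: "t \<in> set (nodes T)"
    and post: "\<And>i s'. i \<le> 80 * m + 100 \<Longrightarrow> prepared (mem s) lo t ts s' \<Longrightarrow> Q i s'"
  shows "wp prep_com Q s"
proof (cases t)
  case (Branch l r)
  have "wp branch_com (\<lambda>i s'. \<forall>j\<le>i + 20. Q j s') s"
    by (rule wp_branch_com[where lo = lo and l = l and r = r and ts = ts])
      (use c mask z st t post Branch in \<open>auto simp: ctx_def simp del: stack_at.simps\<close>)
  then show ?thesis
    unfolding prep_com_def using code(1) Branch by (simp, elim wp_mono, simp)
next
  case (Leaf a)
  show ?thesis
  proof (cases a)
    case (Inl x)
    have "wp clause_com (\<lambda>i s'. \<forall>j\<le>i + 20. Q j s') s"
      by (rule wp_clause_com[OF c mask Z z, where x = x and ts = ts])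
        (use code st t post Leaf Inl in auto)
    then show ?thesis
      unfolding prep_com_def using code(1) Leaf Inl by (simp, elim wp_mono, simp)
  next
    case (Inr x)
    have "wp var_com (\<lambda>i s'. \<forall>j\<le>i + 20. Q j s') s"
      by (rule wp_var_com[OF c mask Z z, where x = x and ts = ts])
        (use code st t post Leaf Inr in auto)
    then show ?thesis
      unfolding prep_com_def using code(1) Leaf Inr by (simp, elim wp_mono, simp)
  qed
qed

lemma node_atI:
  assumes "data_at \<mu> u p t" "\<mu> p = kd" "\<mu> (p + 1) = a" "\<mu> (p + 2) = b"
    and "case t of Leaf x \<Rightarrow> kd = 1 | Branch l r \<Rightarrow> kd = 0 \<and> node_at \<mu> u a l \<and> node_at \<mu> u b r"
  shows "node_at \<mu> u p t"
  using assms by (cases t) auto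

lemma wp_finish_com:
  assumes fr: "fresh s" "0 < reg s rFree"
    and fam: "family_at (mem s) (reg s rFree) (reg s rRes) (fam t)"
    and mask: "vec (mem s) (reg s rMask) m (below t)" "reg s rMask + m \<le> reg s rFree"
    and st: "stack_at (mem s) (reg s rFree) (reg s rStack) ts"
    and kind: "case t of Leaf a \<Rightarrow> reg s rKind = 1
      | Branch l r \<Rightarrow> reg s rKind = 0 \<and> node_at (mem s) (reg s rFree) (reg s rLeft) l \<and>
          node_at (mem s) (reg s rFree) (reg s rRight) r"
    and post: "\<And>i s'. i \<le> 60 \<Longrightarrow> fresh s' \<Longrightarrow> reg s rFree \<le> reg s' rFree \<Longrightarrow>
       (\<And>a. a < reg s rFree \<Longrightarrow> mem s' a = mem s a) \<Longrightarrow>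
       stack_at (mem s') (reg s' rFree) (reg s' rStack) (t # ts) \<Longrightarrow>
       (\<And>r. r \<notin> {rStack, rFree} \<Longrightarrow> reg s' r = reg s r) \<Longrightarrow> Q i s'"
  shows "wp finish_com Q s"
proof -
  let ?p = "reg s rFree"
  define \<mu> where "\<mu> = (mem s)(?p := reg s rKind, ?p + 1 := reg s rLeft, ?p + 2 := reg s rRight,
     ?p + 3 := reg s rRes, ?p + 4 := reg s rMask, ?p + 5 := reg s rStack)"
  have \<mu>: "\<mu> ?p = reg s rKind" "\<mu> (?p + 1) = reg s rLeft" "\<mu> (?p + 2) = reg s rRight"
     "\<mu> (?p + 3) = reg s rRes" "\<mu> (?p + 4) = reg s rMask" "\<mu> (?p + 5) = reg s rStack"
    and lo: "\<And>a. a < ?p \<Longrightarrow> \<mu> a = mem s a"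
    by (simp_all add: \<mu>_def)
  have hi: "\<mu> a = 0" if "?p + 6 \<le> a" for a
    using fr(1) that by (simp add: \<mu>_def fresh_def)
  have "family_at \<mu> (?p + 6) (reg s rRes) (fam t)"
    by (rule family_at_mono[OF fam]) (use lo in auto)
  moreover have "vec \<mu> (reg s rMask) m (below t)"
    by (rule vec_cong[OF mask(1)]) (use mask(2) lo in simp)
  ultimately have "data_at \<mu> (?p + 6) ?p t"
    unfolding data_at_def \<mu> using mask(2) fr(2) by simp
  moreover have "node_at \<mu> (?p + 6) q u" if "node_at (mem s) ?p q u" for q u
    by (rule node_at_mono[OF that]) (use lo in auto)
  ultimately have "node_at \<mu> (?p + 6) ?p t"
    using kind by (intro node_atI[OF _ \<mu>(1-3)]) (auto split: btree.splits)
  moreover have "stack_at \<mu> (?p + 6) (reg s rStack) ts"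
    by (rule stack_at_mono[OF st]) (use lo in auto)
  ultimately have stk: "stack_at \<mu> (?p + 6) ?p (t # ts)" using \<mu>(6) by simp
  let ?s = "s\<lparr>mem := \<mu>, reg := (reg s)(rStack := ?p, rFree := ?p + 6)\<rparr>"
  have "\<mu> = (mem s)(?p := reg s rKind, Suc ?p := reg s rLeft, Suc (Suc ?p) := reg s rRight,
     ?p + 3 := reg s rRes, ?p + 4 := reg s rMask, ?p + 5 := reg s rStack)"
    by (simp add: \<mu>_def)
  note e = this[symmetric]
  have P: "Q i ?s" if "i \<le> 60" for i
    by (rule post) (use that hi lo stk in \<open>auto simp: fresh_def simp del: stack_at.simps\<close>)
  show ?thesis
    unfolding finish_com_def by (simp add: e P)
qed

lemma wp_build_body:
  assumes c: "ctx s" and tk: "toks_at \<gamma> \<nu> (mem s) (reg s rFree) (reg s rToks) (t # us)"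
    and st: "stack_at (mem s) (reg s rFree) (reg s rStack) (children t @ ts)"
    and t: "t \<in> set (nodes T)"
    and post: "\<And>i s'. i \<le> 1200 * (k * k * m) \<Longrightarrow> ctx s' \<Longrightarrow> 
       toks_at \<gamma> \<nu> (mem s') (reg s' rFree) (reg s' rToks) us \<Longrightarrow>
       stack_at (mem s') (reg s' rFree) (reg s' rStack) (t # ts) \<Longrightarrow> Q i s'"
  shows "wp build_body Q s"
proof -
  let ?lo = "reg s rFree" and ?q = "mem s (reg s rToks)" and ?tk = "mem s (reg s rToks + 1)"
  note cd = c[unfolded ctx_def]
  have z: "\<And>a. ?lo \<le> a \<Longrightarrow> mem s a = 0" using cd by (simp add: fresh_def)
  have code: "seg (mem s) ?q (head_code \<gamma> \<nu> t)" "?q + length (head_code \<gamma> \<nu> t) \<le> ?lo"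
    and us: "toks_at \<gamma> \<nu> (mem s) ?lo ?tk us" using tk by simp_all
  let ?s0 = "s\<lparr>reg := (reg s)(rPos := ?q, rToks := ?tk, rMask := ?lo)\<rparr>"
  have "wp (skip_com rM 1) (\<lambda>i1. wp prep_com (\<lambda>i2 s2. wp product_com (\<lambda>i4. wp finish_com
     (\<lambda>i5 s5. \<forall>j\<le>20 + (i1 + (i2 + (i4 + i5))). Q j s5)) (s2\<lparr>reg := (reg s2)(rPol := 0)\<rparr>))) ?s0"
  proof (rule wp_skip_com)
    fix i1 :: nat and s1 :: state
    assume i1: "i1 \<le> 20 * reg ?s0 rM + 10" and F1: "reg s1 rFree = reg ?s0 rFree + 1 * reg ?s0 rM"
      and m1: "mem s1 = mem ?s0" and r1: "\<And>q. q \<notin> {rQ, rFree} \<Longrightarrow> reg s1 q = reg ?s0 q"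
    have R1: "reg s1 rMask = ?lo" "reg s1 rFree = ?lo + m" "mem s1 = mem s" "reg s1 rPos = ?q"
      "reg s1 rStack = reg s rStack" "reg s1 rZero = reg s rZero" "reg s1 rToks = ?tk"
      "reg s1 rM = m" "reg s1 rRows = reg s rRows"
      using F1 m1 r1 cd by simp_all
    have c1: "ctx s1"
      by (rule ctx_mono[OF c]) (use R1 cd in \<open>auto simp: fresh_def\<close>)
    show "wp prep_com (\<lambda>i2 s2. wp product_com (\<lambda>i4. wp finish_com
     (\<lambda>i5 s5. \<forall>j\<le>20 + (i1 + (i2 + (i4 + i5))). Q j s5)) (s2\<lparr>reg := (reg s2)(rPol := 0)\<rparr>)) s1"
    proof (rule wp_frameI, rule wp_prep_com[OF c1 R1(1,2), where t = t and ts = ts and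
          Q = "\<lambda>i s'. i \<le> 80 * m + 100 \<and> prepared (mem s) ?lo t ts s'"])
      fix i2 :: nat and s2 :: state
      assume P: "i2 \<le> 80 * m + 100 \<and> prepared (mem s) ?lo t ts s2"
        and r2: "\<And>r. r \<notin> wregs prep_com \<Longrightarrow> reg s2 r = reg s1 r"
      note p = conjunct2[OF P, unfolded prepared_def]
      then obtain As Bs where AB: "flist (mem s2) {..<reg s2 rFree} m (reg s2 rA) As"
          "flist (mem s2) {..<reg s2 rFree} m (reg s2 rB) Bs" "As \<noteq> []" "Bs \<noteq> []"
          "length As * length Bs \<le> 2 * k * k"
          "products m (below t) False (set As) (set Bs) = fam t" by blast
      have p2: "fresh s2" "?lo + m \<le> reg s2 rFree" "\<And>a. a < ?lo \<Longrightarrow> mem s2 a = mem s a"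
        "vec (mem s2) ?lo m (below t)" "stack_at (mem s) ?lo (reg s2 rStack) ts"
        "case t of Leaf a \<Rightarrow> reg s2 rKind = 1
         | Branch l r \<Rightarrow> reg s2 rKind = 0 \<and> node_at (mem s) ?lo (reg s2 rLeft) l \<and> node_at (mem s) ?lo (reg s2 rRight) r"
        using p by blast+
      have R2: "reg s2 rMask = ?lo" "reg s2 rZero = reg s rZero" "reg s2 rToks = ?tk"
        "reg s2 rM = m" "reg s2 rRows = reg s rRows"
        using r2 R1 by simp_all
      let ?s2 = "s2\<lparr>reg := (reg s2)(rPol := 0)\<rparr>"
      have "wp product_com (\<lambda>i4. wp finish_com (\<lambda>i5 s5. \<forall>j\<le>20 + (i1 + (i2 + (i4 + i5))). Q j s5)) ?s2"
      proof (rule wp_product_com[where m = m and As = As and Bs = Bs and P = "below t" and b = False])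
        fix i4 :: nat and s4 :: state and Xs
        assume i4: "i4 \<le> 300 * (length As * length Bs * m)" and f4: "fresh s4" "reg ?s2 rFree \<le> reg s4 rFree"
          and m4: "\<And>a. a < reg ?s2 rFree \<Longrightarrow> mem s4 a = mem ?s2 a"
          and X: "distinct Xs" "set Xs = products m (below t) False (set As) (set Bs)"
            "flist (mem s4) {..<reg s4 rFree} m (reg s4 rRes) Xs"
          and r4: "\<And>r. r \<notin> wregs product_com \<Longrightarrow> reg s4 r = reg ?s2 r"
        have R4: "reg s4 rMask = ?lo" "reg s4 rZero = reg s rZero" "reg s4 rToks = ?tk"
          "reg s4 rM = m" "reg s4 rRows = reg s rRows" "reg s4 rStack = reg s2 rStack"
          "reg s4 rKind = reg s2 rKind" "reg s4 rLeft = reg s2 rLeft" "reg s4 rRight = reg s2 rRight"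
          using r4 R2 by simp_all
        have lo4: "?lo \<le> reg s4 rFree" "?lo + m \<le> reg s4 rFree" using f4 p2(2) by simp_all
        have m40: "\<And>a. a < ?lo \<Longrightarrow> mem s4 a = mem s a" using m4 p2(2,3) by simp
        show "wp finish_com (\<lambda>i5 s5. \<forall>j\<le>20 + (i1 + (i2 + (i4 + i5))). Q j s5) s4"
        proof (rule wp_finish_com[where t = t and ts = ts])
          show "fresh s4" "0 < reg s4 rFree" using f4 lo4 cd by simp_all
          show "family_at (mem s4) (reg s4 rFree) (reg s4 rRes) (fam t)"
            unfolding family_at_def using X AB(6) by blast
          show "vec (mem s4) (reg s4 rMask) m (below t)"
            unfolding R4 by (rule vec_cong[OF p2(4)]) (use m4 p2(2) in simp)
          show "reg s4 rMask + m \<le> reg s4 rFree" using R4 lo4 by simp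
          show "stack_at (mem s4) (reg s4 rFree) (reg s4 rStack) ts"
            unfolding R4 by (rule stack_at_mono[OF p2(5) lo4(1) m40])
          have "node_at (mem s4) (reg s4 rFree) q u" if "node_at (mem s) ?lo q u" for q u
            by (rule node_at_mono[OF that lo4(1) m40])
          then show "case t of Leaf a \<Rightarrow> reg s4 rKind = 1
            | Branch l r \<Rightarrow> reg s4 rKind = 0 \<and> node_at (mem s4) (reg s4 rFree) (reg s4 rLeft) l \<and>
              node_at (mem s4) (reg s4 rFree) (reg s4 rRight) r"
            unfolding R4 using p2(6) by (cases t) auto
          fix i5 :: nat and s5 :: state
          assume i5: "i5 \<le> 60" and f5: "fresh s5" "reg s4 rFree \<le> reg s5 rFree"
            and m5: "\<And>a. a < reg s4 rFree \<Longrightarrow> mem s5 a = mem s4 a"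
            and st5: "stack_at (mem s5) (reg s5 rFree) (reg s5 rStack) (t # ts)"
            and r5: "\<And>r. r \<notin> {rStack, rFree} \<Longrightarrow> reg s5 r = reg s4 r"
          have m50: "\<And>a. a < ?lo \<Longrightarrow> mem s5 a = mem s a" using m40 m5 lo4 by simp
          have lo5: "?lo \<le> reg s5 rFree" using lo4 f5 by simp
          have c5: "ctx s5"
            by (rule ctx_mono[OF c f5(1) lo5 m50]) (use r5 R4 cd in auto)
          have T5: "toks_at \<gamma> \<nu> (mem s5) (reg s5 rFree) (reg s5 rToks) us"
            using toks_at_mono[OF us lo5 m50] r5[of rToks] R4 by simp
          \<comment> \<open>The product dominates; since \<open>m \<le> k * k * m\<close>, the mask
            and the preparation are charged to it.\<close>
          have "300 * (length As * length Bs * m) \<le> 600 * (k * k * m)"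
            using mult_le_mono1[OF AB(5), of m] by (simp add: algebra_simps)
          moreover have "m \<le> k * k * m" "1 \<le> m"
            using k_pos m_pos by (simp_all add: Suc_le_eq)
          moreover have "i1 \<le> 20 * m + 10" using i1 cd by simp
          ultimately have "20 + (i1 + (i2 + (i4 + i5))) \<le> 1200 * (k * k * m)"
            using conjunct1[OF P] i4 i5 by linarith
          then show "\<forall>j\<le>20 + (i1 + (i2 + (i4 + i5))). Q j s5"
            using post[OF _ c5 T5 st5] by simp
        qed
      next
        show "vec (mem ?s2) (reg ?s2 rMask) m (below t)" "reg ?s2 rMask + m \<le> reg ?s2 rFree"
          using p2 R2 by simp_all
      qed (use p2 R2 AB m_pos cd in \<open>simp_all add: fresh_def\<close>)
      then show "wp product_com (\<lambda>i4. wp finish_com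
        (\<lambda>i5 s5. \<forall>j\<le>20 + (i1 + (i2 + (i4 + i5))). Q j s5)) ?s2" .
    qed (use R1 z st code t cd in auto)
  qed simp
  then show ?thesis
    unfolding build_body_def
    by simp (elim wp_mono, simp)
qed

lemma wp_build_com:
  assumes c: "ctx s" and tk: "toks_at \<gamma> \<nu> (mem s) (reg s rFree) (reg s rToks) (rev (nodes T))"
    and post: "\<And>i s'. i \<le> length (nodes T) * (1200 * (k * k * m) + 10) + 10 \<Longrightarrow> ctx s' \<Longrightarrow>
       node_at (mem s') (reg s' rFree) (reg s' rStack) T \<Longrightarrow> Q i s'"
  shows "wp build_com Q s"
proof -
  let ?N = "length (nodes T)" and ?C = "1200 * (k * k * m) + 10"
  \<comment> \<open>After \<open>j\<close> rounds the last \<open>j\<close> nodes in preorder are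
    done. The stack is the forest of maximal finished subtrees, whose preorder is just this
    suffix.\<close>
  let ?I = "\<lambda>j s'. ctx s' \<and>
     toks_at \<gamma> \<nu> (mem s') (reg s' rFree) (reg s' rToks) (rev (take (?N - j) (nodes T))) \<and>
     (\<exists>ts. concat (map nodes ts) = drop (?N - j) (nodes T) \<and>
        stack_at (mem s') (reg s' rFree) (reg s' rStack) ts)"
  show ?thesis
    unfolding build_com_def
    apply simp
    apply (rule wp_for[where N = ?N and C = ?C and I = ?I])
    subgoal
    proof -
      have "ctx (s\<lparr>reg := (reg s)(rStack := 0)\<rparr>)"
        by (rule ctx_mono[OF c]) (use c in \<open>auto simp: ctx_def fresh_def\<close>)
      then show ?thesis using tk by (auto intro!: exI[of _ "[]"])
    qed
    subgoal premises st for j s'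
    proof -
      define i where "i = ?N - Suc j"
      have i: "?N - j = Suc i" "i < ?N" using st(1) by (simp_all add: i_def)
      have I: "ctx s'" "toks_at \<gamma> \<nu> (mem s') (reg s' rFree) (reg s' rToks) (rev (take (Suc i) (nodes T)))"
        using st(2) unfolding i(1) by blast+
      from st(2) obtain ts where ts: "concat (map nodes ts) = drop (Suc i) (nodes T)"
        "stack_at (mem s') (reg s' rFree) (reg s' rStack) ts"
        unfolding i(1) by blast
      let ?t = "nodes T ! i"
      have tk': "toks_at \<gamma> \<nu> (mem s') (reg s' rFree) (reg s' rToks) (?t # rev (take i (nodes T)))"
        using I(2) i(2) by (simp add: take_Suc_conv_app_nth)
      \<comment> \<open>The children come next in preorder, and preorder determines the forest;
        hence they head the stack.\<close>
      have "nodes T = take i (nodes T) @ ?t # drop (Suc i) (nodes T)" using i(2) by (rule id_take_nth_drop)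
      then obtain E' where "concat (map nodes ts) = concat (map nodes (children ?t)) @ E'"
        unfolding ts(1) using nodes_split by blast
      then obtain vs where vs: "ts = children ?t @ vs" using concat_nodes_prefix by blast
      have eq: "concat (map nodes (?t # vs)) = drop i (nodes T)"
        using ts(1) i(2) unfolding vs by (simp add: nodes_children[of ?t] Cons_nth_drop_Suc[symmetric])
      have "wp build_body (\<lambda>q s''. q + cost_test (Neq (Reg rToks) (Const 0)) \<le> ?C \<and> ?I (Suc j) s'') s'"
      proof (rule wp_build_body[OF I(1) tk' ts(2)[unfolded vs]])
        show "?t \<in> set (nodes T)" using i(2) by simp
        fix q and s'' :: state
        assume q: "q \<le> 1200 * (k * k * m)" and *: "ctx s''"
          "toks_at \<gamma> \<nu> (mem s'') (reg s'' rFree) (reg s'' rToks) (rev (take i (nodes T)))"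
          "stack_at (mem s'') (reg s'' rFree) (reg s'' rStack) (?t # vs)"
        have "\<exists>ts. concat (map nodes ts) = drop i (nodes T) \<and>
          stack_at (mem s'') (reg s'' rFree) (reg s'' rStack) ts"
          using eq *(3) by blast
        then show "q + cost_test (Neq (Reg rToks) (Const 0)) \<le> ?C \<and> ?I (Suc j) s''"
          using q *(1,2) by (simp add: i_def)
      qed
      then show ?thesis using tk' by simp
    qed
    subgoal premises st for s' using st(1) by simp
    subgoal premises st for q s'
    proof -
      from st(2) obtain ts where ts: "concat (map nodes ts) = nodes T"
        "stack_at (mem s') (reg s' rFree) (reg s' rStack) ts" by auto
      then obtain vs where "ts = [T] @ vs" "[] = concat (map nodes vs)"
        using concat_nodes_prefix[of ts "[T]" "[]"] by auto
      then have "stack_at (mem s') (reg s' rFree) (reg s' rStack) (T # vs)" using ts(2) by simp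
      then show ?thesis by (intro post) (use st in auto)
    qed
    done
qed

end

subsection \<open>The families of the complements, top-down\<close>

abbreviation (input) "rPend \<equiv> (28::nat)"
abbreviation (input) "rDone \<equiv> (29::nat)"
abbreviation (input) "rNd \<equiv> (30::nat)"
abbreviation (input) "rCo \<equiv> (31::nat)"
abbreviation (input) "rRev \<equiv> (32::nat)"

text \<open>A cell holds a node record, the family of its complement, and a link. The pending, the
  finished and the reversed list all have this form.\<close>

definition push_com :: "nat \<Rightarrow> nat \<Rightarrow> nat \<Rightarrow> com" where
  "push_com r x y = Store (Reg rFree) (Reg x) ;; Store (Add (Reg rFree) (Const 1)) (Reg y) ;;
     Store (Add (Reg rFree) (Const 2)) (Reg r) ;; Assign r (Reg rFree) ;; incr rFree 3"

text \<open>Handles child \<open>x\<close> with sibling \<open>y\<close>. \<open>rA\<close> still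
  holds the family of the parent's complement, as \<open>product_com\<close> leaves its operands in
  place.\<close>

definition side_com :: "nat \<Rightarrow> nat \<Rightarrow> com" where
  "side_com x y = Assign rB (field y 3) ;; Assign rMask (field x 4) ;; product_com ;;
     push_com rPend x rRes"

text \<open>The right child is pushed before the left one, so that nodes are popped in preorder;
  \<open>rDone\<close> therefore collects them in reverse. Polarity 1 keeps the clauses below the
  child.\<close>

definition down_body :: com where
  "down_body =
     Assign rNd (Load (Reg rPend)) ;; Assign rCo (field rPend 1) ;; Assign rPend (field rPend 2) ;;
     push_com rDone rNd rCo ;;
     Cond (Eq (Load (Reg rNd)) (Const 0))
       (Assign rLeft (field rNd 1) ;; Assign rRight (field rNd 2) ;; Assign rPol (Const 1) ;;
        Assign rA (Reg rCo) ;; side_com rRight rLeft ;; side_com rLeft rRight) Skip"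

definition down_com :: com where
  "down_com = Assign rPend (Const 0) ;; Assign rDone (Const 0) ;; push_com rPend rStack rZero ;;
     While (Neq (Reg rPend) (Const 0)) down_body"

text \<open>Restores preorder, the order in which the output has to list the nodes.\<close>

definition rev_com :: com where
  "rev_com = Assign rRev (Const 0) ;;
     While (Neq (Reg rDone) (Const 0))
       (Assign rNd (Load (Reg rDone)) ;; Assign rCo (field rDone 1) ;; Assign rDone (field rDone 2) ;;
        push_com rRev rNd rCo)"

lemma wregs_push_com [simp]: "wregs (push_com r x y) = {r, rFree}"
  by (auto simp: push_com_def)

lemma wregs_side_com [simp]:
  "wregs (side_com x y) = {rB, rMask, rPend, rRes, rRoot, rFree, rI, rJ, rCell, rK, rNode, rFlag}"
  by (auto simp: side_com_def)

context encoded_cnf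
begin

fun pend_at :: "(nat \<Rightarrow> nat) \<Rightarrow> nat \<Rightarrow> nat \<Rightarrow> ('a + 'b) btree list \<Rightarrow> bool" where
  "pend_at \<mu> u p [] \<longleftrightarrow> p = 0"
| "pend_at \<mu> u p (t # ts) \<longleftrightarrow> p \<noteq> 0 \<and> p + 2 < u \<and> node_at \<mu> u (\<mu> p) t \<and>
     family_at \<mu> u (\<mu> (p + 1)) (cofam t) \<and> pend_at \<mu> u (\<mu> (p + 2)) ts"

lemma pend_at_mono:
  assumes "pend_at \<mu> u p ts" "u \<le> u'" "\<And>a. a < u \<Longrightarrow> \<mu>' a = \<mu> a"
  shows "pend_at \<mu>' u' p ts"
  using assms(1)
proof (induction ts arbitrary: p)
  case (Cons t ts)
  then have n: "node_at \<mu> u (\<mu> p) t" "family_at \<mu> u (\<mu> (p + 1)) (cofam t)" "p + 2 < u" by auto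
  have "\<mu>' p = \<mu> p" "\<mu>' (p + 1) = \<mu> (p + 1)" "\<mu>' (p + 2) = \<mu> (p + 2)" using n(3) by (simp_all add: assms(3))
  then show ?case
    using Cons node_at_mono[OF n(1) assms(2,3)] family_at_mono[OF n(2) assms(2,3)] assms(2) by auto
qed simp

lemma wp_push_com:
  assumes fr: "fresh s" "0 < reg s rFree" and r: "r \<notin> {rFree}"
    and t: "node_at (mem s) (reg s rFree) (reg s x) t"
      "family_at (mem s) (reg s rFree) (reg s y) (cofam t)"
      "pend_at (mem s) (reg s rFree) (reg s r) ts"
    and post: "\<And>i s'. i \<le> 30 \<Longrightarrow> fresh s' \<Longrightarrow> reg s rFree \<le> reg s' rFree \<Longrightarrow>
       (\<And>a. a < reg s rFree \<Longrightarrow> mem s' a = mem s a) \<Longrightarrow>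
       pend_at (mem s') (reg s' rFree) (reg s' r) (t # ts) \<Longrightarrow>
       (\<And>q. q \<notin> {r, rFree} \<Longrightarrow> reg s' q = reg s q) \<Longrightarrow> Q i s'"
  shows "wp (push_com r x y) Q s"
proof -
  let ?p = "reg s rFree"
  define \<mu> where "\<mu> = (mem s)(?p := reg s x, ?p + 1 := reg s y, ?p + 2 := reg s r)"
  have \<mu>: "\<mu> ?p = reg s x" "\<mu> (?p + 1) = reg s y" "\<mu> (?p + 2) = reg s r"
    and lo: "\<And>a. a < ?p \<Longrightarrow> \<mu> a = mem s a" and hi: "\<And>a. ?p + 3 \<le> a \<Longrightarrow> \<mu> a = 0"
    using fr(1) by (simp_all add: \<mu>_def fresh_def)
  have le: "?p \<le> ?p + 3" by simp
  have pend: "pend_at \<mu> (?p + 3) ?p (t # ts)"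
    using node_at_mono[OF t(1) le lo] family_at_mono[OF t(2) le lo] pend_at_mono[OF t(3) le lo] fr(2) \<mu>
    by simp
  let ?s = "s\<lparr>mem := \<mu>, reg := (reg s)(r := ?p, rFree := ?p + 3)\<rparr>"
  have "\<mu> = (mem s)(?p := reg s x, Suc ?p := reg s y, Suc (Suc ?p) := reg s r)"
    by (simp add: \<mu>_def)
  note e = this[symmetric]
  have P: "Q i ?s" if "i \<le> 30" for i
    by (rule post) (use that hi lo pend r in \<open>auto simp: fresh_def simp del: pend_at.simps\<close>)
  show ?thesis
    unfolding push_com_def using r by (simp add: e P)
qed

lemma wp_side_com:
  assumes fr: "fresh s" and m: "reg s rM = m" and pol: "reg s rPol = 1"
    and xy: "x \<in> {rLeft, rRight}" "y \<in> {rLeft, rRight}"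
    and A: "family_at (mem s) (reg s rFree) (reg s rA) (cofam v)" and v: "v \<in> set (nodes T)"
    and t: "node_at (mem s) (reg s rFree) (reg s x) t" and u: "node_at (mem s) (reg s rFree) (reg s y) u"
    and pend: "pend_at (mem s) (reg s rFree) (reg s rPend) ts"
    and prod: "products m (below t) True (cofam v) (fam u) = cofam t" and uT: "u \<in> set (nodes T)"
    and post: "\<And>i s'. i \<le> 400 * (k * k * m) \<Longrightarrow> fresh s' \<Longrightarrow> reg s rFree \<le> reg s' rFree \<Longrightarrow>
       (\<And>a. a < reg s rFree \<Longrightarrow> mem s' a = mem s a) \<Longrightarrow>
       pend_at (mem s') (reg s' rFree) (reg s' rPend) (t # ts) \<Longrightarrow>
       (\<And>q. q \<notin> wregs (side_com x y) \<Longrightarrow> reg s' q = reg s q) \<Longrightarrow> Q i s'"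
  shows "wp (side_com x y) Q s"
proof -
  let ?lo = "reg s rFree"
  note dt = node_at_data[OF t, unfolded data_at_def] and du = node_at_data[OF u, unfolded data_at_def]
  obtain As where As: "distinct As" "set As = cofam v" "flist (mem s) {..<?lo} m (reg s rA) As"
    using A unfolding family_at_def by blast
  obtain Bs where Bs: "distinct Bs" "set Bs = fam u" "flist (mem s) {..<?lo} m (mem s (reg s y + 3)) Bs"
    using du unfolding family_at_def by blast
  note fv = fam_facts[OF v] and fu = fam_facts[OF uT]
  have len: "length As \<le> k" "length Bs \<le> k" "As \<noteq> []" "Bs \<noteq> []"
    using fv(2,8) fu(1,7) As Bs distinct_card[OF As(1)] distinct_card[OF Bs(1)] by auto
  have len2: "length As * length Bs * m \<le> k * k * m"
    using mult_le_mono[OF len(1,2)] by simp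
  let ?s1 = "s\<lparr>reg := (reg s)(rB := mem s (reg s y + 3), rMask := mem s (reg s x + 4))\<rparr>"
  have "wp product_com (\<lambda>i. wp (push_com rPend x rRes) (\<lambda>j s'. \<forall>q\<le>20 + (i + j). Q q s')) ?s1"
  proof (rule wp_product_com[where m = m and As = As and Bs = Bs and P = "below t" and b = True])
    fix i :: nat and s2 :: state and Xs
    assume i: "i \<le> 300 * (length As * length Bs * m)" and f2: "fresh s2" "reg ?s1 rFree \<le> reg s2 rFree"
      and m2: "\<And>a. a < reg ?s1 rFree \<Longrightarrow> mem s2 a = mem ?s1 a"
      and X: "distinct Xs" "set Xs = products m (below t) True (set As) (set Bs)"
        "flist (mem s2) {..<reg s2 rFree} m (reg s2 rRes) Xs"
      and r2: "\<And>r. r \<notin> wregs product_com \<Longrightarrow> reg s2 r = reg ?s1 r"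
    have R2: "reg s2 x = reg s x" "reg s2 rPend = reg s rPend" using r2 xy by auto
    have lo2: "?lo \<le> reg s2 rFree" and m20: "\<And>a. a < ?lo \<Longrightarrow> mem s2 a = mem s a"
      using f2 m2 by simp_all
    show "wp (push_com rPend x rRes) (\<lambda>j s'. \<forall>q\<le>20 + (i + j). Q q s') s2"
    proof (rule wp_push_com[where t = t and ts = ts])
      show "node_at (mem s2) (reg s2 rFree) (reg s2 x) t"
        unfolding R2 by (rule node_at_mono[OF t lo2 m20])
      show "pend_at (mem s2) (reg s2 rFree) (reg s2 rPend) ts"
        unfolding R2 by (rule pend_at_mono[OF pend lo2 m20])
      show "family_at (mem s2) (reg s2 rFree) (reg s2 rRes) (cofam t)"
        unfolding family_at_def using X prod As(2) Bs(2) by auto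
      fix j :: nat and s3 :: state
      assume j: "j \<le> 30" and f3: "fresh s3" "reg s2 rFree \<le> reg s3 rFree"
        and m3: "\<And>a. a < reg s2 rFree \<Longrightarrow> mem s3 a = mem s2 a"
        and p3: "pend_at (mem s3) (reg s3 rFree) (reg s3 rPend) (t # ts)"
        and r3: "\<And>q. q \<notin> {rPend, rFree} \<Longrightarrow> reg s3 q = reg s2 q"
      have "1 \<le> k * k * m" using k_pos m_pos by (simp add: Suc_le_eq)
      then have q: "20 + (i + j) \<le> 400 * (k * k * m)" using i j len2 by linarith
      show "\<forall>q\<le>20 + (i + j). Q q s3"
      proof (intro allI impI post)
        fix r assume "r \<notin> wregs (side_com x y)"
        then show "reg s3 r = reg s r" using r3[of r] r2[of r] by simp
      qed (use q f3 lo2 m3 m20 p3 in auto)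
    qed (use f2 dt lo2 in auto)
  qed (use fr m pol As Bs len dt du m_pos xy in \<open>auto simp: fresh_def\<close>)
  then show ?thesis
    unfolding side_com_def using xy by auto (elim wp_mono, simp)+
qed

lemma wp_down_body:
  assumes c: "ctx s" and t: "t \<in> set (nodes T)"
    and pend: "pend_at (mem s) (reg s rFree) (reg s rPend) (t # ts)"
    and dn: "pend_at (mem s) (reg s rFree) (reg s rDone) us"
    and post: "\<And>i s'. i \<le> 1000 * (k * k * m) \<Longrightarrow> ctx s' \<Longrightarrow>
       pend_at (mem s') (reg s' rFree) (reg s' rPend) (children t @ ts) \<Longrightarrow>
       pend_at (mem s') (reg s' rFree) (reg s' rDone) (t # us) \<Longrightarrow> Q i s'"
  shows "wp down_body Q s"
proof -
  note cd = c[unfolded ctx_def]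
  let ?p = "reg s rPend"
  have p: "?p \<noteq> 0" "?p + 2 < reg s rFree" and nt: "node_at (mem s) (reg s rFree) (mem s ?p) t"
    and ct: "family_at (mem s) (reg s rFree) (mem s (?p + 1)) (cofam t)"
    and ts: "pend_at (mem s) (reg s rFree) (mem s (?p + 2)) ts" using pend by simp_all
  let ?s1 = "s\<lparr>reg := (reg s)(rNd := mem s ?p, rCo := mem s (?p + 1), rPend := mem s (?p + 2))\<rparr>"
  let ?rest = "Cond (Eq (Load (Reg rNd)) (Const 0))
       (Assign rLeft (field rNd 1) ;; Assign rRight (field rNd 2) ;; Assign rPol (Const 1) ;;
        Assign rA (Reg rCo) ;; side_com rRight rLeft ;; side_com rLeft rRight) Skip"
  have big: "1 \<le> k * k * m" using k_pos m_pos by (simp add: Suc_le_eq)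
  have "wp (push_com rDone rNd rCo) (\<lambda>i. wp ?rest (\<lambda>j s'. \<forall>q\<le>20 + (i + j). Q q s')) ?s1"
  proof (rule wp_push_com[where t = t and ts = us])
    fix i :: nat and s2 :: state
    assume i: "i \<le> 30" and f2: "fresh s2" "reg ?s1 rFree \<le> reg s2 rFree"
      and m2': "\<And>a. a < reg ?s1 rFree \<Longrightarrow> mem s2 a = mem ?s1 a"
      and d2: "pend_at (mem s2) (reg s2 rFree) (reg s2 rDone) (t # us)"
      and r2': "\<And>q. q \<notin> {rDone, rFree} \<Longrightarrow> reg s2 q = reg ?s1 q"
    have lo2: "reg s rFree \<le> reg s2 rFree" and m2: "\<And>a. a < reg s rFree \<Longrightarrow> mem s2 a = mem s a"
      using f2 m2' by simp_all
    have r2: "reg s2 rNd = mem s ?p" "reg s2 rCo = mem s (?p + 1)" "reg s2 rPend = mem s (?p + 2)"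
      "reg s2 rM = m" "reg s2 rRows = reg s rRows" "reg s2 rZero = reg s rZero"
      using r2' cd by simp_all
    have c2: "ctx s2" by (rule ctx_mono[OF c f2(1) lo2 m2]) (use r2 cd in auto)
    have nt2: "node_at (mem s2) (reg s2 rFree) (reg s2 rNd) t"
      unfolding r2 by (rule node_at_mono[OF nt lo2 m2])
    have ct2: "family_at (mem s2) (reg s2 rFree) (reg s2 rCo) (cofam t)"
      unfolding r2 by (rule family_at_mono[OF ct lo2 m2])
    have ts2: "pend_at (mem s2) (reg s2 rFree) (reg s2 rPend) ts"
      unfolding r2 by (rule pend_at_mono[OF ts lo2 m2])
    show "wp ?rest (\<lambda>j s'. \<forall>q\<le>20 + (i + j). Q q s') s2"
    proof (cases t)
      case (Leaf a)
      have "\<forall>q\<le>100. Q q s2"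
      proof (intro allI impI, rule post)
        fix q :: nat assume "q \<le> 100"
        then show "q \<le> 1000 * (k * k * m)" using big by linarith
      qed (use c2 ts2 d2 Leaf in simp_all)
      then show ?thesis using nt2 Leaf i by simp
    next
      case (Branch l r)
      note v = t[unfolded Branch] note ch = branch_disjoint(3,4)[OF v]
      let ?n = "reg s2 rNd"
      have n2: "mem s2 ?n = 0" "node_at (mem s2) (reg s2 rFree) (mem s2 (?n + 1)) l"
        "node_at (mem s2) (reg s2 rFree) (mem s2 (?n + 2)) r"
        using nt2 unfolding Branch by simp_all
      let ?s3 = "s2\<lparr>reg := (reg s2)(rLeft := mem s2 (?n + 1), rRight := mem s2 (?n + 2), rPol := 1,
         rA := reg s2 rCo)\<rparr>"
      have "wp (side_com rRight rLeft) (\<lambda>i3. wp (side_com rLeft rRight)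
          (\<lambda>i4 s'. \<forall>q\<le>100 + (i3 + i4). Q q s')) ?s3"
      proof (rule wp_side_com[where v = t and t = r and u = l and ts = ts])
        show "products m (below r) True (cofam t) (fam l) = cofam r"
          unfolding Branch by (rule cofam_right[OF v])
        fix i3 :: nat and s4 :: state
        assume i3: "i3 \<le> 400 * (k * k * m)" and f4: "fresh s4" "reg ?s3 rFree \<le> reg s4 rFree"
          and m4': "\<And>a. a < reg ?s3 rFree \<Longrightarrow> mem s4 a = mem ?s3 a"
          and p4: "pend_at (mem s4) (reg s4 rFree) (reg s4 rPend) (r # ts)"
          and r4': "\<And>q. q \<notin> wregs (side_com rRight rLeft) \<Longrightarrow> reg s4 q = reg ?s3 q"
        have lo4: "reg s2 rFree \<le> reg s4 rFree" and m4: "\<And>a. a < reg s2 rFree \<Longrightarrow> mem s4 a = mem s2 a"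
          using f4 m4' by simp_all
        have r4: "reg s4 rLeft = mem s2 (?n + 1)" "reg s4 rRight = mem s2 (?n + 2)" "reg s4 rPol = 1"
          "reg s4 rA = reg s2 rCo" "reg s4 rDone = reg s2 rDone" "reg s4 rM = m"
          "reg s4 rRows = reg s2 rRows" "reg s4 rZero = reg s2 rZero"
          using r4' r2 by simp_all
        have c4: "ctx s4" by (rule ctx_mono[OF c2 f4(1) lo4 m4]) (use r2 r4 in auto)
        show "wp (side_com rLeft rRight) (\<lambda>i4 s'. \<forall>q\<le>100 + (i3 + i4). Q q s') s4"
        proof (rule wp_side_com[where v = t and t = l and u = r and ts = "r # ts"])
          show "products m (below l) True (cofam t) (fam r) = cofam l"
            unfolding Branch by (rule cofam_left[OF v])
          show "family_at (mem s4) (reg s4 rFree) (reg s4 rA) (cofam t)"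
            unfolding r4 by (rule family_at_mono[OF ct2 lo4 m4])
          show "node_at (mem s4) (reg s4 rFree) (reg s4 rLeft) l"
            unfolding r4 by (rule node_at_mono[OF n2(2) lo4 m4])
          show "node_at (mem s4) (reg s4 rFree) (reg s4 rRight) r"
            unfolding r4 by (rule node_at_mono[OF n2(3) lo4 m4])
          fix i4 :: nat and s5 :: state
          assume i4: "i4 \<le> 400 * (k * k * m)" and f5: "fresh s5" "reg s4 rFree \<le> reg s5 rFree"
            and m5: "\<And>a. a < reg s4 rFree \<Longrightarrow> mem s5 a = mem s4 a"
            and p5: "pend_at (mem s5) (reg s5 rFree) (reg s5 rPend) (l # r # ts)"
            and r5: "\<And>q. q \<notin> wregs (side_com rLeft rRight) \<Longrightarrow> reg s5 q = reg s4 q"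
          have c5: "ctx s5" by (rule ctx_mono[OF c4 f5 m5]) (use r5 in auto)
          have lo5: "reg s2 rFree \<le> reg s5 rFree" and m52: "\<And>a. a < reg s2 rFree \<Longrightarrow> mem s5 a = mem s2 a"
            using lo4 f5(2) m4 m5 by simp_all
          have rd: "reg s5 rDone = reg s2 rDone" using r5[of rDone] r4 by simp
          have d5: "pend_at (mem s5) (reg s5 rFree) (reg s5 rDone) (t # us)"
            unfolding rd by (rule pend_at_mono[OF d2 lo5 m52])
          have "100 + (i3 + i4) \<le> 1000 * (k * k * m)" using i3 i4 big by linarith
          then show "\<forall>q\<le>100 + (i3 + i4). Q q s5"
            using c5 p5 d5 Branch by (auto intro!: post simp del: pend_at.simps)
        qed (use f4 r4 p4 ch t in auto)
      qed (use f2 r2 n2 ct2 ts2 ch t in \<open>auto simp: fresh_def\<close>)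
      then show ?thesis using n2(1) i by simp (elim wp_mono, simp)
    qed
  qed (use cd nt ct dn in \<open>auto simp: fresh_def\<close>)
  then show ?thesis
    unfolding down_body_def by simp (elim wp_mono, auto split: if_splits elim!: wp_mono)
qed

lemma wp_down_com:
  assumes c: "ctx s" and T: "node_at (mem s) (reg s rFree) (reg s rStack) T"
    and post: "\<And>i s'. i \<le> length (nodes T) * (1000 * (k * k * m) + 10) + 60 \<Longrightarrow> ctx s' \<Longrightarrow>
       pend_at (mem s') (reg s' rFree) (reg s' rDone) (rev (nodes T)) \<Longrightarrow> Q i s'"
  shows "wp down_com Q s"
proof -
  let ?N = "length (nodes T)" and ?C = "1000 * (k * k * m) + 10"
  \<comment> \<open>The pending list is the forest of subtrees not yet visited, whose preorder is
    what remains of the preorder of \<open>T\<close>.\<close>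
  let ?I = "\<lambda>j s'. ctx s' \<and>
     pend_at (mem s') (reg s' rFree) (reg s' rDone) (rev (take j (nodes T))) \<and>
     (\<exists>ts. concat (map nodes ts) = drop j (nodes T) \<and>
        pend_at (mem s') (reg s' rFree) (reg s' rPend) ts)"
  note cd = c[unfolded ctx_def]
  let ?s1 = "s\<lparr>reg := (reg s)(rPend := 0, rDone := 0)\<rparr>"
  have "wp (push_com rPend rStack rZero)
     (\<lambda>i. wp (While (Neq (Reg rPend) (Const 0)) down_body) (\<lambda>j s'. \<forall>q\<le>10 + (i + j). Q q s')) ?s1"
  proof (rule wp_push_com[where t = T and ts = "[]"])
    show "family_at (mem ?s1) (reg ?s1 rFree) (reg ?s1 rZero) (cofam T)"
      unfolding family_at_def cofam_root using cd by (intro exI[of _ "[{}]"]) simp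
    fix i :: nat and s2 :: state
    assume i: "i \<le> 30" and f2: "fresh s2" "reg ?s1 rFree \<le> reg s2 rFree"
      and m2: "\<And>a. a < reg ?s1 rFree \<Longrightarrow> mem s2 a = mem ?s1 a"
      and p2: "pend_at (mem s2) (reg s2 rFree) (reg s2 rPend) [T]"
      and r2: "\<And>q. q \<notin> {rPend, rFree} \<Longrightarrow> reg s2 q = reg ?s1 q"
    have c2: "ctx s2" by (rule ctx_mono[OF c f2(1)]) (use f2 m2 r2 cd in auto)
    have d2: "reg s2 rDone = 0" using r2[of rDone] by simp
    show "wp (While (Neq (Reg rPend) (Const 0)) down_body) (\<lambda>j s'. \<forall>q\<le>10 + (i + j). Q q s') s2"
      apply (rule wp_for[where N = ?N and C = ?C and I = ?I])
      subgoal using c2 d2 p2 by (auto intro!: exI[of _ "[T]"])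
      subgoal premises st for j s'
      proof -
        have I: "ctx s'" "pend_at (mem s') (reg s' rFree) (reg s' rDone) (rev (take j (nodes T)))"
          using st(2) by blast+
        from st(2) obtain ts where ts: "concat (map nodes ts) = drop j (nodes T)"
          "pend_at (mem s') (reg s' rFree) (reg s' rPend) ts"
          by blast
        let ?t = "nodes T ! j"
        have dj: "drop j (nodes T) = ?t # drop (Suc j) (nodes T)"
          using st(1) by (simp add: Cons_nth_drop_Suc)
        then obtain t vs where p: "ts = t # vs" using ts(1) by (cases ts) auto
        have t: "t = ?t" and rest: "concat (map nodes (children t @ vs)) = drop (Suc j) (nodes T)"
          using ts(1) dj unfolding p by (auto simp: nodes_children[of t])
        have tT: "t \<in> set (nodes T)" using st(1) t by simp
        have tk: "rev (take (Suc j) (nodes T)) = t # rev (take j (nodes T))"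
          using st(1) t by (simp add: take_Suc_conv_app_nth)
        have "wp down_body (\<lambda>q s''. q + cost_test (Neq (Reg rPend) (Const 0)) \<le> ?C \<and> ?I (Suc j) s'') s'"
        proof (rule wp_down_body[OF I(1) tT ts(2)[unfolded p] I(2)])
          fix q :: nat and s'' :: state
          assume q: "q \<le> 1000 * (k * k * m)" and *: "ctx s''"
            "pend_at (mem s'') (reg s'' rFree) (reg s'' rPend) (children t @ vs)"
            "pend_at (mem s'') (reg s'' rFree) (reg s'' rDone) (t # rev (take j (nodes T)))"
          have "\<exists>ts. concat (map nodes ts) = drop (Suc j) (nodes T) \<and>
            pend_at (mem s'') (reg s'' rFree) (reg s'' rPend) ts"
            using rest *(2) by blast
          then show "q + cost_test (Neq (Reg rPend) (Const 0)) \<le> ?C \<and> ?I (Suc j) s''"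
            unfolding tk using q *(1,3) by simp
        qed
        then show ?thesis using ts(2) p by simp
      qed
      subgoal premises st for s'
      proof -
        from st(1) obtain ts where
          ts: "concat (map nodes ts) = drop ?N (nodes T)" "pend_at (mem s') (reg s' rFree) (reg s' rPend) ts"
          by blast
        then have "ts = []" by (cases ts) (auto simp: nodes_nonempty)
        then show ?thesis using ts(2) by simp
      qed
      subgoal premises st for q s'
        using st(1,2) i by (auto intro!: post)
      done
  qed (use cd T in \<open>auto simp: fresh_def\<close>)
  then show ?thesis
    unfolding down_com_def by simp (elim wp_mono, simp)
qed

lemma wp_rev_com:
  assumes c: "ctx s" and D: "pend_at (mem s) (reg s rFree) (reg s rDone) (rev ts)"
    and post: "\<And>i s'. i \<le> length ts * 70 + 20 \<Longrightarrow> ctx s' \<Longrightarrow>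
       pend_at (mem s') (reg s' rFree) (reg s' rRev) ts \<Longrightarrow> Q i s'"
  shows "wp rev_com Q s"
proof -
  let ?N = "length ts"
  let ?I = "\<lambda>j s'. ctx s' \<and>
     pend_at (mem s') (reg s' rFree) (reg s' rDone) (rev (take (?N - j) ts)) \<and>
     pend_at (mem s') (reg s' rFree) (reg s' rRev) (drop (?N - j) ts)"
  show ?thesis
    unfolding rev_com_def
    apply simp
    apply (rule wp_for[where N = ?N and C = 70 and I = ?I])
    subgoal
    proof -
      have "ctx (s\<lparr>reg := (reg s)(rRev := 0)\<rparr>)"
        by (rule ctx_mono[OF c]) (use c in \<open>auto simp: ctx_def fresh_def\<close>)
      then show ?thesis using D by simp
    qed
    subgoal premises st for j s'
    proof -
      define i where "i = ?N - Suc j"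
      have i: "?N - j = Suc i" "i < ?N" using st(1) by (simp_all add: i_def)
      let ?t = "ts ! i" let ?p = "reg s' rDone"
      have c': "ctx s'" and R: "pend_at (mem s') (reg s' rFree) (reg s' rRev) (drop (Suc i) ts)"
        and Dn: "pend_at (mem s') (reg s' rFree) ?p (?t # rev (take i ts))"
        using st(2) i(2) unfolding i(1) by (simp_all add: take_Suc_conv_app_nth)
      note cd = c'[unfolded ctx_def]
      let ?s1 = "s'\<lparr>reg := (reg s')(rNd := mem s' ?p, rCo := mem s' (?p + 1), rDone := mem s' (?p + 2))\<rparr>"
      have "wp (push_com rRev rNd rCo) (\<lambda>q s''. q + 25 \<le> 70 \<and> ?I (Suc j) s'') ?s1"
      proof (rule wp_push_com[where t = ?t and ts = "drop (Suc i) ts"])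
        fix q :: nat and s2 :: state
        assume q: "q \<le> 30" and f2: "fresh s2" "reg ?s1 rFree \<le> reg s2 rFree"
          and m2: "\<And>a. a < reg ?s1 rFree \<Longrightarrow> mem s2 a = mem ?s1 a"
          and p2: "pend_at (mem s2) (reg s2 rFree) (reg s2 rRev) (?t # drop (Suc i) ts)"
          and r2: "\<And>q. q \<notin> {rRev, rFree} \<Longrightarrow> reg s2 q = reg ?s1 q"
        have c2: "ctx s2" by (rule ctx_mono[OF c' f2(1)]) (use f2 m2 r2 in auto)
        have "pend_at (mem s2) (reg s2 rFree) (mem s' (?p + 2)) (rev (take i ts))"
          by (rule pend_at_mono[where \<mu> = "mem s'" and u = "reg s' rFree"]) (use Dn f2 m2 in auto)
        then have "pend_at (mem s2) (reg s2 rFree) (reg s2 rDone) (rev (take i ts))"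
          using r2[of rDone] by simp
        then show "q + 25 \<le> 70 \<and> ?I (Suc j) s2"
          using q c2 p2 i(2) by (simp add: i_def[symmetric] Cons_nth_drop_Suc del: pend_at.simps)
      qed (use cd Dn R in \<open>auto simp: fresh_def\<close>)
      then show ?thesis using Dn by simp (elim wp_mono, simp)
    qed
    subgoal premises st for s' using st(1) by simp
    subgoal premises st for q s'
      by (intro post) (use st(1,2) in auto)
    done
qed

end

subsection \<open>Writing the output\<close>

definition copy_com :: com where
  "copy_com = Assign rK (Const 0) ;;
     While (Less (Reg rK) (Reg rM))
       (Store (Reg rFree) (Load (at1 rA rK)) ;; incr rFree 1 ;; incr rK 1)"

text \<open>Lists carry no length: the word for the count is reserved at the start and filled after
  the last vector has been copied.\<close>

definition emit_com :: com where
  "emit_com = Assign rCell (Reg rFree) ;; incr rFree 1 ;; Assign rFlag (Const 0) ;;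
     While (Neq (Reg rA) (Const 0)) (copy_com ;; incr rFlag 1 ;; Assign rA (Load (Reg rA))) ;;
     Store (Reg rCell) (Reg rFlag)"

text \<open>From here on only output is allocated, so it occupies one contiguous segment, whose
  start is put into register 0.\<close>

definition out_com :: com where
  "out_com = Assign 0 (Reg rFree) ;;
     While (Neq (Reg rRev) (Const 0))
       (Assign rNd (Load (Reg rRev)) ;; Assign rA (field rNd 3) ;; emit_com ;;
        Assign rA (field rRev 1) ;; emit_com ;; Assign rRev (field rRev 2))"

lemma wregs_copy_com [simp]: "wregs copy_com = {rFree, rK}"
  by (auto simp: copy_com_def)

lemma wregs_emit_com [simp]: "wregs emit_com = {rCell, rFree, rFlag, rK, rA}"
  by (auto simp: emit_com_def)

definition bits :: "nat \<Rightarrow> nat set \<Rightarrow> nat list" where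
  "bits m X = map (\<lambda>j. of_bool (j \<in> X)) [0..<m]"

lemma length_bits [simp]: "length (bits m X) = m"
  by (simp add: bits_def)

lemma seg_bits: "seg \<mu> a (bits m X) \<longleftrightarrow> vec \<mu> a m X"
  by (simp add: seg_def vec_def bits_def)

definition family_words :: "nat \<Rightarrow> nat set list \<Rightarrow> nat list" where
  "family_words m Xs = length Xs # concat (map (bits m) Xs)"

lemma length_concat_bits: "length (concat (map (bits m) Xs)) = length Xs * m"
  by (induction Xs) auto

lemma length_family_words: "length (family_words m Xs) = 1 + length Xs * m"
  by (simp add: family_words_def length_concat_bits)

lemma wp_copy_com:
  assumes m: "reg s rM = m" and X: "vec (mem s) (reg s rA + 1) m X" "reg s rA + m < reg s rFree"
    and post: "\<And>i s'. i \<le> 30 * m + 10 \<Longrightarrow> reg s' rFree = reg s rFree + m \<Longrightarrow>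
      (\<And>a. a < reg s rFree \<Longrightarrow> mem s' a = mem s a) \<Longrightarrow> vec (mem s') (reg s rFree) m X \<Longrightarrow>
      (\<And>r. r \<notin> wregs copy_com \<Longrightarrow> reg s' r = reg s r) \<Longrightarrow> Q i s'"
  shows "wp copy_com Q s"
proof -
  let ?fr = "reg s rFree"
  let ?I = "\<lambda>j s'. reg s' rK = j \<and> reg s' rFree = ?fr + j \<and> (\<forall>a<?fr. mem s' a = mem s a) \<and>
     vec (mem s') ?fr j X"
  show ?thesis
    unfolding copy_com_def
    apply simp
    apply (rule wp_for[where N = m and C = 30 and I = ?I])
    subgoal by (simp add: vec_def)
    subgoal premises st for j s'
    proof -
      have r: "reg s' rM = m" "reg s' rA = reg s rA"
        using st(3)[of rM] st(3)[of rA] m by simp_all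
      have v: "mem s' (reg s rA + (1 + j)) = of_bool (j \<in> X)"
        using st(1,2) X by (simp add: vec_def)
      show ?thesis using st(1,2) r v by (auto simp: vec_def less_Suc_eq)
    qed
    subgoal premises st for s' using st(1) st(2)[of rM] m by simp
    subgoal premises st for q s'
    proof -
      have r: "reg s' q = reg s q" if "q \<notin> wregs copy_com" for q
        using st(3)[of q] that by simp
      show ?thesis by (rule post) (use st(1,2) r in auto)
    qed
    done
qed

lemma wp_emit_com:
  assumes m: "reg s rM = m" and X: "flist (mem s) {..<reg s rFree} m (reg s rA) Xs"
    and post: "\<And>i s'. i \<le> length Xs * (30 * m + 40) + 30 \<Longrightarrow>
      reg s' rFree = reg s rFree + length (family_words m Xs) \<Longrightarrow>
      (\<And>a. a < reg s rFree \<Longrightarrow> mem s' a = mem s a) \<Longrightarrow> seg (mem s') (reg s rFree) (family_words m Xs) \<Longrightarrow>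
      (\<And>r. r \<notin> wregs emit_com \<Longrightarrow> reg s' r = reg s r) \<Longrightarrow> Q i s'"
  shows "wp emit_com Q s"
proof -
  let ?fr = "reg s rFree"
  let ?I = "\<lambda>j s'. reg s' rFlag = j \<and> reg s' rFree = ?fr + 1 + j * m \<and> (\<forall>a<?fr. mem s' a = mem s a) \<and>
     flist (mem s) {..<?fr} m (reg s' rA) (drop j Xs) \<and>
     seg (mem s') (?fr + 1) (concat (map (bits m) (take j Xs)))"
  show ?thesis
    unfolding emit_com_def
    apply simp
    apply (rule wp_for[where N = "length Xs" and C = "30 * m + 40" and I = ?I])
    subgoal using X by simp
    subgoal premises st for j s'
    proof -
      have I: "reg s' rFlag = j" "reg s' rFree = ?fr + 1 + j * m" "\<And>a. a < ?fr \<Longrightarrow> mem s' a = mem s a"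
        "flist (mem s) {..<?fr} m (reg s' rA) (drop j Xs)"
        "seg (mem s') (?fr + 1) (concat (map (bits m) (take j Xs)))" using st(2) by blast+
      note d = flist_drop[OF I(4) st(1)]
      have r: "reg s' rM = m" using st(3)[of rM] m by simp
      have v: "vec (mem s') (reg s' rA + 1) m (Xs ! j)"
        by (rule vec_cong[OF d(3)]) (use d(2) I(3) in simp)
      have a: "mem s' (reg s' rA) = mem s (reg s' rA)" using d(2) I(3) by simp
      have "wp copy_com (\<lambda>q s2. q + 20 \<le> 30 * m + 40 \<and> ?I (Suc j)
          (s2\<lparr>reg := (reg s2)(rFlag := Suc (reg s2 rFlag), rA := mem s2 (reg s2 rA))\<rparr>)) s'"
      proof (rule wp_copy_com[OF r v])
        fix q :: nat and s2 :: state
        assume q: "q \<le> 30 * m + 10" and F: "reg s2 rFree = reg s' rFree + m"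
          and m2: "\<And>a. a < reg s' rFree \<Longrightarrow> mem s2 a = mem s' a" and v2: "vec (mem s2) (reg s' rFree) m (Xs ! j)"
          and r2: "\<And>r. r \<notin> wregs copy_com \<Longrightarrow> reg s2 r = reg s' r"
        have "seg (mem s2) (?fr + 1) (concat (map (bits m) (take j Xs)))"
          by (rule seg_cong[OF I(5)]) (use m2 I(2) st(1) in \<open>simp add: length_concat_bits\<close>)
        then have "seg (mem s2) (?fr + 1) (concat (map (bits m) (take (Suc j) Xs)))"
          using v2 st(1) I(2) by (simp add: take_Suc_conv_app_nth length_concat_bits seg_bits)
        moreover have "mem s2 (reg s2 rA) = mem s (reg s' rA)"
          using r2[of rA] m2 d(2) I(2) a by simp
        ultimately show "q + 20 \<le> 30 * m + 40 \<and> ?I (Suc j)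
          (s2\<lparr>reg := (reg s2)(rFlag := Suc (reg s2 rFlag), rA := mem s2 (reg s2 rA))\<rparr>)"
          using q F I(1,2,3) r2[of rFlag] m2 d(4) by simp
      qed (use d(2) I(2) in simp)
      then show ?thesis using d(1) by simp (elim wp_mono, simp)
    qed
    subgoal premises st for s' using st(1) by simp
    subgoal premises st for q s'
    proof -
      have I: "reg s' rFlag = length Xs" "reg s' rFree = ?fr + 1 + length Xs * m"
        "\<And>a. a < ?fr \<Longrightarrow> mem s' a = mem s a"
        "seg (mem s') (?fr + 1) (concat (map (bits m) Xs))" using st(2) by simp_all
      have r: "reg s' q = reg s q" if "q \<notin> wregs emit_com" for q
        using st(3)[of q] that by simp
      have c: "reg s' rCell = ?fr" using st(3)[of rCell] by simp
      let ?s = "s'\<lparr>mem := (mem s')(?fr := length Xs)\<rparr>"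
      have "seg (mem ?s) (?fr + 1) (concat (map (bits m) Xs))"
        by (rule seg_cong[OF I(4)]) simp
      then have sg: "seg (mem ?s) ?fr (family_words m Xs)" by (simp add: family_words_def)
      have "Q i ?s" if "i \<le> length Xs * (30 * m + 40) + 30" for i
        by (rule post) (use that I sg r in \<open>auto simp: length_family_words\<close>)
      then show ?thesis using c I(1) st(1) by simp
    qed
    done
qed

context encoded_cnf
begin

text \<open>\<open>encodes_family\<close> asks for an enumeration of sets of clauses. Decoding by
  \<open>g\<close>, which inverts the image under \<gamma> on subsets of \<open>cla F\<close>,
  provides it in the order of the list \<open>Xs\<close>.\<close>

lemma encodes_family_words:
  assumes "distinct Xs" "set Xs = (`) \<gamma> ` \<S>" "\<S> \<subseteq> Pow (cla F)"
  shows "encodes_family \<gamma> (card (cla F)) \<S> (family_words m Xs)"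
proof -
  define g where "g X = {c \<in> cla F. \<gamma> c \<in> X}" for X
  have inv: "g (\<gamma> ` S) = S" if "S \<in> \<S>" for S
  proof -
    have "S \<subseteq> cla F" using that assms(3) by blast
    then show ?thesis using inj_on_image_mem_iff[OF \<gamma>_inj] by (auto simp: g_def)
  qed
  have gX: "\<gamma> ` g X = X \<and> g X \<in> \<S>" if "X \<in> set Xs" for X
  proof -
    obtain S where "S \<in> \<S>" "X = \<gamma> ` S" using \<open>X \<in> set Xs\<close> unfolding assms(2) by (rule imageE) simp
    then show ?thesis using inv by simp
  qed
  have "inj_on g (set Xs)" by (rule inj_on_inverseI[of _ "(`) \<gamma>"]) (use gX in simp)
  then have "distinct (map g Xs)" using assms(1) by (simp add: distinct_map)
  moreover have "set (map g Xs) = \<S>"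
  proof
    show "set (map g Xs) \<subseteq> \<S>" using gX by auto
    show "\<S> \<subseteq> set (map g Xs)"
    proof
      fix S assume S: "S \<in> \<S>"
      then have "\<gamma> ` S \<in> set Xs" unfolding assms(2) by (rule imageI)
      then show "S \<in> set (map g Xs)" using inv[OF S] by force
    qed
  qed
  moreover have "map (char_vec \<gamma> (card (cla F))) (map g Xs) = map (bits m) Xs"
    using gX by (simp add: char_vec_def bits_def m)
  ultimately show ?thesis
    unfolding encodes_family_def family_words_def by (metis length_map)
qed

lemma node_encoded:
  assumes "v \<in> set (nodes T)" "distinct Xs" "set Xs = fam v" "distinct Ys" "set Ys = cofam v"
  shows "\<exists>as bs. family_words m Xs @ family_words m Ys = as @ bs \<and>
           encodes_family \<gamma> (card (cla F)) (PS (F_node F v)) as \<and>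
           encodes_family \<gamma> (card (cla F)) (PS (F_conode F v)) bs"
proof (intro exI conjI)
  have "PS (F_node F v) \<subseteq> Pow (cla F)" "PS (F_conode F v) \<subseteq> Pow (cla F)"
    using node_below(1)[OF assms(1)] by (auto simp: PS_restr F_node_def F_conode_def dest!: ps_sets_subset)
  then show "encodes_family \<gamma> (card (cla F)) (PS (F_node F v)) (family_words m Xs)"
    "encodes_family \<gamma> (card (cla F)) (PS (F_conode F v)) (family_words m Ys)"
    using assms by (auto intro!: encodes_family_words simp: fam_def cofam_def)
qed simp

definition node_words :: "('a + 'b) btree \<Rightarrow> nat list \<Rightarrow> bool" where
  "node_words v us \<longleftrightarrow> (\<exists>as bs. us = as @ bs \<and>
           encodes_family \<gamma> (card (cla F)) (PS (F_node F v)) as \<and>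
           encodes_family \<gamma> (card (cla F)) (PS (F_conode F v)) bs)"

text \<open>Both families of a node have at most \<open>k\<close> members, so writing them costs a
  multiple of \<open>k * m\<close> only.\<close>

lemma wp_out_com:
  assumes c: "ctx s" and D: "pend_at (mem s) (reg s rFree) (reg s rRev) (nodes T)"
    and post: "\<And>i s' ws. i \<le> length (nodes T) * (300 * (k * m)) + 20 \<Longrightarrow>
       seg (mem s') (reg s' 0) ws \<Longrightarrow> encodes_output \<gamma> F T ws \<Longrightarrow> Q i s'"
  shows "wp out_com Q s"
proof -
  let ?u = "reg s rFree" and ?N = "length (nodes T)"
  note cd = c[unfolded ctx_def]
  let ?I = "\<lambda>j s'. (\<forall>a<?u. mem s' a = mem s a) \<and> pend_at (mem s) ?u (reg s' rRev) (drop j (nodes T)) \<and>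
     (\<exists>wss. list_all2 node_words (take j (nodes T)) wss \<and> seg (mem s') ?u (concat wss) \<and>
        reg s' rFree = ?u + length (concat wss))"
  have km: "1 \<le> k * m" "k \<le> k * m" "1 \<le> m" using k_pos m_pos by (simp_all add: Suc_le_eq)
  show ?thesis
    unfolding out_com_def
    apply simp
    apply (rule wp_for[where N = ?N and C = "300 * (k * m)" and I = ?I])
    subgoal using D by (auto intro!: exI[of _ "[]"])
    subgoal premises st for j s'
    proof -
      have I: "\<And>a. a < ?u \<Longrightarrow> mem s' a = mem s a" "pend_at (mem s) ?u (reg s' rRev) (drop j (nodes T))"
        using st(2) by blast+
      from st(2) obtain wss where wss: "list_all2 node_words (take j (nodes T)) wss"
        "seg (mem s') ?u (concat wss)" "reg s' rFree = ?u + length (concat wss)" by blast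
      let ?t = "nodes T ! j" let ?p = "reg s' rRev" let ?n = "mem s ?p"
      have dj: "drop j (nodes T) = ?t # drop (Suc j) (nodes T)"
        using st(1) by (simp add: Cons_nth_drop_Suc)
      have p: "?p \<noteq> 0" "?p + 2 < ?u" "node_at (mem s) ?u ?n ?t"
        "family_at (mem s) ?u (mem s (?p + 1)) (cofam ?t)"
        "pend_at (mem s) ?u (mem s (?p + 2)) (drop (Suc j) (nodes T))"
        using I(2) unfolding dj by simp_all
      note d = node_at_data[OF p(3), unfolded data_at_def]
      have tT: "?t \<in> set (nodes T)" using st(1) by simp
      obtain Xs where Xs: "distinct Xs" "set Xs = fam ?t" "flist (mem s) {..<?u} m (mem s (?n + 3)) Xs"
        using d unfolding family_at_def by blast
      obtain Ys where Ys: "distinct Ys" "set Ys = cofam ?t" "flist (mem s) {..<?u} m (mem s (?p + 1)) Ys"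
        using p(4) unfolding family_at_def by blast
      have len: "length Xs \<le> k" "length Ys \<le> k"
        using fam_facts(7,8)[OF tT] Xs Ys distinct_card[OF Xs(1)] distinct_card[OF Ys(1)] by simp_all
      have e: "mem s' ?p = ?n" "mem s' (?p + 1) = mem s (?p + 1)" "mem s' (?p + 2) = mem s (?p + 2)"
        "mem s' (?n + 3) = mem s (?n + 3)"
        using I(1) p(2) d by simp_all
      have r: "reg s' rM = m" using st(3)[of rM] cd by simp
      have le: "?u \<le> reg s' rFree" using wss(3) by simp
      let ?Z = "\<lambda>q s2. q + 40 \<le> 300 * (k * m) \<and>
         ?I (Suc j) (s2\<lparr>reg := (reg s2)(rRev := mem s2 (reg s2 rRev + 2))\<rparr>)"
      let ?s1 = "s'\<lparr>reg := (reg s')(rNd := ?n, rA := mem s (?n + 3))\<rparr>"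
      have "wp emit_com (\<lambda>i1 s2. wp emit_com (\<lambda>i2. ?Z (i1 + i2))
        (s2\<lparr>reg := (reg s2)(rA := mem s2 (reg s2 rRev + 1))\<rparr>)) ?s1"
      proof (rule wp_emit_com[where Xs = Xs and m = m])
        show "flist (mem ?s1) {..<reg ?s1 rFree} m (reg ?s1 rA) Xs"
          using flist_mono[OF Xs(3), of "{..<reg s' rFree}" "mem s'"] I(1) le by auto
        fix i1 :: nat and s2 :: state
        assume i1: "i1 \<le> length Xs * (30 * m + 40) + 30"
          and F2': "reg s2 rFree = reg ?s1 rFree + length (family_words m Xs)"
          and m2': "\<And>a. a < reg ?s1 rFree \<Longrightarrow> mem s2 a = mem ?s1 a"
          and sg2': "seg (mem s2) (reg ?s1 rFree) (family_words m Xs)"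
          and r2': "\<And>r. r \<notin> wregs emit_com \<Longrightarrow> reg s2 r = reg ?s1 r"
        have F2: "reg s2 rFree = reg s' rFree + length (family_words m Xs)"
          and m2: "\<And>a. a < reg s' rFree \<Longrightarrow> mem s2 a = mem s' a"
          and sg2: "seg (mem s2) (reg s' rFree) (family_words m Xs)"
          using F2' m2' sg2' by simp_all
        have r2: "reg s2 rRev = ?p" "reg s2 rM = m" using r2' r by simp_all
        have m20: "\<And>a. a < ?u \<Longrightarrow> mem s2 a = mem s a" using m2 I(1) le by simp
        have e2: "mem s2 (?p + 1) = mem s (?p + 1)" using m20 p(2) by simp
        let ?s2 = "s2\<lparr>reg := (reg s2)(rA := mem s2 (reg s2 rRev + 1))\<rparr>"
        show "wp emit_com (\<lambda>i2. ?Z (i1 + i2)) ?s2"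
        proof (rule wp_emit_com[where Xs = Ys and m = m])
          have "flist (mem s2) {..<reg s2 rFree} m (mem s (?p + 1)) Ys"
            by (rule flist_mono[OF Ys(3)]) (use m20 F2 le in auto)
          then show "flist (mem ?s2) {..<reg ?s2 rFree} m (reg ?s2 rA) Ys"
            using r2 e2 by simp
          fix i2 :: nat and s3 :: state
          assume i2: "i2 \<le> length Ys * (30 * m + 40) + 30"
            and F3': "reg s3 rFree = reg ?s2 rFree + length (family_words m Ys)"
            and m3': "\<And>a. a < reg ?s2 rFree \<Longrightarrow> mem s3 a = mem ?s2 a"
            and sg3': "seg (mem s3) (reg ?s2 rFree) (family_words m Ys)"
            and r3': "\<And>r. r \<notin> wregs emit_com \<Longrightarrow> reg s3 r = reg ?s2 r"
          have F3: "reg s3 rFree = reg s2 rFree + length (family_words m Ys)"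
            and m3: "\<And>a. a < reg s2 rFree \<Longrightarrow> mem s3 a = mem s2 a"
            and sg3: "seg (mem s3) (reg s2 rFree) (family_words m Ys)"
            using F3' m3' sg3' by simp_all
          have r3: "reg s3 rRev = ?p" using r3' r2 by simp
          have m30: "\<And>a. a < ?u \<Longrightarrow> mem s3 a = mem s a" using m3 m20 F2 le by simp
          let ?w = "family_words m Xs @ family_words m Ys"
          have "seg (mem s3) ?u (concat wss)"
            by (rule seg_cong[OF wss(2)]) (use m2 m3 F2 wss(3) in simp)
          moreover have "seg (mem s3) (reg s' rFree) (family_words m Xs)"
            by (rule seg_cong[OF sg2]) (use m3 F2 in simp)
          ultimately have sg: "seg (mem s3) ?u (concat (wss @ [?w]))"
            using sg3 F2 wss(3) by (simp add: add.assoc)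
          have "node_words ?t ?w"
            unfolding node_words_def by (rule node_encoded[OF tT Xs(1,2) Ys(1,2)])
          then have "list_all2 node_words (take j (nodes T) @ [?t]) (wss @ [?w])"
            using wss(1) by (intro list_all2_appendI) simp_all
          then have la: "list_all2 node_words (take (Suc j) (nodes T)) (wss @ [?w])"
            using st(1) by (simp add: take_Suc_conv_app_nth)
          have e3: "mem s3 (?p + 2) = mem s (?p + 2)" using m30 p(2) by simp
          have "\<exists>wss. list_all2 node_words (take (Suc j) (nodes T)) wss \<and> seg (mem s3) ?u (concat wss) \<and>
            reg s3 rFree = ?u + length (concat wss)"
            by (rule exI[of _ "wss @ [?w]"]) (use la sg F2 F3 wss(3) in simp)
          moreover have "i1 + i2 + 40 \<le> 300 * (k * m)"
          proof -
            have "length Xs * (30 * m + 40) \<le> k * (30 * m + 40)" "length Ys * (30 * m + 40) \<le> k * (30 * m + 40)"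
              using len by (intro mult_le_mono1; simp)+
            moreover have "k * (30 * m + 40) = 30 * (k * m) + 40 * k" by (simp add: algebra_simps)
            ultimately show ?thesis using i1 i2 km by linarith
          qed
          ultimately show "?Z (i1 + i2) s3"
            using m30 e3 r3 p(5) by simp
        qed (use r2 in simp)
      qed (use r in simp)
      then show ?thesis using p(1) e by simp (elim wp_mono, simp)
    qed
    subgoal premises st for s' using st(1) by simp
    subgoal premises st for q s'
    proof -
      from st(2) obtain wss where wss: "list_all2 node_words (nodes T) wss" "seg (mem s') ?u (concat wss)"
        by auto
      have "encodes_output \<gamma> F T (concat wss)"
        using wss(1) unfolding encodes_output_def node_words_def by blast
      moreover have "reg s' 0 = ?u" using st(3)[of 0] by simp
      ultimately show ?thesis using wss(2) st(1) by (intro post) auto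
    qed
    done
qed

end

subsection \<open>The whole program\<close>

definition main_com :: com where
  "main_com = heap_com ;; rows_com ;; zero_com ;; toks_com ;; build_com ;; down_com ;; rev_com ;; out_com"

text \<open>A leaf takes two words, a branch one, and there is one branch fewer than there are
  leaves.\<close>

lemma length_tree_code: "length (tree_code \<gamma> \<nu> t) + 1 \<le> 3 * length (leaves t)"
proof (induction t)
  case (Leaf a)
  then show ?case by (cases a) auto
qed simp

lemma length_clause_words:
  assumes "\<And>ls. ls \<in> set Ls \<Longrightarrow> length ls \<le> b"
  shows "length (clause_words Ls) \<le> length Ls * (b + 1)"
  using assms
proof (induction Ls)
  case (Cons ls Ls)
  have "length ls \<le> b" using Cons.prems by simp
  moreover have "length (clause_words Ls) \<le> length Ls * (b + 1)" using Cons by simp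
  ultimately show ?case by simp
qed simp

context encoded_cnf
begin

lemma nodes_bound: "length (nodes T) \<le> 2 * (m + n)"
  using length_nodes[of T] length_leaves_T by simp

text \<open>The costs 1200, 1000 and 300 per node, doubled because there are up to
  \<open>2 * (m + n)\<close> nodes, account for 5000 of the constant 6000. The rest covers the
  reading of the input and the constant overheads.\<close>

lemma wp_main_com:
  assumes hd: "mem s 0 = n" "mem s 1 = m"
    and inp: "seg (mem s) 2 (clause_words Ls @ tree_code \<gamma> \<nu> T)"
    and z: "\<And>a. 2 + length (clause_words Ls @ tree_code \<gamma> \<nu> T) \<le> a \<Longrightarrow> mem s a = 0"
    and Ls: "\<And>ls. ls \<in> set Ls \<Longrightarrow> set ls \<subseteq> {..<2 * n} \<and> length ls \<le> 2 * n"
    and post: "\<And>i s' ws. i \<le> 6000 * (k * k * (m * (m + n))) \<Longrightarrow>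
       seg (mem s') (reg s' 0) ws \<Longrightarrow> encodes_output \<gamma> F T ws \<Longrightarrow> Q i s'"
  shows "wp main_com Q s"
proof -
  let ?H = "2 + m * (2 * n + 5) + 4 * n"
  let ?cw = "length (clause_words Ls)" and ?tc = "length (tree_code \<gamma> \<nu> T)"
  have cw: "?cw \<le> m * (2 * n + 1)" using length_clause_words[of Ls "2 * n"] Ls length_Ls by simp
  have tc: "?tc \<le> 3 * (m + n)" using length_tree_code[of \<gamma> \<nu> T] length_leaves_T by simp
  have "2 + ?cw + ?tc \<le> 2 + m * (2 * n + 1) + 3 * (m + n)" by (intro add_mono cw tc order_refl)
  also have "\<dots> \<le> ?H" by (simp add: algebra_simps)
  finally have H: "2 + ?cw + ?tc \<le> ?H" .
  have zH: "\<And>a. ?H \<le> a \<Longrightarrow> mem s a = 0" using z H by simp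
  let ?W = "m * (m + n)" let ?V = "k * k * ?W"
  note wb = work_bounds[OF m_pos, of n]
  define W V where "W = ?W" and "V = k * k * W"
  have WV: "?W \<le> ?V" using k_pos by (simp add: Suc_le_eq)
  have Nkm: "length (nodes T) * (k * k * m) \<le> 2 * ?V"
    using mult_le_mono1[OF nodes_bound, of "k * k * m"] by (simp add: algebra_simps)
  have "k * m \<le> k * k * m" using k_pos by (simp add: Suc_le_eq)
  then have Nkm': "length (nodes T) * (k * m) \<le> 2 * ?V"
    using Nkm mult_le_mono2[of "k * m" "k * k * m" "length (nodes T)"] by linarith
  have "m + n \<le> W" unfolding W_def using m_pos by (simp add: Suc_le_eq)
  then have N: "length (nodes T) \<le> 2 * V"
    using nodes_bound WV[folded W_def, folded V_def] by simp
  show ?thesis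
    unfolding main_com_def wp_Seq
  proof (rule wp_heap_com[OF hd m_pos])
    fix i1 :: nat and s1 :: state
    assume i1: "i1 \<le> 100 * ?W" and s1: "reg s1 rFree = ?H" "reg s1 rN = n" "reg s1 rM = m" "mem s1 = mem s"
    have f1: "fresh s1" using s1 zH by (simp add: fresh_def)
    show "wp rows_com (\<lambda>t s'. wp zero_com (\<lambda>u s''. wp toks_com (\<lambda>t' s'. wp build_com (\<lambda>ta s''. wp down_com
       (\<lambda>tb s'. wp rev_com (\<lambda>tc s''. wp out_com (\<lambda>u'. Q (i1 + (t + (u + (t' + (ta + (tb + (tc + u')))))))) s'') s') s'') s') s'') s') s1"
    proof (rule wp_rows_com[OF f1 s1(2)])
      show "reg s1 rM = length Ls" "Ls \<noteq> []" using s1 length_Ls m_pos by auto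
      show "seg (mem s1) 2 (clause_words Ls)" using inp s1 by simp
      show "2 + ?cw \<le> reg s1 rFree" using H s1 by simp
      fix i2 :: nat and s2 :: state
      assume i2: "i2 \<le> 200 * (length Ls * (length Ls + n))" and f2: "fresh s2"
        and F2: "reg s2 rFree = reg s1 rFree + length Ls * (2 * n + 1)" and P2: "reg s2 rPos = 2 + ?cw"
        and R2: "reg s2 rRows = reg s1 rFree" and m2: "\<And>a. a < reg s1 rFree \<Longrightarrow> mem s2 a = mem s1 a"
        and rows: "rows_at (mem s2) n (reg s1 rFree) Ls"
        and r2: "\<And>r. r \<notin> wregs rows_com \<Longrightarrow> reg s2 r = reg s1 r"
      have M2: "reg s2 rM = m" using r2 s1 by simp
      have H2: "?H \<le> reg s2 rFree" using F2 s1 by simp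
      have pos2: "0 < reg s2 rFree" using H2 by simp
      show "wp zero_com (\<lambda>u s''. wp toks_com (\<lambda>t' s'. wp build_com (\<lambda>ta s''. wp down_com
       (\<lambda>tb s'. wp rev_com (\<lambda>tc s''. wp out_com (\<lambda>u'. Q (i1 + (i2 + (u + (t' + (ta + (tb + (tc + u')))))))) s'') s') s'') s') s'') s2"
      proof (rule wp_zero_com[OF f2 pos2 M2])
        fix i3 :: nat and s3 :: state
        assume i3: "i3 \<le> 20 * m + 20" and f3: "fresh s3" "reg s2 rFree \<le> reg s3 rFree" and m3: "mem s3 = mem s2"
          and z3: "flist (mem s3) {..<reg s3 rFree} m (reg s3 rZero) [{}]"
          and r3: "\<And>r. r \<notin> wregs zero_com \<Longrightarrow> reg s3 r = reg s2 r"
        have pos3: "0 < reg s3 rFree" using pos2 f3 by linarith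
        have c3: "ctx s3"
          unfolding ctx_def using pos3 f3 z3 r3 M2 R2 F2 rows m3 length_Ls by (simp del: flist.simps)
        have P3: "reg s3 rPos = 2 + ?cw" using r3 P2 by simp
        have H3: "?H \<le> reg s3 rFree" "0 < reg s3 rFree" using H2 f3 by simp_all
        have mH: "mem s3 a = mem s a" if "a < ?H" for a using that m3 m2[of a] s1 by simp
        have "seg (mem s) (2 + ?cw) (tree_code \<gamma> \<nu> T)" using inp by simp
        then have T3: "seg (mem s3) (reg s3 rPos) (tree_code \<gamma> \<nu> T)"
          unfolding P3 by (rule seg_cong) (use mH H in simp)
        show "wp toks_com (\<lambda>t' s'. wp build_com (\<lambda>ta s''. wp down_com
       (\<lambda>tb s'. wp rev_com (\<lambda>tc s''. wp out_com (\<lambda>u'. Q (i1 + (i2 + (i3 + (t' + (ta + (tb + (tc + u')))))))) s'') s') s'') s') s3"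
        proof (rule wp_toks_com[OF f3(1) H3(2) T3])
          show "reg s3 rPos + ?tc \<le> reg s3 rFree" using P3 H H3 by simp
          fix i4 :: nat and s4 :: state
          assume i4: "i4 \<le> 40 * length (nodes T) + 20" and f4: "fresh s4" "reg s3 rFree \<le> reg s4 rFree"
            and m4: "\<And>a. a < reg s3 rFree \<Longrightarrow> mem s4 a = mem s3 a"
            and t4: "toks_at \<gamma> \<nu> (mem s4) (reg s4 rFree) (reg s4 rToks) (rev (nodes T))"
            and r4: "\<And>r. r \<notin> wregs toks_com \<Longrightarrow> reg s4 r = reg s3 r"
          have c4: "ctx s4" by (rule ctx_mono[OF c3 f4 m4]) (use r4 in auto)
          show "wp build_com (\<lambda>ta s''. wp down_com
            (\<lambda>tb s'. wp rev_com (\<lambda>tc s''. wp out_com (\<lambda>u'. Q (i1 + (i2 + (i3 + (i4 + (ta + (tb + (tc + u')))))))) s'') s') s'') s4"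
          proof (rule wp_build_com[OF c4 t4])
            fix i5 :: nat and s5 :: state
            assume i5: "i5 \<le> length (nodes T) * (1200 * (k * k * m) + 10) + 10" and c5: "ctx s5"
              and n5: "node_at (mem s5) (reg s5 rFree) (reg s5 rStack) T"
            show "wp down_com
              (\<lambda>tb s'. wp rev_com (\<lambda>tc s''. wp out_com (\<lambda>u'. Q (i1 + (i2 + (i3 + (i4 + (i5 + (tb + (tc + u')))))))) s'') s') s5"
            proof (rule wp_down_com[OF c5 n5])
              fix i6 :: nat and s6 :: state
              assume i6: "i6 \<le> length (nodes T) * (1000 * (k * k * m) + 10) + 60" and c6: "ctx s6"
                and p6: "pend_at (mem s6) (reg s6 rFree) (reg s6 rDone) (rev (nodes T))"
              show "wp rev_com (\<lambda>tc s''. wp out_com (\<lambda>u'. Q (i1 + (i2 + (i3 + (i4 + (i5 + (i6 + (tc + u')))))))) s'') s6"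
              proof (rule wp_rev_com[OF c6 p6])
                fix i7 :: nat and s7 :: state
                assume i7: "i7 \<le> length (nodes T) * 70 + 20" and c7: "ctx s7"
                  and p7: "pend_at (mem s7) (reg s7 rFree) (reg s7 rRev) (nodes T)"
                show "wp out_com (\<lambda>u'. Q (i1 + (i2 + (i3 + (i4 + (i5 + (i6 + (i7 + u')))))))) s7"
                proof (rule wp_out_com[OF c7 p7])
                  fix i8 :: nat and s8 :: state and ws
                  assume i8: "i8 \<le> length (nodes T) * (300 * (k * m)) + 20"
                    and out: "seg (mem s8) (reg s8 0) ws" "encodes_output \<gamma> F T ws"
                  have "length (nodes T) * (1200 * (k * k * m) + 10) =
                      1200 * (length (nodes T) * (k * k * m)) + 10 * length (nodes T)"
                    "length (nodes T) * (1000 * (k * k * m) + 10) =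
                      1000 * (length (nodes T) * (k * k * m)) + 10 * length (nodes T)"
                    "length (nodes T) * (300 * (k * m)) = 300 * (length (nodes T) * (k * m))"
                    by (simp_all add: algebra_simps)
                  moreover have "i2 \<le> 200 * W" unfolding W_def using i2 length_Ls by simp
                  moreover note i1[folded W_def] i3 i4 i5 i6 i7 i8
                    wb[folded W_def] WV[folded W_def, folded V_def]
                    Nkm[folded W_def, folded V_def] Nkm'[folded W_def, folded V_def]
                    N
                  ultimately have "i1 + (i2 + (i3 + (i4 + (i5 + (i6 + (i7 + i8)))))) \<le> 6000 * V"
                    by linarith
                  then show "Q (i1 + (i2 + (i3 + (i4 + (i5 + (i6 + (i7 + i8))))))) s8"
                    unfolding V_def W_def using out by (rule post)
                qed
              qed
            qed
          qed
        qed
      qed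
    qed (use Ls in auto)
  qed
qed

end

text \<open>A purely syntactic check: 30 bounds the cost and the sum of constants of every single
  expression in the program, and neither depends on the input.\<close>

lemma slow_main_com: "slow_com 30 main_com"
  by (simp add: main_com_def heap_com_def rows_com_def row_com_def zero_com_def toks_com_def build_com_def
      build_body_def finish_com_def prep_com_def branch_com_def clause_com_def var_com_def col_com_def
      union_com_def skip_com_def product_com_def product_body_def mix_com_def insert_com_def
      down_com_def down_body_def side_com_def push_com_def rev_com_def out_com_def emit_com_def copy_com_def
      small_exp_def)

context decomposed_cnf
begin

lemma lit_code_bound: "c \<in> cla F \<Longrightarrow> l \<in> lits F c \<Longrightarrow> lit_code \<nu> l < 2 * n"
proof -
  assume "c \<in> cla F" "l \<in> lits F c"
  then have "lit_var l \<in> vars F" by (auto simp: vars_def)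
  then have "\<nu> (lit_var l) < n" using \<nu>_image by auto
  then show ?thesis by (cases l) auto
qed

text \<open>Half of a code is the number of the variable and its parity the sign. The codes of a
  clause are thus distinct and, being below \<open>2 * n\<close>, at most \<open>2 * n\<close> in
  number; the initial heap address depends on this.\<close>

lemma lit_code_inj: "c \<in> cla F \<Longrightarrow> inj_on (lit_code \<nu>) (lits F c)"
proof (rule inj_onI)
  fix l l' assume c: "c \<in> cla F" and l: "l \<in> lits F c" "l' \<in> lits F c" and e: "lit_code \<nu> l = lit_code \<nu> l'"
  have v: "lit_var l \<in> vars F" "lit_var l' \<in> vars F" using c l by (auto simp: vars_def)
  have code: "\<nu> (lit_var x) = lit_code \<nu> x div 2"
    "x = (if even (lit_code \<nu> x) then Pos (lit_var x) else Neg (lit_var x))"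
    for x :: "'v literal" by (cases x; simp)+
  have "\<nu> (lit_var l) = \<nu> (lit_var l')" unfolding code e ..
  then have "lit_var l = lit_var l'" using \<nu>_inj v by (auto simp: inj_on_def)
  then have "l = (if even (lit_code \<nu> l') then Pos (lit_var l') else Neg (lit_var l'))"
    using code(2)[of l] unfolding e by metis
  then show "l = l'" using code(2)[of l'] by metis
qed

lemma input_words:
  assumes "encodes_input \<gamma> \<nu> F T ws"
  obtains Ls where "encoded_cnf F T \<gamma> \<nu> m n k Ls" "ws = n # m # clause_words Ls @ tree_code \<gamma> \<nu> T"
    "\<And>ls. ls \<in> set Ls \<Longrightarrow> set ls \<subseteq> {..<2 * n} \<and> length ls \<le> 2 * n"
proof -
  from assms obtain wss where wss: "length wss = m"
    "\<And>c. c \<in> cla F \<Longrightarrow> encodes_clause \<nu> (lits F c) (wss ! \<gamma> c)"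
    "ws = n # m # concat wss @ tree_code \<gamma> \<nu> T"
    unfolding encodes_input_def encodes_cnf_def m n by auto
  \<comment> \<open>The code of a clause starts with its length, which \<open>tl\<close>
    removes.\<close>
  define Ls where "Ls = map tl wss"
  have cl: "wss ! \<gamma> c = length (Ls ! \<gamma> c) # Ls ! \<gamma> c \<and> set (Ls ! \<gamma> c) = lit_code \<nu> ` lits F c \<and>
      distinct (Ls ! \<gamma> c)" if c: "c \<in> cla F" for c
  proof -
    obtain ls where ls: "distinct ls" "set ls = lits F c" "wss ! \<gamma> c = length ls # map (lit_code \<nu>) ls"
      using wss(2)[OF c] unfolding encodes_clause_def by blast
    have "\<gamma> c < length wss" using c \<gamma>_image wss(1) by auto
    then have "Ls ! \<gamma> c = map (lit_code \<nu>) ls" using ls(3) by (simp add: Ls_def)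
    moreover have "distinct (map (lit_code \<nu>) ls)" using ls lit_code_inj[OF c] by (simp add: distinct_map)
    ultimately show ?thesis using ls by simp
  qed
  have len: "length Ls = m" using wss(1) by (simp add: Ls_def)
  have ex: "\<exists>c\<in>cla F. j = \<gamma> c" if "j < m" for j using that \<gamma>_image by blast
  have "wss = map (\<lambda>ls. length ls # ls) Ls"
  proof (rule nth_equalityI)
    show "length wss = length (map (\<lambda>ls. length ls # ls) Ls)" by (simp add: Ls_def)
    fix j assume "j < length wss"
    then have j: "j < m" using wss(1) by simp
    then obtain c where "c \<in> cla F" "j = \<gamma> c" using ex by blast
    then have "wss ! j = length (Ls ! j) # Ls ! j" using cl[of c] by simp
    then show "wss ! j = map (\<lambda>ls. length ls # ls) Ls ! j" using j len by simp
  qed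
  then have 2: "ws = n # m # clause_words Ls @ tree_code \<gamma> \<nu> T" using wss(3) by simp
  have 1: "encoded_cnf F T \<gamma> \<nu> m n k Ls"
  proof unfold_locales
    show "length Ls = m" by (rule len)
    show "\<And>c. c \<in> cla F \<Longrightarrow> set (Ls ! \<gamma> c) = lit_code \<nu> ` lits F c" using cl by blast
  qed
  have "set ls \<subseteq> {..<2 * n} \<and> length ls \<le> 2 * n" if ls: "ls \<in> set Ls" for ls
  proof -
    obtain j where "j < length Ls" "ls = Ls ! j" using ls by (auto simp: in_set_conv_nth)
    then obtain c where c: "c \<in> cla F" "ls = Ls ! \<gamma> c" using ex[of j] len by auto
    have sub: "set ls \<subseteq> {..<2 * n}" using cl[OF c(1)] lit_code_bound[OF c(1)] c(2) by auto
    have "distinct ls" using cl[OF c(1)] c(2) by simp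
    then have "length ls = card (set ls)" by (simp only: distinct_card)
    also have "\<dots> \<le> 2 * n" using card_mono[OF _ sub] by simp
    finally show ?thesis using sub by simp
  qed
  then show ?thesis using that 1 2 by blast
qed

lemma tree_code_bound:
  assumes "v \<in> set (nodes T)" "w \<in> set (tree_code \<gamma> \<nu> v)"
  shows "w \<le> m + n + 2"
  using assms
proof (induction v)
  case (Leaf a)
  show ?case
  proof (cases a)
    case (Inl c)
    then have "\<gamma> c < m" using node_below(1)[OF Leaf(1)] \<gamma>_image by (auto simp: below_Leaf)
    then show ?thesis using Leaf(2) Inl by auto
  next
    case (Inr x)
    then have "\<nu> x < n" using node_below(2)[OF Leaf(1)] \<nu>_image by (auto simp: below_Leaf)
    then show ?thesis using Leaf(2) Inr by auto
  qed
next
  case (Branch l r)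
  then show ?case using branch_disjoint(3,4)[OF Branch.prems(1)] by auto
qed

end

text \<open>The left side is what \<open>exec_slow\<close> demands for \<open>K = 30\<close> and
  initial words up to \<open>2 * n + m + 2\<close>.\<close>

lemma word_bound:
  fixes m n k t :: nat
  assumes "0 < m" "0 < k" "t \<le> 6000 * (k * k * (m * (m + n)))"
  shows "30 * ((2 * n + m + 2) + 30 * t) + 30 < (m + n + k) ^ 40"
proof -
  define x where "x = m + n + k"
  have le: "m \<le> x" "m + n \<le> x" "k \<le> x" "2 \<le> x" using assms by (simp_all add: x_def)
  have "k * k * (m * (m + n)) \<le> x * x * (x * x)" by (intro mult_le_mono le)
  also have "\<dots> = x ^ 4" by (simp add: power4_eq_xxxx mult.assoc)
  finally have t: "t \<le> 6000 * x ^ 4" using assms(3) by linarith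
  have "x ^ 1 \<le> x ^ 4" by (rule power_increasing) (use le in auto)
  then have x4: "x \<le> x ^ 4" by simp
  \<comment> \<open>The term \<open>900 * 6000 * x ^ 4\<close> dominates. As \<open>m\<close> and
    \<open>k\<close> are positive, \<open>x\<close> is at least 2, so that 36 further factors
    \<open>x\<close> outweigh the numerical constant.\<close>
  have "30 * ((2 * n + m + 2) + 30 * t) + 30 \<le> 6000000 * x ^ 4" using t x4 le by simp
  also have "\<dots> < 2 ^ 36 * x ^ 4" using le by simp
  also have "\<dots> \<le> x ^ 36 * x ^ 4" by (intro mult_le_mono1 power_mono le) simp
  also have "\<dots> = x ^ 40" using power_add[of x 36 4] by simp
  finally show ?thesis unfolding x_def .
qed

theorem theorem1:
  "\<exists>(p :: com) (a :: real) (d :: nat).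
     \<forall>(F :: (nat, nat) cnf) (T :: (nat + nat) btree) (\<gamma> :: nat \<Rightarrow> nat) (\<nu> :: nat \<Rightarrow> nat)
       (ws :: nat list) (k :: nat) (m :: nat) (n :: nat).
       wf_cnf F \<and> m = card (cla F) \<and> n = card (vars F) \<and>
       branch_decomposition F T \<and> k = ps_width F T \<and>
       numbering \<gamma> (cla F) \<and> numbering \<nu> (vars F) \<and> encodes_input \<gamma> \<nu> F T ws \<longrightarrow>
       (\<exists>t s out. exec ((m + n + k) ^ d) p (initial_state ws) t s \<and>
          output_is s out \<and> encodes_output \<gamma> F T out \<and>
          real t \<le> a * time_bound k m n)"
\<comment> \<open>The constant 6000 comes from \<open>wp_main_com\<close>, the exponent 40 from
  \<open>word_bound\<close>.\<close>
proof (rule exI[of _ main_com], rule exI[of _ "6000 :: real"], rule exI[of _ "40 :: nat"],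
    intro allI impI, elim conjE)
  fix F :: "(nat, nat) cnf" and T :: "(nat + nat) btree" and \<gamma> \<nu> :: "nat \<Rightarrow> nat"
    and ws :: "nat list" and k m n :: nat
  assume A: "wf_cnf F" "m = card (cla F)" "n = card (vars F)" "branch_decomposition F T"
    "k = ps_width F T" "numbering \<gamma> (cla F)" "numbering \<nu> (vars F)" and ws: "encodes_input \<gamma> \<nu> F T ws"
  interpret decomposed_cnf F T \<gamma> \<nu> m n k using A by unfold_locales
  obtain Ls where enc: "encoded_cnf F T \<gamma> \<nu> m n k Ls" and
    W: "ws = n # m # clause_words Ls @ tree_code \<gamma> \<nu> T" and
    Ls: "\<And>ls. ls \<in> set Ls \<Longrightarrow> set ls \<subseteq> {..<2 * n} \<and> length ls \<le> 2 * n"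
    by (rule input_words[OF ws]) (rule that)
  interpret E: encoded_cnf F T \<gamma> \<nu> m n k Ls by (rule enc)
  let ?s = "initial_state ws" let ?M = "2 * n + m + 2"
  have sg: "seg (mem ?s) 0 ws" by (simp add: seg_def initial_state_def)
  have "wp main_com (\<lambda>t s. t \<le> 6000 * (k * k * (m * (m + n))) \<and>
      (\<exists>out. seg (mem s) (reg s 0) out \<and> encodes_output \<gamma> F T out)) ?s"
  proof (rule E.wp_main_com)
    show "mem ?s 0 = n" "mem ?s 1 = m" "seg (mem ?s) 2 (clause_words Ls @ tree_code \<gamma> \<nu> T)"
      using sg unfolding W by (simp_all add: numeral_2_eq_2)
    show "\<And>a. 2 + length (clause_words Ls @ tree_code \<gamma> \<nu> T) \<le> a \<Longrightarrow> mem ?s a = 0"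
      by (simp add: initial_state_def W)
  qed (use Ls in auto)
  then obtain t s B where ex: "exec B main_com ?s t s" and t: "t \<le> 6000 * (k * k * (m * (m + n)))"
    and out: "\<exists>out. seg (mem s) (reg s 0) out \<and> encodes_output \<gamma> F T out"
    unfolding wp_def run_def by blast
  \<comment> \<open>Lengths and codes of clauses are at most \<open>2 * n\<close>, words of the tree
    code at most \<open>m + n + 2\<close>.\<close>
  have wsM: "w \<le> ?M" if w: "w \<in> set ws" for w
  proof -
    consider "w = n" | "w = m" | "w \<in> set (clause_words Ls)" | "w \<in> set (tree_code \<gamma> \<nu> T)"
      using w unfolding W list.set set_append by blast
    then show ?thesis
    proof cases
      case 3
      then obtain ls where "ls \<in> set Ls" "w = length ls \<or> w \<in> set ls" by auto
      then show ?thesis using Ls[of ls] by auto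
    next
      case 4
      then show ?thesis using tree_code_bound[OF mem_nodes] by fastforce
    qed auto
  qed
  have "bounded_state ?M ?s"
    unfolding bounded_state_def initial_state_def using wsM by simp
  \<comment> \<open>The run was found for some bound \<open>B\<close>; only here is it confined to
    the polynomial one.\<close>
  then have "exec ((m + n + k) ^ 40) main_com ?s t s"
    using exec_slow[OF ex slow_main_com] word_bound[OF m_pos k_pos t] by blast
  moreover obtain ou where ou: "seg (mem s) (reg s 0) ou" "encodes_output \<gamma> F T ou" using out by blast
  moreover have "output_is s ou" using ou(1) by (simp add: output_is_def seg_def)
  moreover have "real t \<le> 6000 * time_bound k m n"
  proof -
    \<comment> \<open>The factor \<open>max 1 (log 2 (real k))\<close> is at least 1, so the bound
      without a logarithm suffices.\<close>
    have "real t \<le> real (6000 * (k * k * (m * (m + n))))" using t by (simp only: of_nat_le_iff)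
    also have "\<dots> = 6000 * ((real k)\<^sup>2 * 1 * real m * (real m + real n))"
      by (simp add: power2_eq_square)
    also have "\<dots> \<le> 6000 * time_bound k m n"
      unfolding time_bound_def by (intro mult_left_mono mult_right_mono) auto
    finally show ?thesis .
  qed
  ultimately show "\<exists>t s out. exec ((m + n + k) ^ 40) main_com (initial_state ws) t s \<and>
          output_is s out \<and> encodes_output \<gamma> F T out \<and> real t \<le> 6000 * time_bound k m n"
    by blast
qed

end
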